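(* For every $u\in[0,\infty]$ there exists an ergodic Lebesgue measure preserving rigid transformation $T$ whose lower measure-theoretic slow entropy with respect to the polynomial scale $a_n(t)=n^t$ satisfies $\underline{\mathrm{ent}}^{\mu}_{n^t}(T)=u$.
   Context: "Lebesgue measure preserving transformation" means an invertible transformation $T$ of $X$ preserving normalized Lebesgue measure $\mu$; the constructions can be viewed as taking place on $X=\mathbb{T}^2=\mathbb{R}^2/\mathbb{Z}^2$, the disc $\mathbb{D}$, or the annulus $\mathbb{A}=\mathbb{S}^1\times[0,1]$. Rigid: there is an increasing sequence $\{t_n\}_{n\in\mathbb{N}}$ of positive integers such that $f\circ T^{t_n}\to f$ in $L^2$ for every $f\in L^2(X,\mu)$. Slow entropy. Let $T$ be an (invertible) measure-preserving transformation of a standard Borel probability space $(X,\mathcal{B},\mu)$, $\mathcal{P}=\{P_1,\dots,P_m\}$ a finite measurable partition. The $n$-name of $x$ is $w(x)=(w_k(x))_{k=0}^{n-1}\in\{1,\dots,m\}^n$ with $T^k(x)\in P_{w_k(x)}$. For words of length $n$, $d_n^H(w,w')=\frac1n\#\{0\le k\le n-1: w_k\ne w'_k\}$ (Hamming metric). Put $B_{\mathcal{P},n}(x,T,\epsilon)=\{y\in X: d_n^H(w(x),w(y))<\epsilon\}$ and let $S_{\mathcal{P}}(T,n,\epsilon)$ be the minimal cardinality of a family of such balls whose union has $\mu$-measure greater than $1-\epsilon$. For a family $\{a_n(t)\}_{n\in\mathbb{N},t>0}$ of positive sequences increasing to infinity and monotone in $t$, let $B(\epsilon,\mathcal{P})=\{t>0:\liminf_{n\to\infty}\frac{S_{\mathcal{P}}(T,n,\epsilon)}{a_n(t)}>0\}$,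 $A(\epsilon,\mathcal{P})=\sup B(\epsilon,\mathcal{P})$ if this set is nonempty and $A(\epsilon,\mathcal{P})=0$ otherwise. The lower slow entropy is $\underline{\mathrm{ent}}_{a_n(t)}^{\mu}(T)=\sup_{\mathcal{P}}\lim_{\epsilon\to0}A(\epsilon,\mathcal{P})$, the supremum being over finite measurable partitions. *)

theory Defs
  imports "HOL-Probability.Probability"
begin

section \<open>The phase spaces\<close>

definition normalized_lebesgue :: "'a::euclidean_space set \<Rightarrow> 'a measure" where
  "normalized_lebesgue X = uniform_measure (restrict_space lborel X) X"

text \<open>As a measure space, the circle \<open>\<real>/\<int>\<close> is represented by its fundamental domain \<open>[0,1)\<close>.\<close>

definition torus :: "(real \<times> real) set" where
  "torus = {0..<1} \<times> {0..<1}"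

definition disc :: "(real \<times> real) set" where
  "disc = cball 0 1"

definition annulus :: "(real \<times> real) set" where
  "annulus = {0..<1} \<times> {0..1}"

lemma prob_space_normalized_lebesgue:
  assumes "X \<in> {torus, disc, annulus}"
  shows "prob_space (normalized_lebesgue X)"
    and "space (normalized_lebesgue X) = X"
    and "sets (normalized_lebesgue X) = sets (restrict_space borel X)"
proof -
  have X: "X \<in> sets borel"
    using assms by (auto simp: torus_def disc_def annulus_def intro!: borel_Times)
  have "bounded X"
    using assms by (auto simp: torus_def disc_def annulus_def intro!: bounded_Times)
  then have fin: "emeasure lborel X \<noteq> \<infinity>"
    using emeasure_bounded_finite[of X] by auto
  have "\<exists>a r. 0 < r \<and> ball a r \<subseteq> X"
    using assms
  proof (elim insertE emptyE)
    assume "X = disc"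
    then show ?thesis by (intro exI[of _ 0] exI[of _ 1]) (auto simp: disc_def)
  next
    assume "X = torus"
    moreover have "box (0, 0) (1, 1) \<subseteq> torus"
      by (auto simp: torus_def box_def Basis_prod_def inner_prod_def)
    moreover have "(1/2, 1/2) \<in> box (0, 0) (1 :: real, 1 :: real)"
      by (auto simp: box_def Basis_prod_def inner_prod_def)
    ultimately show ?thesis
      using open_box[unfolded open_contains_ball, of "(0, 0)" "(1, 1) :: real \<times> real"] by blast
  next
    assume "X = annulus"
    moreover have "box (0, 0) (1, 1) \<subseteq> annulus"
      by (auto simp: annulus_def box_def Basis_prod_def inner_prod_def)
    moreover have "(1/2, 1/2) \<in> box (0, 0) (1 :: real, 1 :: real)"
      by (auto simp: box_def Basis_prod_def inner_prod_def)
    ultimately show ?thesis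
      using open_box[unfolded open_contains_ball, of "(0, 0)" "(1, 1) :: real \<times> real"] by blast
  qed
  then obtain a r where ar: "0 < r" "ball a r \<subseteq> X" by blast
  have "emeasure lborel X \<noteq> 0"
  proof
    assume "emeasure lborel X = 0"
    then have "X \<in> null_sets lborel" using X by (auto simp: null_sets_def)
    then have "ball a r \<in> null_sets lborel"
      using null_sets_subset[of X lborel "ball a r"] ar by auto
    then show False
      using ar(1) open_not_negligible[of "ball a r"]
      by (auto simp: negligible_iff_null_sets null_sets_completionI)
  qed
  then show "prob_space (normalized_lebesgue X)"
    unfolding normalized_lebesgue_def
    using X fin by (intro prob_space_uniform_measure) (auto simp: emeasure_restrict_space)
  show "space (normalized_lebesgue X) = X"
    by (simp add: normalized_lebesgue_def space_restrict_space)
  show "sets (normalized_lebesgue X) = sets (restrict_space borel X)"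
    by (simp add: normalized_lebesgue_def sets_restrict_space)
qed

section \<open>Measure-preserving transformations\<close>

definition invertible_measure_preserving :: "'a measure \<Rightarrow> ('a \<Rightarrow> 'a) \<Rightarrow> bool" where
  "invertible_measure_preserving M T \<longleftrightarrow>
     bij_betw T (space M) (space M) \<and>
     T \<in> measurable M M \<and>
     inv_into (space M) T \<in> measurable M M \<and>
     distr M M T = M"

definition ergodic :: "'a measure \<Rightarrow> ('a \<Rightarrow> 'a) \<Rightarrow> bool" where
  "ergodic M T \<longleftrightarrow>
     (\<forall>A\<in>sets M. T -` A \<inter> space M = A \<longrightarrow> measure M A = 0 \<or> measure M A = 1)"

definition square_integrable :: "'a measure \<Rightarrow> ('a \<Rightarrow> complex) \<Rightarrow> bool" where
  "square_integrable M f \<longleftrightarrow>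
     f \<in> borel_measurable M \<and> integrable M (\<lambda>x. (cmod (f x))\<^sup>2)"

definition l2_norm :: "'a measure \<Rightarrow> ('a \<Rightarrow> complex) \<Rightarrow> real" where
  "l2_norm M f = sqrt (\<integral>x. (cmod (f x))\<^sup>2 \<partial>M)"

definition rigid :: "'a measure \<Rightarrow> ('a \<Rightarrow> 'a) \<Rightarrow> bool" where
  "rigid M T \<longleftrightarrow>
     (\<exists>t :: nat \<Rightarrow> nat. strict_mono t \<and> (\<forall>n. 0 < t n) \<and>
        (\<forall>f. square_integrable M f \<longrightarrow>
           (\<lambda>n. l2_norm M (\<lambda>x. f ((T ^^ t n) x) - f x)) \<longlonglongrightarrow> 0))"

section \<open>Lower slow entropy\<close>

definition finite_measurable_partition :: "'a measure \<Rightarrow> 'a set set \<Rightarrow> bool" where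
  "finite_measurable_partition M \<P> \<longleftrightarrow>
     finite \<P> \<and> \<P> \<subseteq> sets M \<and> partition_on (space M) \<P>"

text \<open>The letters of a name are the atoms of the partition themselves rather than their indices.\<close>

definition name_of :: "'a set set \<Rightarrow> ('a \<Rightarrow> 'a) \<Rightarrow> nat \<Rightarrow> 'a \<Rightarrow> 'a set list" where
  "name_of \<P> T n x = map (\<lambda>k. THE p. p \<in> \<P> \<and> (T ^^ k) x \<in> p) [0..<n]"

text \<open>Used only for words of equal length.\<close>

definition hamming_dist :: "'b list \<Rightarrow> 'b list \<Rightarrow> real" where
  "hamming_dist w w' = real (card {k. k < length w \<and> w ! k \<noteq> w' ! k}) / real (length w)"

definition hamming_ball ::
  "'a measure \<Rightarrow> 'a set set \<Rightarrow> ('a \<Rightarrow> 'a) \<Rightarrow> nat \<Rightarrow> real \<Rightarrow> 'a \<Rightarrow> 'a set" where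
  "hamming_ball M \<P> T n \<epsilon> x =
     {y \<in> space M. hamming_dist (name_of \<P> T n x) (name_of \<P> T n y) < \<epsilon>}"

text \<open>Finite covering families always exist for \<open>\<epsilon> > 0\<close>, as there are only finitely many
  \<open>n\<close>-names and hence finitely many balls.\<close>

definition covering_number ::
  "'a measure \<Rightarrow> 'a set set \<Rightarrow> ('a \<Rightarrow> 'a) \<Rightarrow> nat \<Rightarrow> real \<Rightarrow> nat" where
  "covering_number M \<P> T n \<epsilon> =
     (LEAST c. \<exists>F. finite F \<and> card F = c \<and> F \<subseteq> hamming_ball M \<P> T n \<epsilon> ` space M \<and>
                   measure M (\<Union>F) > 1 - \<epsilon>)"

definition slow_growth_set ::
  "(nat \<Rightarrow> real \<Rightarrow> real) \<Rightarrow> 'a measure \<Rightarrow> ('a \<Rightarrow> 'a) \<Rightarrow> real \<Rightarrow> 'a set set \<Rightarrow> real set" where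
  "slow_growth_set a M T \<epsilon> \<P> =
     {t. 0 < t \<and> liminf (\<lambda>n. ereal (real (covering_number M \<P> T n \<epsilon>) / a n t)) > 0}"

text \<open>In \<^typ>\<open>ennreal\<close> the supremum of the empty set is \<open>0\<close>, which is the required convention.\<close>

definition slow_growth_exponent ::
  "(nat \<Rightarrow> real \<Rightarrow> real) \<Rightarrow> 'a measure \<Rightarrow> ('a \<Rightarrow> 'a) \<Rightarrow> real \<Rightarrow> 'a set set \<Rightarrow> ennreal" where
  "slow_growth_exponent a M T \<epsilon> \<P> = (SUP t\<in>slow_growth_set a M T \<epsilon> \<P>. ennreal t)"

text \<open>The limit exists because the exponent increases as \<open>\<epsilon>\<close> decreases to \<open>0\<close>.\<close>

definition lower_slow_entropy ::
  "(nat \<Rightarrow> real \<Rightarrow> real) \<Rightarrow> 'a measure \<Rightarrow> ('a \<Rightarrow> 'a) \<Rightarrow> ennreal" where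
  "lower_slow_entropy a M T =
     (SUP \<P>\<in>{\<P>. finite_measurable_partition M \<P>}.
        Lim (at_right 0) (\<lambda>\<epsilon>. slow_growth_exponent a M T \<epsilon> \<P>))"

end

theory Submission
  imports Defs "HOL-Real_Asymp.Real_Asymp"
begin

text \<open>
  At stage \<open>n\<close> the space is divided into \<open>K\<close> towers of equal width and common height \<open>h\<close>, on which
  \<open>T\<close> climbs. A tower of stage \<open>n + 1\<close> is indexed by a line \<open>j \<mapsto> a + j b\<close> over \<open>\<int>/K\<close>; it is cut into blocks,
  and block \<open>j\<close> is a pile of \<open>L\<close> copies of the tower \<open>a + j b\<close> of stage \<open>n\<close>. The repetitions make
  \<open>T ^ h\<close> converge to the identity. Two different lines meet at most once, so names along
  different towers stay far apart in the Hamming metric, and from the length \<open>L h\<close> on about \<open>K\<close> balls are needed.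
  Conversely, up to a small set, a name of length \<open>\<epsilon> L h\<close> is determined by a tower and a level, so \<open>K h\<close> balls suffice.
  As \<open>K\<close> grows doubly exponentially while \<open>h\<close> may grow much more slowly, raising \<open>L\<close> at sparse
  stages such that \<open>(L h) ^ u\<close> is about \<open>K\<close> yields the exponent \<open>u\<close>.
\<close>

section \<open>Lines as tower labels\<close>

text \<open>The lower entropy is a liminf over all lengths \<open>N\<close>, so its two bounds are
  asymmetric: the lower one must hold at every \<open>N\<close>, the upper one only along one
  sequence of lengths. For \<open>N\<close> between \<open>16 * per n\<close> and
  \<open>16 * per (n + 1)\<close> at least \<open>tow (n + 1) / 2\<close> balls are needed, so
  \<open>per n\<close> to the power \<open>t\<close> must stay below \<open>tow n\<close> at every
  stage when \<open>t < u\<close>. For \<open>N\<close> a small multiple of \<open>per n\<close>,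
  \<open>tow n * h n\<close> balls suffice, and this matches only where \<open>per n\<close> is
  comparable to a power of \<open>tow n\<close> while \<open>h n\<close> is negligible. That is the
  reason for raising the repetition numbers at sparse stages only. A line has two parameters, which
  roughly squares the number of towers at each stage. Two words lose at most one block in
  \<open>blk n\<close> to the meeting point of their lines; with \<open>blk n = 2 ^ (n + 3)\<close>
  these losses sum to 1/4, so distinct words always differ on more than 3/4 of their length. The
  repetitions contribute nothing to ergodicity. It comes from the lines alone, by an estimate on
  translations of Z/K that does not involve \<open>L\<close>.\<close>

text \<open>
  Stage \<open>n\<close> has \<open>tow n\<close> towers. A tower \<open>i\<close> of stage \<open>n + 1\<close> encodes the line with intercept \<open>i div slp n\<close> and
  slope \<open>i mod slp n\<close>, whose value at \<open>j < blk n\<close> is \<open>lab n i j\<close>. The identity \<open>blk n * slp n = tow n\<close>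
  keeps \<open>(j - j') (b - b')\<close> below the modulus, which replaces the primality of the modulus.
\<close>

definition blk :: "nat \<Rightarrow> nat" where "blk n = 2 ^ (n + 3)"
definition slp :: "nat \<Rightarrow> nat" where "slp n = 2 ^ (2 ^ n + 1)"
definition tow :: "nat \<Rightarrow> nat" where "tow n = 2 ^ (2 ^ n + n + 4)"

lemma blk_slp: "blk n * slp n = tow n"
proof -
  have "n + 3 + (2 ^ n + 1) = 2 ^ n + n + (4::nat)" by simp
  then show ?thesis unfolding blk_def slp_def tow_def by (metis power_add)
qed

lemma tow_Suc: "tow (Suc n) = tow n * slp n"
proof -
  have "2 ^ n + n + 4 + (2 ^ n + 1) = 2 ^ Suc n + Suc n + (4::nat)" by simp
  then show ?thesis unfolding slp_def tow_def by (metis power_add)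
qed

lemma blk_pos [simp]: "blk n > 0" and slp_pos [simp]: "slp n > 0" and tow_pos [simp]: "tow n > 0"
  by (simp_all add: blk_def slp_def tow_def)

lemma blk_ge_8: "blk n \<ge> 8"
  by (simp add: blk_def power_add)

lemma slp_ge_2: "slp n \<ge> 2"
  by (simp add: slp_def power_add)

definition lab :: "nat \<Rightarrow> nat \<Rightarrow> nat \<Rightarrow> nat" where
  "lab n i j = (i div slp n + j * (i mod slp n)) mod tow n"

lemma lab_less [simp]: "lab n i j < tow n"
  by (simp add: lab_def)

lemma tow_index_div: "i < tow (Suc n) \<Longrightarrow> i div slp n < tow n"
  by (simp add: tow_Suc less_mult_imp_div_less)

text \<open>Two common values make the modulus divide \<open>(j - j') * (b - b')\<close>, which is
  too small to be a nonzero multiple of it.\<close>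

lemma lab_inj:
  assumes i: "i < tow (Suc n)" "i' < tow (Suc n)" "i \<noteq> i'"
    and j: "j < blk n" "j' < blk n"
    and eq: "lab n i j = lab n i' j" "lab n i j' = lab n i' j'"
  shows "j = j'"
proof -
  define K where "K = int (tow n)"
  define a where "a = int (i div slp n)"
  define a' where "a' = int (i' div slp n)"
  define b where "b = int (i mod slp n)"
  define b' where "b' = int (i' mod slp n)"
  have K: "K = int (blk n) * int (slp n)"
    by (simp add: K_def flip: blk_slp)
  have "(a + int j * b) mod K = (a' + int j * b') mod K"
    using eq(1) unfolding lab_def a_def a'_def b_def b'_def K_def
    by (metis of_nat_add of_nat_mult of_nat_mod)
  then have d1: "K dvd (a + int j * b) - (a' + int j * b')"
    by (simp add: mod_eq_dvd_iff)
  have "(a + int j' * b) mod K = (a' + int j' * b') mod K"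
    using eq(2) unfolding lab_def a_def a'_def b_def b'_def K_def
    by (metis of_nat_add of_nat_mult of_nat_mod)
  then have d2: "K dvd (a + int j' * b) - (a' + int j' * b')"
    by (simp add: mod_eq_dvd_iff)
  have d: "K dvd (int j - int j') * (b - b')"
    using dvd_diff[OF d1 d2] by (simp add: algebra_simps)
  have "\<bar>int j - int j'\<bar> < int (blk n)" using j by linarith
  moreover have bb: "\<bar>b - b'\<bar> < int (slp n)"
    unfolding b_def b'_def
    using mod_less_divisor[OF slp_pos, of i n] mod_less_divisor[OF slp_pos, of i' n] by linarith
  ultimately have "\<bar>int j - int j'\<bar> * \<bar>b - b'\<bar> < K"
    unfolding K by (intro mult_strict_mono') auto
  then have "(int j - int j') * (b - b') = 0"
    using d zdvd_imp_le[of K "\<bar>(int j - int j') * (b - b')\<bar>"]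
    by (metis abs_mult dvd_abs_iff linorder_not_less zero_less_abs_iff)
  \<comment> \<open>Equal slopes would make the intercepts congruent, hence equal, and then the
    lines coincide.\<close>
  moreover have "b \<noteq> b'"
  proof
    assume bb': "b = b'"
    then have "K dvd a - a'" using d1 by simp
    moreover have "a < K" "a' < K" "a \<ge> 0" "a' \<ge> 0"
      using tow_index_div[OF i(1)] tow_index_div[OF i(2)] by (auto simp: a_def a'_def K_def)
    ultimately have "a = a'"
      by (metis mod_eq_dvd_iff mod_pos_pos_trivial)
    then show False
      using bb' i(3) unfolding a_def a'_def b_def b'_def
      by (metis div_mult_mod_eq of_nat_eq_iff)
  qed
  ultimately show ?thesis by simp
qed

lemma bij_betw_pair_index:
  "bij_betw (\<lambda>(a, b). a * q + b) ({..<p} \<times> {..<q}) {..<p * q}" for p q :: nat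
proof (rule bij_betwI[where g = "\<lambda>i. (i div q, i mod q)"])
  show "(\<lambda>(a, b). a * q + b) \<in> {..<p} \<times> {..<q} \<rightarrow> {..<p * q}"
  proof clarsimp
    fix a b assume "a < p" "b < q"
    then have "Suc a * q \<le> p * q" by (intro mult_le_mono1) simp
    then show "a * q + b < p * q" using \<open>b < q\<close> by simp
  qed
  show "(\<lambda>i. (i div q, i mod q)) \<in> {..<p * q} \<rightarrow> {..<p} \<times> {..<q}"
    by (cases "q = 0") (auto simp: less_mult_imp_div_less)
qed auto

lemma sum_pair_index:
  "(\<Sum>i<p * q. f i) = (\<Sum>a<p. \<Sum>b<q. f (a * q + b))" for p q :: nat
  using sum.reindex_bij_betw[OF bij_betw_pair_index[of q p], of f, symmetric]
  by (simp add: sum.cartesian_product case_prod_unfold)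

lemma bij_betw_add_mod:
  fixes K v :: nat
  assumes "K > 0"
  shows "bij_betw (\<lambda>a. (a + v) mod K) {..<K} {..<K}"
proof (rule bij_betwI[where g = "\<lambda>a. (a + (K - v mod K)) mod K"])
  have v: "v mod K < K" using assms by simp
  show "((a + v) mod K + (K - v mod K)) mod K = a" if "a \<in> {..<K}" for a
  proof -
    have "((a + v) mod K + (K - v mod K)) mod K = ((a + v mod K) + (K - v mod K)) mod K"
      by (metis mod_add_left_eq mod_add_right_eq)
    also have "(a + v mod K) + (K - v mod K) = a + K" using v by simp
    finally show ?thesis using that by simp
  qed
  show "((a + (K - v mod K)) mod K + v) mod K = a" if "a \<in> {..<K}" for a
  proof -
    have "((a + (K - v mod K)) mod K + v) mod K = ((a + (K - v mod K)) + v mod K) mod K"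
      by (metis mod_add_left_eq mod_add_right_eq)
    also have "(a + (K - v mod K)) + v mod K = a + K" using v by simp
    finally show ?thesis using that by simp
  qed
qed (use assms in auto)

text \<open>For each slope, translating the intercept permutes the residues, so exactly one line of
  that slope takes the value \<open>c\<close> at \<open>j\<close>.\<close>

lemma card_lab_fiber:
  assumes "c < tow n"
  shows "card {i. i < tow (Suc n) \<and> lab n i j = c} = slp n"
proof -
  have "card {i. i < tow (Suc n) \<and> lab n i j = c} = (\<Sum>i<tow n * slp n. of_bool (lab n i j = c))"
    by (simp add: tow_Suc) (metis lessThan_iff Collect_conj_eq Collect_mem_eq Int_def lessThan_def)
  also have "\<dots> = (\<Sum>a<tow n. \<Sum>b<slp n. of_bool ((a + j * b) mod tow n = c))"
    unfolding sum_pair_index by (intro sum.cong) (auto simp: lab_def)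
  also have "\<dots> = (\<Sum>b<slp n. \<Sum>a<tow n. of_bool ((a + j * b) mod tow n = c))"
    by (rule sum.swap)
  also have "\<dots> = (\<Sum>b<slp n. \<Sum>a<tow n. of_bool (a = c))"
    by (intro sum.cong refl sum.reindex_bij_betw[OF bij_betw_add_mod, where g = "\<lambda>a. of_bool (a = c)"]) simp
  also have "\<dots> = slp n" using assms by simp
  finally show ?thesis .
qed

section \<open>Words\<close>

primrec hgt :: "(nat \<Rightarrow> nat) \<Rightarrow> nat \<Rightarrow> nat" where
  "hgt L 0 = 1"
| "hgt L (Suc n) = blk n * (L n * hgt L n)"

text \<open>The word lists the towers of stage 0 crossed while climbing tower \<open>i\<close> of
  stage \<open>n\<close>; \<open>I_0_word\<close> makes this precise. The quotient by
  \<open>L n * hgt L n\<close> is the block, the remainder by \<open>hgt L n\<close> the level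
  inside a copy.\<close>

primrec word :: "(nat \<Rightarrow> nat) \<Rightarrow> nat \<Rightarrow> nat \<Rightarrow> nat \<Rightarrow> nat" where
  "word L 0 i k = i"
| "word L (Suc n) i k = word L n (lab n i (k div (L n * hgt L n))) (k mod hgt L n)"

lemma sum_consecutive_blocks:
  fixes f :: "nat \<Rightarrow> 'a::comm_monoid_add"
  assumes "q0 \<le> q1"
  shows "(\<Sum>q=q0..<q1. \<Sum>r<v. f (q * v + r)) = sum f {q0 * v..<q1 * v}"
  using assms
proof (induction q1 rule: dec_induct)
  case (step q)
  have "(\<Sum>r<v. f (q * v + r)) = sum f {q * v..<q * v + v}"
    using sum.shift_bounds_nat_ivl[of f 0 "q * v" v] by (simp add: lessThan_atLeast0 add.commute)
  moreover have "sum f {q0 * v..<q * v} + sum f {q * v..<q * v + v} = sum f {q0 * v..<q * v + v}"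
    using step by (intro sum.atLeastLessThan_concat) auto
  ultimately show ?case
    using step by (simp add: add.commute)
qed simp

lemma of_nat_div_ge: "real x / real v - 1 \<le> real (x div v)"
  using floor_divide_of_nat_eq[of x v, where 'a = real] by linarith

locale repetitions =
  fixes L :: "nat \<Rightarrow> nat"
  assumes L_ge_2: "L n \<ge> 2"
begin

abbreviation h :: "nat \<Rightarrow> nat" where "h \<equiv> hgt L"

abbreviation per :: "nat \<Rightarrow> nat" where "per n \<equiv> L n * h n"

lemma L_pos [simp]: "L n > 0"
  using L_ge_2[of n] by simp

lemma h_pos [simp]: "h n > 0"
  by (induction n) auto

lemma per_pos [simp]: "per n > 0"
  by simp

lemma h_Suc: "h (Suc n) = blk n * per n"
  by simp

lemma h_le_h_Suc: "16 * h n \<le> h (Suc n)"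
proof -
  have "8 * (2 * h n) \<le> blk n * (L n * h n)"
    by (intro mult_le_mono blk_ge_8 L_ge_2 order_refl)
  then show ?thesis by simp
qed

lemma strict_mono_h: "strict_mono h"
proof (rule strict_monoI_Suc)
  show "h n < h (Suc n)" for n using h_le_h_Suc[of n] h_pos[of n] by linarith
qed

lemma h_ge: "n < h n"
proof (induction n)
  case (Suc n)
  then show ?case using h_le_h_Suc[of n] by linarith
qed simp

lemma h_dvd_mono: "n \<le> N \<Longrightarrow> h n dvd h N"
  by (induction N rule: dec_induct) auto

section \<open>Hamming distances between tower words\<close>

abbreviation differ :: "nat \<Rightarrow> nat \<Rightarrow> nat \<Rightarrow> nat \<Rightarrow> real" where
  "differ n i i' k \<equiv> of_bool (word L n i k \<noteq> word L n i' k)"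

text \<open>Inside a block each word is \<open>L n\<close> copies of one word of stage
  \<open>n\<close>, so the differences of a single copy are counted \<open>L n\<close> times.
  Positions are reduced modulo \<open>h (Suc n)\<close> because the words are later read
  periodically, as they occur in a pile.\<close>

lemma diff_block:
  "(\<Sum>r<per n. differ (Suc n) i i' ((q * per n + r) mod h (Suc n))) =
     real (L n) * (\<Sum>k<h n. differ n (lab n i (q mod blk n)) (lab n i' (q mod blk n)) k)"
proof -
  have w: "word L (Suc n) i ((q * per n + (l * h n + k)) mod h (Suc n))
      = word L n (lab n i (q mod blk n)) k" if "l < L n" "k < h n" for i l k
  proof -
    define x where "x = q * per n + (l * h n + k)"
    have "Suc l * h n \<le> L n * h n" using that(1) by (intro mult_le_mono1) simp
    then have lt: "l * h n + k < per n" using that(2) by simp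
    have "x div per n = q" using lt unfolding x_def
      by (metis add.right_neutral div_less div_mult_self3 gr_implies_not0 add.commute)
    moreover have "x mod h (Suc n) = per n * (x div per n mod blk n) + x mod per n"
      by (metis h_Suc mod_mult2_eq mult.commute)
    ultimately have "x mod h (Suc n) div per n = q mod blk n"
      by (simp add: div_add1_eq)
    moreover have "x mod h (Suc n) mod h n = x mod h n"
      by (intro mod_mod_cancel h_dvd_mono) simp
    moreover have "x mod h n = k"
      using that unfolding x_def by (simp add: mod_add_left_eq[symmetric] flip: mult.assoc)
    ultimately show ?thesis by (simp add: x_def)
  qed
  have "(\<Sum>r<per n. differ (Suc n) i i' ((q * per n + r) mod h (Suc n))) =
     (\<Sum>l<L n. \<Sum>k<h n. differ (Suc n) i i' ((q * per n + (l * h n + k)) mod h (Suc n)))"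
    by (rule sum_pair_index)
  also have "\<dots> = (\<Sum>l<L n. \<Sum>k<h n. differ n (lab n i (q mod blk n)) (lab n i' (q mod blk n)) k)"
    by (intro sum.cong refl) (auto simp only: w lessThan_iff)
  finally show ?thesis by simp
qed

text \<open>By \<open>lab_inj\<close> each run of \<open>blk n\<close> blocks contains at most one
  agreement, so \<open>q div blk n\<close> is injective on the agreeing blocks. The summand 2 pays
  for the incomplete runs at both ends.\<close>

lemma card_agreeing_blocks:
  assumes "i < tow (Suc n)" "i' < tow (Suc n)" "i \<noteq> i'" "q0 \<le> q1"
  shows "real (card {q \<in> {q0..<q1}. lab n i (q mod blk n) = lab n i' (q mod blk n)})
           \<le> real (q1 - q0) / 8 + 2"
proof -
  let ?S = "{q \<in> {q0..<q1}. lab n i (q mod blk n) = lab n i' (q mod blk n)}"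
  have inj: "inj_on (\<lambda>q. q div blk n) ?S"
  proof (rule inj_onI)
    fix q q' assume q: "q \<in> ?S" "q' \<in> ?S" "q div blk n = q' div blk n"
    then have "q mod blk n = q' mod blk n"
      using lab_inj[OF assms(1-3), of "q mod blk n" "q' mod blk n"] by simp
    then show "q = q'" using q(3) by (metis div_mult_mod_eq)
  qed
  have "card ?S = card ((\<lambda>q. q div blk n) ` ?S)"
    by (rule card_image[OF inj, symmetric])
  also have "\<dots> \<le> card {q0 div blk n..q1 div blk n}"
    by (intro card_mono) (auto intro!: div_le_mono)
  also have "\<dots> = q1 div blk n + 1 - q0 div blk n" by simp
  finally have "real (card ?S) \<le> real (q1 div blk n) + 1 - real (q0 div blk n)"
    using div_le_mono[OF assms(4), of "blk n"] by linarith
  then have "real (card ?S) \<le> real q1 / real (blk n) - real q0 / real (blk n) + 2"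
    using of_nat_div_le_of_nat[of q1 "blk n", where 'a = real] of_nat_div_ge[of q0 "blk n"] by linarith
  also have "real q1 / real (blk n) - real q0 / real (blk n) = (real q1 - real q0) / real (blk n)"
    by (simp add: diff_divide_distrib)
  also have "(real q1 - real q0) / real (blk n) \<le> (real q1 - real q0) / 8"
    using blk_ge_8[of n] assms(4) by (intro divide_left_mono) auto
  finally show ?thesis using assms(4) by simp
qed

text \<open>The fraction decreases by the factor \<open>1 - 1 / blk n\<close> at each stage.\<close>

lemma word_distance:
  assumes "i < tow n" "i' < tow n" "i \<noteq> i'"
  shows "(\<Sum>k<h n. differ n i i' k) \<ge> (3/4 + 1/4 * (1/2) ^ n) * real (h n)"
  using assms
proof (induction n arbitrary: i i')
  case 0
  then show ?case by simp
next
  case (Suc n)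
  define c :: real where "c = 3/4 + 1/4 * (1/2) ^ n"
  have c: "0 \<le> c" "c \<le> 1" by (auto simp: c_def field_simps)
  let ?S = "{j \<in> {..<blk n}. lab n i j = lab n i' j}"
  have "card ?S \<le> 1"
    using lab_inj[OF Suc.prems] by (intro card_le_Suc0_iff_eq[THEN iffD2, simplified One_nat_def[symmetric]]) auto
  then have card: "real (card ({..<blk n} - ?S)) \<ge> real (blk n) - 1"
    by (subst card_Diff_subset) auto
  have "(\<Sum>k<h (Suc n). differ (Suc n) i i' k) =
      (\<Sum>j<blk n. \<Sum>r<per n. differ (Suc n) i i' (j * per n + r))"
    unfolding h_Suc by (rule sum_pair_index)
  also have "\<dots> = (\<Sum>j<blk n. real (L n) * (\<Sum>k<h n. differ n (lab n i j) (lab n i' j) k))"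
  proof (rule sum.cong[OF refl])
    fix j assume j: "j \<in> {..<blk n}"
    have "j * per n + r < h (Suc n)" if "r < per n" for r
    proof -
      have "Suc j * per n \<le> blk n * per n" using j by (intro mult_le_mono1) simp
      then show ?thesis using that by simp
    qed
    then have "(\<Sum>r<per n. differ (Suc n) i i' (j * per n + r)) =
        (\<Sum>r<per n. differ (Suc n) i i' ((j * per n + r) mod h (Suc n)))"
      by (intro sum.cong) (auto simp del: hgt.simps word.simps)
    then show "(\<Sum>r<per n. differ (Suc n) i i' (j * per n + r)) =
        real (L n) * (\<Sum>k<h n. differ n (lab n i j) (lab n i' j) k)"
      using diff_block[where n = n and i = i and i' = i' and q = j] j by (simp del: hgt.simps word.simps)
  qed
  also have "\<dots> \<ge> (\<Sum>j\<in>{..<blk n} - ?S. real (L n) * (c * real (h n)))"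
  proof (rule order_trans[OF sum_mono sum_mono2])
    show "real (L n) * (c * real (h n)) \<le> real (L n) * (\<Sum>k<h n. differ n (lab n i j) (lab n i' j) k)"
      if "j \<in> {..<blk n} - ?S" for j
      using Suc.IH[of "lab n i j" "lab n i' j"] that by (intro mult_left_mono) (auto simp: c_def)
  qed (auto intro!: mult_nonneg_nonneg sum_nonneg)
  also have "(\<Sum>j\<in>{..<blk n} - ?S. real (L n) * (c * real (h n))) =
      real (card ({..<blk n} - ?S)) * (real (L n) * (c * real (h n)))" by simp
  also have "\<dots> \<ge> (real (blk n) - 1) * (real (L n) * (c * real (h n)))"
    using card c by (intro mult_right_mono) auto
  also have "(real (blk n) - 1) * (real (L n) * (c * real (h n))) =
      (c - c / real (blk n)) * real (h (Suc n))"
    by (simp add: field_simps)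
  also have "\<dots> \<ge> (c - 1 / real (blk n)) * real (h (Suc n))"
    using c by (intro mult_right_mono diff_left_mono divide_right_mono) auto
  \<comment> \<open>The loss \<open>1 / blk n\<close> is exactly the amount by which the surplus
    over 3/4 shrinks when halved; this is where the exponent \<open>n + 3\<close> in
    \<open>blk\<close> comes from.\<close>
  also have "c - 1 / real (blk n) = 3/4 + 1/4 * (1/2) ^ Suc n"
    by (simp add: c_def blk_def power_add power_one_over field_simps)
  finally show ?case by (simp only:)
qed

text \<open>The window is trimmed to whole blocks. All but about one eighth of these carry different
  labels, and each such block contributes differences on 3/4 of its length.\<close>

lemma periodic_word_distance:
  assumes i: "i < tow (Suc n)" "i' < tow (Suc n)" "i \<noteq> i'" and M: "M \<ge> 8 * per n"
  shows "(\<Sum>k=p..<p + M. differ (Suc n) i i' (k mod h (Suc n))) \<ge> real M / 4"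
proof -
  define v where "v = per n"
  have v: "v > 0" by (simp add: v_def)
  \<comment> \<open>Rounded up, whereas \<open>q1\<close> is rounded down, so that only blocks lying
    wholly inside the window are counted.\<close>
  define q0 where "q0 = (p + v - 1) div v"
  define q1 where "q1 = (p + M) div v"
  have q0: "real q0 \<le> (real p + real v - 1) / real v" "p \<le> q0 * v"
  proof -
    show "real q0 \<le> (real p + real v - 1) / real v"
      using of_nat_div_le_of_nat[of "p + v - 1" v] v by (simp add: q0_def of_nat_diff)
    have "p + v - 1 < Suc q0 * v"
      using v dividend_less_div_times[of v "p + v - 1"] by (simp add: q0_def)
    then show "p \<le> q0 * v" by simp
  qed
  have q1: "real q1 \<ge> (real p + real M) / real v - 1" "q1 * v \<le> p + M"
    using of_nat_div_ge[of "p + M" v] by (auto simp: q1_def)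
  have Mv: "real M \<ge> 8 * real v" using M by (simp add: v_def flip: of_nat_mult)
  have Q: "real q1 - real q0 \<ge> real M / real v - 2"
    using q0(1) q1(1) v by (simp add: field_simps)
  moreover have "real M / real v \<ge> 8" using Mv v by (simp add: field_simps)
  ultimately have q01: "q0 \<le> q1" by linarith
  let ?S = "{q \<in> {q0..<q1}. lab n i (q mod blk n) = lab n i' (q mod blk n)}"
  have card: "real (card ({q0..<q1} - ?S)) \<ge> 7/8 * (real q1 - real q0) - 2"
  proof -
    have "card ({q0..<q1} - ?S) = (q1 - q0) - card ?S"
      by (subst card_Diff_subset) auto
    moreover have "card ?S \<le> q1 - q0"
    proof -
      have "card ?S \<le> card {q0..<q1}" by (intro card_mono) auto
      then show ?thesis by simp
    qed
    ultimately show ?thesis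
      using card_agreeing_blocks[OF i q01] q01 by (simp add: of_nat_diff) argo
  qed
  have "(\<Sum>k=p..<p + M. differ (Suc n) i i' (k mod h (Suc n))) \<ge>
      (\<Sum>k=q0 * v..<q1 * v. differ (Suc n) i i' (k mod h (Suc n)))"
    using q0(2) q1(2) by (intro sum_mono2) auto
  also have "(\<Sum>k=q0 * v..<q1 * v. differ (Suc n) i i' (k mod h (Suc n))) =
      (\<Sum>q=q0..<q1. \<Sum>r<v. differ (Suc n) i i' ((q * v + r) mod h (Suc n)))"
    by (rule sum_consecutive_blocks[OF q01, symmetric])
  also have "\<dots> = (\<Sum>q=q0..<q1. real (L n) *
      (\<Sum>k<h n. differ n (lab n i (q mod blk n)) (lab n i' (q mod blk n)) k))"
    unfolding v_def by (simp only: diff_block)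
  also have "\<dots> \<ge> (\<Sum>q\<in>{q0..<q1} - ?S. real (L n) * (3/4 * real (h n)))"
  proof (rule order_trans[OF sum_mono sum_mono2])
    fix q assume q: "q \<in> {q0..<q1} - ?S"
    have "3/4 * real (h n) \<le> (3/4 + 1/4 * (1/2) ^ n) * real (h n)"
      by (intro mult_right_mono) auto
    also have "\<dots> \<le> (\<Sum>k<h n. differ n (lab n i (q mod blk n)) (lab n i' (q mod blk n)) k)"
      using q by (intro word_distance) auto
    finally show "real (L n) * (3/4 * real (h n)) \<le> real (L n) *
      (\<Sum>k<h n. differ n (lab n i (q mod blk n)) (lab n i' (q mod blk n)) k)"
      by (intro mult_left_mono) auto
  qed (auto intro!: mult_nonneg_nonneg sum_nonneg)
  also have "(\<Sum>q\<in>{q0..<q1} - ?S. real (L n) * (3/4 * real (h n))) =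
      real (card ({q0..<q1} - ?S)) * (3/4 * real v)" by (simp add: v_def)
  also have "\<dots> \<ge> (7/8 * (real M / real v - 2) - 2) * (3/4 * real v)"
  proof (rule mult_right_mono)
    show "7/8 * (real M / real v - 2) - 2 \<le> real (card ({q0..<q1} - ?S))"
      using card Q by argo
  qed simp
  also have "(7/8 * (real M / real v - 2) - 2) * (3/4 * real v) = 21/32 * real M - 45/16 * real v"
    using v by (simp add: field_simps)
  \<comment> \<open>With \<open>v\<close> at most \<open>M / 8\<close> the left side is at least
    \<open>39/128 * M\<close>; the factor 8 in the hypothesis is spent here.\<close>
  also have "\<dots> \<ge> real M / 4" using Mv by simp
  finally show ?thesis by simp
qed

text \<open>A window no longer than a block meets at most two consecutive blocks, and one of them
  contains at least half of it. There the words are periodic repetitions of words of stage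
  \<open>n + 1\<close>. It matters that \<open>j\<close> depends on the window only and serves all
  pairs of towers at once: a Hamming ball then determines one common label.\<close>

lemma window_distance:
  assumes M: "16 * per n \<le> M" "M \<le> per (Suc n)" and \<sigma>: "\<sigma> + M \<le> h (Suc (Suc n))"
  shows "\<exists>j<blk (Suc n). \<forall>i i'. lab (Suc n) i j \<noteq> lab (Suc n) i' j \<longrightarrow>
           (\<Sum>k<M. differ (Suc (Suc n)) i i' (\<sigma> + k)) \<ge> real M / 8"
proof -
  define v where "v = per (Suc n)"
  have v: "v > 0" by (simp add: v_def)
  \<comment> \<open>The interval from \<open>p\<close> of length \<open>M'\<close> is the part of
    the window lying in block \<open>j\<close>, at least half of the window.\<close>
  have key: "(\<Sum>k<M. differ (Suc (Suc n)) i i' (\<sigma> + k)) \<ge> real M / 8"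
    if p: "\<sigma> \<le> p" "p + M' \<le> \<sigma> + M" "M \<le> 2 * M'" "j * v \<le> p" "p + M' \<le> Suc j * v"
      and ne: "lab (Suc n) i j \<noteq> lab (Suc n) i' j" for p M' j i i'
  proof -
    have "real M / 8 \<le> real M' / 4" using p(3) by simp
    also have "\<dots> \<le> (\<Sum>k=p..<p + M'. differ (Suc n) (lab (Suc n) i j) (lab (Suc n) i' j) (k mod h (Suc n)))"
      using M(1) p(3) ne by (intro periodic_word_distance) auto
    also have "\<dots> = (\<Sum>k=p..<p + M'. differ (Suc (Suc n)) i i' k)"
    proof (intro sum.cong refl)
      fix k assume k: "k \<in> {p..<p + M'}"
      have "k div per (Suc n) = j"
        using k p(4,5) by (intro div_nat_eqI) (auto simp: v_def algebra_simps)
      then show "differ (Suc n) (lab (Suc n) i j) (lab (Suc n) i' j) (k mod h (Suc n)) =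
          differ (Suc (Suc n)) i i' k"
        by (simp only: word.simps(2)[of L "Suc n"])
    qed
    also have "\<dots> \<le> (\<Sum>k=\<sigma>..<\<sigma> + M. differ (Suc (Suc n)) i i' k)"
      using p by (intro sum_mono2) auto
    also have "\<dots> = (\<Sum>k<M. differ (Suc (Suc n)) i i' (\<sigma> + k))"
      using sum.shift_bounds_nat_ivl[of "differ (Suc (Suc n)) i i'" 0 \<sigma> M]
      by (simp add: lessThan_atLeast0 add.commute del: word.simps)
    finally show ?thesis .
  qed
  define j0 where "j0 = \<sigma> div v"
  have j0: "j0 * v \<le> \<sigma>" "\<sigma> < Suc j0 * v"
    using v dividend_less_div_times[of v \<sigma>] by (auto simp: j0_def)
  have h: "h (Suc (Suc n)) = blk (Suc n) * v" by (simp add: v_def)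
  have jlt: "j < blk (Suc n)" if "j * v < \<sigma> + M" for j
    using that \<sigma> h by (metis mult_less_cancel2 order_less_le_trans)
  have M0: "M > 0" using M(1) per_pos[of n] by linarith
  show ?thesis
  proof (cases "\<sigma> + M \<le> Suc j0 * v")
    case True
    have "j0 < blk (Suc n)" using j0 M0 by (intro jlt) linarith
    moreover have "\<forall>i i'. lab (Suc n) i j0 \<noteq> lab (Suc n) i' j0 \<longrightarrow>
           (\<Sum>k<M. differ (Suc (Suc n)) i i' (\<sigma> + k)) \<ge> real M / 8"
      using key[of \<sigma> M j0] True j0 by auto
    ultimately show ?thesis by blast
  next
    case F: False
    show ?thesis
    proof (cases "M \<le> 2 * (Suc j0 * v - \<sigma>)")
      case True
      have "j0 < blk (Suc n)" using j0 M0 by (intro jlt) linarith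
      moreover have "\<forall>i i'. lab (Suc n) i j0 \<noteq> lab (Suc n) i' j0 \<longrightarrow>
           (\<Sum>k<M. differ (Suc (Suc n)) i i' (\<sigma> + k)) \<ge> real M / 8"
        using key[of \<sigma> "Suc j0 * v - \<sigma>" j0] True F j0 by (auto simp del: mult_Suc)
      ultimately show ?thesis by blast
    next
      case False
      have "Suc j0 < blk (Suc n)" using F by (intro jlt) linarith
      moreover have "\<forall>i i'. lab (Suc n) i (Suc j0) \<noteq> lab (Suc n) i' (Suc j0) \<longrightarrow>
           (\<Sum>k<M. differ (Suc (Suc n)) i i' (\<sigma> + k)) \<ge> real M / 8"
        using key[of "Suc j0 * v" "\<sigma> + M - Suc j0 * v" "Suc j0"] False F j0 M(2)
        by (auto simp: v_def simp del: hgt.simps word.simps)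
      ultimately show ?thesis by blast
    qed
  qed
qed

end

section \<open>Mixing of the tower labels\<close>

lemma sum_mod_shift:
  fixes F :: "int \<Rightarrow> real"
  assumes K: "K > 0" and per: "\<And>a. F (a mod K) = F a"
  shows "(\<Sum>a\<in>{0..<K}. F (a + v)) = (\<Sum>a\<in>{0..<K}. F a)"
proof -
  have "bij_betw (\<lambda>a. (a + v) mod K) {0..<K} {0..<K}"
  proof (rule bij_betwI[where g = "\<lambda>a. (a - v) mod K"])
    fix a assume "a \<in> {0..<K}"
    then show "((a + v) mod K - v) mod K = a" "((a - v) mod K + v) mod K = a"
      by (auto simp: mod_diff_left_eq mod_add_left_eq)
  qed (use K in auto)
  from sum.reindex_bij_betw[OF this, of F] show ?thesis by (simp add: per)
qed

text \<open>
  The hypothesis says that membership in \<open>V\<close> rarely changes along a line. Hence \<open>V\<close> is almost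
  invariant under most translations \<open>(j - j') b\<close>, and by subadditivity of \<open>g\<close> under most translations
  of \<open>\<int>/K\<close>, which forces \<open>V\<close> to be almost empty or almost full.
\<close>

lemma lab_mixing:
  fixes V V' :: "nat set" and n :: nat
  defines "c \<equiv> card (V \<inter> {..<tow n})"
  assumes e: "(\<Sum>j<blk n. \<Sum>i<tow (Suc n). of_bool ((lab n i j \<in> V) \<noteq> (i \<in> V'))) \<le> e * real (tow (Suc n)) * real (blk n)"
  shows "real c * (real (tow n) - real c) \<le> 8 * e * (real (tow n))\<^sup>2"
proof -
  define K where "K = int (tow n)"
  define B where "B = slp n"
  define m where "m = blk n"
  have K: "K > 0" by (simp add: K_def)
  have m: "m \<ge> 8" unfolding m_def by (rule blk_ge_8)
  have B: "B \<ge> 2" unfolding B_def by (rule slp_ge_2)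
  have mB: "real m * real B = real_of_int K"
    unfolding m_def B_def K_def by (simp flip: blk_slp)
  have K': "real (tow (Suc n)) = real_of_int K * real B"
    by (simp add: tow_Suc K_def B_def)
  define P where "P a \<longleftrightarrow> nat (a mod K) \<in> V" for a :: int
  have P_mod [simp]: "P (a mod K) = P a" for a by (simp add: P_def)
  \<comment> \<open>The number of points at which \<open>V\<close> and its translate by
    \<open>v\<close> differ. The facts below make it behave like a seminorm on Z/K: it is even,
    subadditive and \<open>K\<close>-periodic.\<close>
  define g where "g v = (\<Sum>a\<in>{0..<K}. of_bool (P a \<noteq> P (a + v)) :: real)" for v
  have P_mod' [simp]: "P (a mod K + v) = P (a + v)" for a v
    using P_mod[of "a mod K + v"] P_mod[of "a + v"] by (simp add: mod_add_left_eq)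
  have shift: "(\<Sum>a\<in>{0..<K}. of_bool (P (a + v) \<noteq> P (a + w))) = g (w - v)" for v w
  proof -
    have "g (w - v) = (\<Sum>a\<in>{0..<K}. of_bool (P (a + v) \<noteq> P (a + v + (w - v))))"
      unfolding g_def by (rule sum_mod_shift[OF K, symmetric]) simp
    then show ?thesis by simp
  qed
  have g_minus: "g (- v) = g v" for v
    using shift[of v 0] shift[of 0 v] by (simp add: eq_commute)
  have g_add: "g (v + w) \<le> g v + g w" for v w
  proof -
    have "g (v + w) = (\<Sum>a\<in>{0..<K}. of_bool (P a \<noteq> P (a + (v + w))))" by (simp add: g_def)
    also have "\<dots> \<le> (\<Sum>a\<in>{0..<K}. of_bool (P a \<noteq> P (a + v)) + of_bool (P (a + v) \<noteq> P (a + (v + w))))"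
      by (intro sum_mono) auto
    also have "\<dots> = g v + g w"
      using shift[of v "v + w"] by (simp add: sum.distrib g_def)
    finally show ?thesis .
  qed
  have g_nonneg: "g v \<ge> 0" for v by (simp add: g_def sum_nonneg)
  have g_diff: "g (v - w) \<le> g v + g w" for v w
    using g_add[of v "- w"] by (simp add: g_minus)
  have g_mod: "g (v mod K) = g v" for v
  proof -
    have "P (a + v mod K) = P (a + v)" for a
      using P_mod'[of v a] by (simp add: add.commute)
    then show ?thesis by (simp add: g_def)
  qed

  define E where "E j = (\<Sum>i<tow (Suc n). of_bool ((lab n i j \<in> V) \<noteq> (i \<in> V')) :: real)" for j
  define X where "X = 2 * e * real_of_int K * real B * real m"
  have E: "(\<Sum>j<m. E j) \<le> e * real (tow (Suc n)) * real m" using e by (simp add: E_def m_def)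
  \<comment> \<open>A block of at most average error. Comparing every other block with this one
    eliminates \<open>V'\<close> and leaves a statement about \<open>V\<close> alone.\<close>
  obtain j' where j': "E j' \<le> e * real (tow (Suc n))"
  proof -
    have "\<exists>j'<m. E j' \<le> e * real (tow (Suc n))"
    proof (rule ccontr)
      assume "\<not> ?thesis"
      then have "(\<Sum>j<m. E j) > (\<Sum>j<m. e * real (tow (Suc n)))"
        using m by (intro sum_strict_mono) (auto simp: not_le lessThan_empty_iff)
      then show False using E by (simp add: mult.commute)
    qed
    then show ?thesis using that by blast
  qed
  have g_lab: "(\<Sum>i<tow (Suc n). of_bool ((lab n i j \<in> V) \<noteq> (lab n i j' \<in> V))) =
      (\<Sum>b<B. g ((int j - int j') * int b))" for j
  proof -
    have lab: "lab n (a * B + b) j \<in> V \<longleftrightarrow> P (int a + int j * int b)" if "b < B" for a b j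
    proof -
      have "lab n (a * B + b) j = (a + j * b) mod tow n"
        using that by (simp add: lab_def B_def)
      also have "\<dots> = nat ((int a + int j * int b) mod K)"
        by (simp add: K_def nat_mod_as_int flip: of_nat_mult of_nat_add)
      finally show ?thesis by (simp add: P_def)
    qed
    have "(\<Sum>i<tow (Suc n). of_bool ((lab n i j \<in> V) \<noteq> (lab n i j' \<in> V)) :: real) =
        (\<Sum>a<tow n. \<Sum>b<B. of_bool (P (int a + int j * int b) \<noteq> P (int a + int j' * int b)))"
      unfolding tow_Suc B_def[symmetric] sum_pair_index by (intro sum.cong refl) (simp add: lab)
    also have "\<dots> = (\<Sum>b<B. \<Sum>a<tow n. of_bool (P (int a + int j * int b) \<noteq> P (int a + int j' * int b)))"
      by (rule sum.swap)
    also have "\<dots> = (\<Sum>b<B. \<Sum>a\<in>{0..<K}. of_bool (P (a + int j * int b) \<noteq> P (a + int j' * int b)))"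
      unfolding K_def
      by (intro sum.cong refl sum.reindex_bij_witness[where i = nat and j = int]) auto
    also have "\<dots> = (\<Sum>b<B. g ((int j - int j') * int b))"
      unfolding shift by (intro sum.cong refl) (metis g_minus left_diff_distrib minus_diff_eq)
    finally show ?thesis .
  qed
  have "(\<Sum>j<m. \<Sum>b<B. g ((int j - int j') * int b)) \<le> (\<Sum>j<m. E j + E j')"
    unfolding g_lab[symmetric] E_def sum.distrib[symmetric] by (intro sum_mono) auto
  also have "\<dots> \<le> X"
    using E mult_right_mono[OF j', of "real m"] by (simp add: sum.distrib X_def K' algebra_simps)
  finally have X: "(\<Sum>j<m. \<Sum>b<B. g ((int j - int j') * int b)) \<le> X" .
  have X0: "X \<ge> 0" by (rule order_trans[OF _ X]) (auto intro!: sum_nonneg g_nonneg)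

  \<comment> \<open>The translation by \<open>b\<close> is the difference of the translations by
    \<open>(j + 1 - j') * b\<close> and \<open>(j - j') * b\<close>. Averaging over the
    \<open>m - 1\<close> consecutive pairs bounds \<open>g\<close> on the short
    translations.\<close>
  have step1: "real m * (\<Sum>b<B. g (int b)) \<le> 4 * X"
  proof -
    have "real (m - 1) * (\<Sum>b<B. g (int b)) = (\<Sum>j<m - 1. \<Sum>b<B. g (int b))" by simp
    also have "\<dots> \<le> (\<Sum>j<m - 1. \<Sum>b<B. g ((int (Suc j) - int j') * int b) + g ((int j - int j') * int b))"
    proof (intro sum_mono)
      fix j b
      show "g (int b) \<le> g ((int (Suc j) - int j') * int b) + g ((int j - int j') * int b)"
        using g_diff[of "(int (Suc j) - int j') * int b" "(int j - int j') * int b"]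
        by (simp add: algebra_simps)
    qed
    also have "\<dots> = (\<Sum>j<m - 1. \<Sum>b<B. g ((int (Suc j) - int j') * int b)) +
        (\<Sum>j<m - 1. \<Sum>b<B. g ((int j - int j') * int b))"
      by (simp add: sum.distrib)
    also have "(\<Sum>j<m - 1. \<Sum>b<B. g ((int (Suc j) - int j') * int b)) \<le>
        (\<Sum>j<m. \<Sum>b<B. g ((int j - int j') * int b))"
    proof -
      have m': "m = Suc (m - 1)" using m by simp
      have "(\<Sum>j<m. \<Sum>b<B. g ((int j - int j') * int b)) = (\<Sum>b<B. g ((int 0 - int j') * int b)) +
          (\<Sum>j<m - 1. \<Sum>b<B. g ((int (Suc j) - int j') * int b))"
        by (subst m') (rule sum.lessThan_Suc_shift)
      moreover have "(\<Sum>b<B. g ((int 0 - int j') * int b)) \<ge> 0" by (intro sum_nonneg g_nonneg)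
      ultimately show ?thesis by linarith
    qed
    also have "(\<Sum>j<m - 1. \<Sum>b<B. g ((int j - int j') * int b)) \<le>
        (\<Sum>j<m. \<Sum>b<B. g ((int j - int j') * int b))"
      by (intro sum_mono2 sum_nonneg g_nonneg) auto
    finally have "real (m - 1) * (\<Sum>b<B. g (int b)) \<le> 2 * X" using X by simp
    moreover have "real m / 2 * (\<Sum>b<B. g (int b)) \<le> real (m - 1) * (\<Sum>b<B. g (int b))"
      using m by (intro mult_right_mono sum_nonneg g_nonneg) auto
    ultimately show ?thesis by simp
  qed

  \<comment> \<open>The translation by \<open>d * B\<close> is composed of those by
    \<open>d * b\<close> and \<open>d * (B - b)\<close>. Averaging over \<open>b\<close> bounds
    \<open>g\<close> on the multiples of \<open>B\<close>.\<close>
  have step2: "real B * (\<Sum>j<m. g ((int j - int j') * int B)) \<le> 4 * X"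
  proof -
    have "real (B - 1) * g (d * int B) \<le> 2 * (\<Sum>b<B. g (d * int b))" for d
    proof -
      have "real (B - 1) * g (d * int B) = (\<Sum>b=1..<B. g (d * int B))" by simp
      also have "\<dots> \<le> (\<Sum>b=1..<B. g (d * int b) + g (d * int (B - b)))"
      proof (intro sum_mono)
        fix b assume "b \<in> {1..<B}"
        then show "g (d * int B) \<le> g (d * int b) + g (d * int (B - b))"
          using g_add[of "d * int b" "d * int (B - b)"] by (simp add: of_nat_diff algebra_simps)
      qed
      also have "\<dots> = 2 * (\<Sum>b=1..<B. g (d * int b))"
      proof -
        have "(\<Sum>b=1..<B. g (d * int (B - b))) = (\<Sum>b=1..<B. g (d * int b))"
          by (intro sum.reindex_bij_witness[where i = "\<lambda>b. B - b" and j = "\<lambda>b. B - b"]) auto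
        then show ?thesis by (simp add: sum.distrib)
      qed
      also have "\<dots> \<le> 2 * (\<Sum>b<B. g (d * int b))"
        by (intro mult_left_mono sum_mono2 g_nonneg) auto
      finally show ?thesis .
    qed
    then have "(\<Sum>j<m. real (B - 1) * g ((int j - int j') * int B)) \<le>
        (\<Sum>j<m. 2 * (\<Sum>b<B. g ((int j - int j') * int b)))"
      by (intro sum_mono)
    also have "\<dots> \<le> 2 * X" using X by (simp flip: sum_distrib_left)
    finally have "real (B - 1) * (\<Sum>j<m. g ((int j - int j') * int B)) \<le> 2 * X"
      by (simp add: sum_distrib_left)
    moreover have "real B / 2 * (\<Sum>j<m. g ((int j - int j') * int B)) \<le>
        real (B - 1) * (\<Sum>j<m. g ((int j - int j') * int B))"
      using B by (intro mult_right_mono sum_nonneg g_nonneg) auto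
    ultimately show ?thesis by simp
  qed

  \<comment> \<open>Since \<open>m * B = K\<close>, each residue is uniquely
    \<open>j * B + b\<close> with \<open>j < m\<close> and \<open>b < B\<close>. The shift by
    \<open>j' * B\<close> leaves the total over all residues unchanged and produces the multiples
    \<open>(j - j') * B\<close> controlled by \<open>step2\<close>.\<close>
  have "(\<Sum>v\<in>{0..<K}. g v) \<le> 8 * X"
  proof -
    have "(\<Sum>v\<in>{0..<K}. g v) = (\<Sum>v\<in>{0..<K}. g (v + (- int j' * int B)))"
      by (rule sum_mod_shift[where F = g, OF K, symmetric]) (rule g_mod)
    also have "\<dots> = (\<Sum>v<m * B. g (int v + (- int j' * int B)))"
      unfolding K_def m_def B_def blk_slp
      by (intro sum.reindex_bij_witness[where i = int and j = nat]) auto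
    also have "\<dots> = (\<Sum>j<m. \<Sum>b<B. g (int (j * B + b) + (- int j' * int B)))"
      by (rule sum_pair_index)
    also have "\<dots> \<le> (\<Sum>j<m. \<Sum>b<B. g ((int j - int j') * int B) + g (int b))"
    proof (intro sum_mono)
      fix j b
      show "g (int (j * B + b) + (- int j' * int B)) \<le> g ((int j - int j') * int B) + g (int b)"
        using g_add[of "(int j - int j') * int B" "int b"] by (simp add: algebra_simps)
    qed
    also have "\<dots> = real B * (\<Sum>j<m. g ((int j - int j') * int B)) + real m * (\<Sum>b<B. g (int b))"
      by (simp add: sum.distrib sum_distrib_left)
    finally show ?thesis using step1 step2 by linarith
  qed
  \<comment> \<open>Double counting: the total is the number of ordered pairs of residues of which
    exactly one lies in \<open>V\<close>.\<close>
  also have "(\<Sum>v\<in>{0..<K}. g v) = 2 * (real c * (real (tow n) - real c))"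
  proof -
    have c: "(\<Sum>a\<in>{0..<K}. of_bool (P a)) = real c"
    proof -
      have "(\<Sum>a\<in>{0..<K}. of_bool (P a)) = (\<Sum>a<tow n. of_bool (a \<in> V) :: real)"
        unfolding K_def P_def
        by (intro sum.reindex_bij_witness[where i = int and j = nat]) auto
      also have "\<dots> = real c" by (simp add: c_def Int_commute)
      finally show ?thesis .
    qed
    have nc: "(\<Sum>a\<in>{0..<K}. of_bool (\<not> P a)) = real (tow n) - real c"
    proof -
      have "(\<Sum>a\<in>{0..<K}. of_bool (\<not> P a)) + (\<Sum>a\<in>{0..<K}. of_bool (P a)) = (\<Sum>a\<in>{0..<K}. 1 :: real)"
        unfolding sum.distrib[symmetric] by (intro sum.cong) auto
      then show ?thesis using c by (simp add: K_def)
    qed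
    have "(\<Sum>v\<in>{0..<K}. g v) = (\<Sum>a\<in>{0..<K}. \<Sum>v\<in>{0..<K}. of_bool (P a \<noteq> P (v + a)))"
      unfolding g_def by (subst sum.swap) (simp add: add.commute)
    also have "\<dots> = (\<Sum>a\<in>{0..<K}. \<Sum>v\<in>{0..<K}. of_bool (P a \<noteq> P v))"
      by (intro sum.cong refl sum_mod_shift[OF K]) simp
    also have "\<dots> = (\<Sum>a\<in>{0..<K}. \<Sum>v\<in>{0..<K}.
        of_bool (P a) * of_bool (\<not> P v) + of_bool (\<not> P a) * of_bool (P v))"
      by (intro sum.cong refl) auto
    also have "\<dots> = 2 * (real c * (real (tow n) - real c))"
      unfolding sum.distrib sum_product[symmetric] c nc by simp
    finally show ?thesis .
  qed
  finally have "2 * (real c * (real (tow n) - real c)) \<le> 8 * X" .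
  moreover have "X = 2 * e * (real (tow n))\<^sup>2"
    using mB by (simp add: X_def K_def power2_eq_square mult.assoc mult.commute[of "real B" "real m"])
  ultimately show ?thesis by simp
qed

lemma blk_neq_0 [simp]: "blk n \<noteq> 0" and tow_neq_0 [simp]: "tow n \<noteq> 0"
  by (simp_all add: blk_def tow_def)

lemma (in repetitions) L_neq_0 [simp]: "L n \<noteq> 0" and h_neq_0 [simp]: "h n \<noteq> 0"
  using L_pos[of n] h_pos[of n] by (simp_all only: neq0_conv)

lemma card_less_Collect: "card {j. j < N \<and> P j} = (\<Sum>j<N. of_bool (P j))" for N :: nat
proof -
  have "{j. j < N \<and> P j} = {..<N} \<inter> {j. P j}" by auto
  then show ?thesis by simp
qed

section \<open>Tower systems\<close>

text \<open>All that the dynamical arguments need: \<open>I n x\<close> and \<open>s n x\<close> are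
  the tower and the level of \<open>x\<close> at stage \<open>n\<close>. At the top of a tower stage
  \<open>n\<close> says nothing about \<open>T\<close>; there later stages decide, through
  \<open>s_proj\<close> and \<open>I_proj\<close>. The last assumption states that the levels of the
  towers generate the measurable sets modulo null sets.\<close>

locale tower_system = repetitions L + prob_space M
  for L :: "nat \<Rightarrow> nat" and M :: "'a measure" +
  fixes T :: "'a \<Rightarrow> 'a" and G :: "'a set" and I s :: "nat \<Rightarrow> 'a \<Rightarrow> nat"
  assumes T_measurable [measurable]: "T \<in> measurable M M"
    and T_preserving: "distr M M T = M"
    and G_sets [measurable]: "G \<in> sets M"
    and G_full: "prob G = 1"
    and T_G: "x \<in> G \<Longrightarrow> T x \<in> G"
    and I_measurable [measurable]: "I n \<in> measurable M (count_space UNIV)"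
    and s_measurable [measurable]: "s n \<in> measurable M (count_space UNIV)"
    and I_less: "x \<in> G \<Longrightarrow> I n x < tow n"
    and s_less: "x \<in> G \<Longrightarrow> s n x < h n"
    and T_label: "x \<in> G \<Longrightarrow> Suc (s n x) < h n \<Longrightarrow> I n (T x) = I n x \<and> s n (T x) = Suc (s n x)"
    and s_proj: "x \<in> G \<Longrightarrow> s n x = s (Suc n) x mod h n"
    and I_proj: "x \<in> G \<Longrightarrow> I n x = lab n (I (Suc n) x) (s (Suc n) x div per n)"
    and prob_cell: "i < tow n \<Longrightarrow> j < h n \<Longrightarrow>
          prob {x \<in> G. I n x = i \<and> s n x = j} = 1 / (real (tow n) * real (h n))"
    and cells_dense: "A \<in> sets M \<Longrightarrow> e > 0 \<Longrightarrow>
          \<forall>\<^sub>F n in sequentially. \<exists>U. prob {x \<in> G. (x \<in> A) \<noteq> ((I n x, s n x) \<in> U)} < e"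
begin

lemma G_space: "x \<in> G \<Longrightarrow> x \<in> space M"
  using sets.sets_into_space[OF G_sets] by auto

lemma sets_G_Collect:
  assumes "Measurable.pred M P"
  shows "{x \<in> G. P x} \<in> sets M"
proof -
  have "{x \<in> G. P x} = G \<inter> {x \<in> space M. P x}" using G_space by auto
  also have "\<dots> \<in> sets M" using assms by measurable
  finally show ?thesis .
qed

lemma prob_G_Collect:
  assumes "A \<in> sets M"
  shows "prob A = prob {x \<in> G. x \<in> A}"
proof -
  have "AE x in M. x \<in> G" using G_full prob_eq_1[OF G_sets] by simp
  then show ?thesis
    using assms by (intro finite_measure_eq_AE sets_G_Collect) (auto intro: sets_G_Collect)
qed

lemma funpow_measurable [measurable]: "(T ^^ k) \<in> measurable M M"
  by (induction k) (auto simp: comp_def)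

lemma prob_vimage:
  assumes "A \<in> sets M"
  shows "prob (T -` A \<inter> space M) = prob A"
  using measure_distr[OF T_measurable assms] T_preserving by simp

lemma prob_funpow_vimage:
  assumes "A \<in> sets M"
  shows "prob ((T ^^ k) -` A \<inter> space M) = prob A"
  using assms
proof (induction k arbitrary: A)
  case 0
  then show ?case using sets.sets_into_space by (auto intro!: arg_cong[of _ _ prob])
next
  case (Suc k)
  have "(T ^^ Suc k) -` A \<inter> space M = (T ^^ k) -` (T -` A \<inter> space M) \<inter> space M"
    using measurable_space[OF funpow_measurable] by auto
  then have "prob ((T ^^ Suc k) -` A \<inter> space M) = prob ((T ^^ k) -` (T -` A \<inter> space M) \<inter> space M)"
    by (simp only:)
  also have "\<dots> = prob (T -` A \<inter> space M)"
    using Suc.prems by (intro Suc.IH measurable_sets[OF T_measurable])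
  also have "\<dots> = prob A"
    by (rule prob_vimage[OF Suc.prems])
  finally show ?case .
qed

lemma funpow_G: "x \<in> G \<Longrightarrow> (T ^^ k) x \<in> G"
  by (induction k) (auto intro: T_G)

lemma funpow_label:
  assumes "x \<in> G" "s n x + k < h n"
  shows "I n ((T ^^ k) x) = I n x \<and> s n ((T ^^ k) x) = s n x + k"
  using assms(2)
proof (induction k)
  case (Suc k)
  then show ?case using T_label[OF funpow_G[OF assms(1)], of n k] by simp
qed simp

lemma block_less:
  assumes "x \<in> G"
  shows "s (Suc n) x div per n < blk n"
  using s_less[OF assms, of "Suc n"] by (simp add: less_mult_imp_div_less)

text \<open>Inside a pile, leaving the top of a copy means entering the bottom of the next copy of
  the same tower, so the tower is kept and the level is read modulo \<open>h n\<close>. Both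
  rigidity and the upper bound rest on this.\<close>

lemma funpow_label_in_block:
  assumes x: "x \<in> G" and k: "s (Suc n) x mod per n + k < per n"
  shows "I n ((T ^^ k) x) = I n x \<and> s n ((T ^^ k) x) = (s n x + k) mod h n"
proof -
  define \<sigma> where "\<sigma> = s (Suc n) x"
  define v where "v = per n"
  have v: "v > 0" by (simp add: v_def)
  have \<sigma>: "\<sigma> = \<sigma> div v * v + \<sigma> mod v" by simp
  have "Suc (\<sigma> div v) * v \<le> h (Suc n)"
    using block_less[OF x, of n] unfolding h_Suc \<sigma>_def v_def by (intro mult_le_mono1) simp
  then have lt: "\<sigma> + k < h (Suc n)"
    using k \<sigma> unfolding \<sigma>_def[symmetric] v_def[symmetric] mult_Suc by linarith
  have dv: "(\<sigma> + k) div v = \<sigma> div v"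
  proof -
    define q r where "q = \<sigma> div v" and "r = \<sigma> mod v"
    have "\<sigma> + k = v * q + (r + k)" "r + k < v"
      using k by (simp_all add: q_def r_def \<sigma>_def v_def)
    then have "(\<sigma> + k) div v = q" by (intro div_nat_eqI) auto
    then show ?thesis by (simp add: q_def)
  qed
  note l = funpow_label[OF x lt[unfolded \<sigma>_def]]
  show ?thesis
    using I_proj[OF funpow_G[OF x], of n k] I_proj[OF x, of n]
      s_proj[OF funpow_G[OF x], of n k] s_proj[OF x, of n] l dv
    by (simp add: \<sigma>_def v_def mod_add_left_eq)
qed

lemma prob_label:
  "prob {x \<in> G. P (I n x) (s n x)} =
     (\<Sum>i<tow n. \<Sum>j<h n. of_bool (P i j)) / (real (tow n) * real (h n))"
proof -
  let ?c = "\<lambda>(i, j). {x \<in> G. I n x = i \<and> s n x = j}"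
  let ?S = "{p \<in> {..<tow n} \<times> {..<h n}. P (fst p) (snd p)}"
  have eq: "{x \<in> G. P (I n x) (s n x)} = (\<Union>p\<in>?S. ?c p)"
    using I_less s_less by auto
  have "prob {x \<in> G. P (I n x) (s n x)} = (\<Sum>p\<in>?S. prob (?c p))"
    unfolding eq by (intro finite_measure_finite_Union) (auto simp: disjoint_family_on_def intro!: sets_G_Collect)
  also have "\<dots> = (\<Sum>p\<in>?S. 1 / (real (tow n) * real (h n)))"
  proof (rule sum.cong[OF refl])
    fix p assume "p \<in> ?S"
    then have p: "fst p < tow n" "snd p < h n" by (simp_all add: mem_Times_iff)
    show "prob (?c p) = 1 / (real (tow n) * real (h n))"
      unfolding case_prod_beta by (rule prob_cell[OF p])
  qed
  also have "\<dots> = (\<Sum>p\<in>{..<tow n} \<times> {..<h n}. of_bool (P (fst p) (snd p)) / (real (tow n) * real (h n)))"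
    by (intro sum.mono_neutral_cong_left) auto
  also have "\<dots> = (\<Sum>i<tow n. \<Sum>j<h n. of_bool (P i j)) / (real (tow n) * real (h n))"
    unfolding sum.cartesian_product case_prod_unfold sum_divide_distrib ..
  finally show ?thesis .
qed

lemma prob_tower:
  "prob {x \<in> G. P (I n x)} = real (card {i. i < tow n \<and> P i}) / real (tow n)"
proof -
  have "(\<Sum>i<tow n. of_bool (P i)) = real (card {i. i < tow n \<and> P i})"
    by (subst card_less_Collect) simp
  then show ?thesis
    using prob_label[of "\<lambda>i j. P i" n] by (simp flip: sum_distrib_left)
qed

lemma prob_level:
  "prob {x \<in> G. P (s n x)} = real (card {j. j < h n \<and> P j}) / real (h n)"
proof -
  have "(\<Sum>i<h n. of_bool (P i)) = real (card {i. i < h n \<and> P i})"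
    by (subst card_less_Collect) simp
  then show ?thesis
    using prob_label[of "\<lambda>i j. P j" n] tow_pos[of n] by simp
qed

lemma card_mod_ge:
  fixes m v d :: nat
  assumes "d \<le> v"
  shows "card {j. j < m * v \<and> v - d \<le> j mod v} = m * d"
proof -
  have "card {j. j < m * v \<and> v - d \<le> j mod v} = (\<Sum>j<m * v. of_bool (v - d \<le> j mod v))"
    using card_less_Collect[of "m * v" "\<lambda>j. v - d \<le> j mod v"] .
  also have "\<dots> = (\<Sum>a<m. \<Sum>b<v. of_bool (v - d \<le> b))"
    unfolding sum_pair_index by (intro sum.cong refl) simp
  also have "(\<Sum>b<v. of_bool (v - d \<le> b)) = card {b. b < v \<and> v - d \<le> b}"
    by (rule card_less_Collect[symmetric])
  also have "{b. b < v \<and> v - d \<le> b} = {v - d..<v}" by auto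
  finally show ?thesis using assms by simp
qed

text \<open>These are the points to which \<open>funpow_label_in_block\<close> does not apply for
  \<open>k = d\<close>, as \<open>d\<close> steps carry them out of their pile.\<close>

lemma prob_late_in_block:
  assumes "d \<le> per n"
  shows "prob {x \<in> G. per n - d \<le> s (Suc n) x mod per n} = real d / real (per n)"
proof -
  have "card {j. j < h (Suc n) \<and> per n - d \<le> j mod per n} = blk n * d"
    unfolding h_Suc by (rule card_mod_ge[OF assms])
  then show ?thesis
    using prob_level[of "\<lambda>j. per n - d \<le> j mod per n" "Suc n"]
    by simp
qed

section \<open>Ergodicity\<close>

text \<open>For invariant \<open>A\<close> the error of a union of whole towers is the same on every level, so the best
  level of \<open>U\<close> can be copied to all levels.\<close>

lemma invariant_set_towers:
  assumes A: "A \<in> sets M" "T -` A \<inter> space M = A"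
    and U: "prob {x \<in> G. (x \<in> A) \<noteq> ((I n x, s n x) \<in> U)} < e"
  shows "\<exists>V. prob {x \<in> G. (x \<in> A) \<noteq> (I n x \<in> V)} < e"
proof -
  note [measurable] = A(1)
  have AT: "T x \<in> A \<longleftrightarrow> x \<in> A" if "x \<in> G" for x
    using A(2) G_space[OF that] by blast
  define D where "D V j = {x \<in> G. s n x = j \<and> (x \<in> A) \<noteq> (I n x \<in> V)}" for V j
  have D_sets: "D V j \<in> sets M" for V j
    unfolding D_def by (intro sets_G_Collect) measurable
  have D_le: "prob (D V j) \<le> prob (D V (Suc j))" if "Suc j < h n" for V j
  proof -
    have "D V j \<subseteq> T -` D V (Suc j) \<inter> space M"
      using T_label T_G AT G_space that by (auto simp: D_def)
    then have "prob (D V j) \<le> prob (T -` D V (Suc j) \<inter> space M)"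
      using D_sets by (intro finite_measure_mono) auto
    then show ?thesis using prob_vimage[OF D_sets] by simp
  qed
  have D_compl: "prob (D V j) + prob (D (- V) j) = 1 / real (h n)" if "j < h n" for V j
  proof -
    have "prob (D V j) + prob (D (- V) j) = prob (D V j \<union> D (- V) j)"
      using D_sets by (intro finite_measure_Union[symmetric]) (auto simp: D_def)
    also have "D V j \<union> D (- V) j = {x \<in> G. s n x = j}" by (auto simp: D_def)
    also have "prob \<dots> = real (card {i. i < h n \<and> i = j}) / real (h n)" by (rule prob_level)
    also have "{i. i < h n \<and> i = j} = {j}" using that by auto
    finally show ?thesis by simp
  qed
  \<comment> \<open>By \<open>D_le\<close> neither the error of \<open>V\<close> nor that of its
    complement can decrease with the level. Their sum is the constant measure of a level, so neither
    can increase.\<close>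
  have D_Suc: "prob (D V (Suc j)) = prob (D V j)" if "Suc j < h n" for V j
    using D_le[OF that, of V] D_le[OF that, of "- V"] D_compl[of j V] D_compl[of "Suc j" V] that
    by linarith
  have D_0: "prob (D V j) = prob (D V 0)" if "j < h n" for V j
    using that by (induction j) (auto simp: D_Suc)
  have sum: "prob {x \<in> G. (x \<in> A) \<noteq> (I n x \<in> V (s n x))} = (\<Sum>j<h n. prob (D (V j) 0))" for V
  proof -
    have eq: "{x \<in> G. (x \<in> A) \<noteq> (I n x \<in> V (s n x))} = (\<Union>j<h n. D (V j) j)"
      using s_less by (auto simp: D_def)
    have "prob {x \<in> G. (x \<in> A) \<noteq> (I n x \<in> V (s n x))} = (\<Sum>j<h n. prob (D (V j) j))"
      unfolding eq by (intro finite_measure_finite_Union) (auto simp: disjoint_family_on_def D_sets, auto simp: D_def)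
    also have "\<dots> = (\<Sum>j<h n. prob (D (V j) 0))"
      by (intro sum.cong refl D_0) simp
    finally show ?thesis .
  qed
  define V where "V j = {i. (i, j) \<in> U}" for j
  have "(\<Sum>j<h n. prob (D (V j) 0)) < e"
    using U unfolding sum[symmetric] by (simp add: V_def)
  then have "\<exists>j<h n. prob (D (V j) 0) < e / real (h n)"
  proof (rule contrapos_pp)
    assume "\<not> ?thesis"
    then have "(\<Sum>j<h n. e / real (h n)) \<le> (\<Sum>j<h n. prob (D (V j) 0))"
      by (intro sum_mono) (meson lessThan_iff not_less)
    then show "\<not> (\<Sum>j<h n. prob (D (V j) 0)) < e" by simp
  qed
  then obtain j where "prob (D (V j) 0) < e / real (h n)" by blast
  then have "real (h n) * prob (D (V j) 0) < e"
    by (simp add: pos_less_divide_eq mult.commute)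
  then have "prob {x \<in> G. (x \<in> A) \<noteq> (I n x \<in> V j)} < e"
    using sum[of "\<lambda>_. V j"] by simp
  then show ?thesis by (rule exI)
qed

text \<open>An invariant set is nearly a union of towers both at stage \<open>n\<close> and at stage
  \<open>n + 1\<close>. A tower of the latter is a line through towers of the former, so membership
  rarely changes along lines, and \<open>lab_mixing\<close> with error \<open>2 * e\<close> gives
  \<open>16 * e\<close> for the proportion \<open>\<beta>\<close> of towers. Passing from
  \<open>\<beta>\<close> to the measure \<open>\<alpha>\<close> costs one more \<open>e\<close>,
  hence the 17.\<close>

lemma ergodic: "ergodic M T"
  unfolding ergodic_def
proof (intro ballI impI)
  fix A assume A: "A \<in> sets M" "T -` A \<inter> space M = A"
  note [measurable] = A(1)
  define \<alpha> where "\<alpha> = prob A"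
  have bound: "\<alpha> * (1 - \<alpha>) \<le> 17 * e" if e: "e > 0" for e
  proof -
    have "\<exists>n. \<forall>N\<ge>n. \<exists>U. prob {x \<in> G. (x \<in> A) \<noteq> ((I N x, s N x) \<in> U)} < e"
      using cells_dense[OF A(1) e] by (simp only: eventually_sequentially)
    then obtain n where n: "\<forall>N\<ge>n. \<exists>U. prob {x \<in> G. (x \<in> A) \<noteq> ((I N x, s N x) \<in> U)} < e"
      by (rule exE)
    obtain U where U: "prob {x \<in> G. (x \<in> A) \<noteq> ((I n x, s n x) \<in> U)} < e"
      using n[rule_format, of n] by auto
    obtain U' where U': "prob {x \<in> G. (x \<in> A) \<noteq> ((I (Suc n) x, s (Suc n) x) \<in> U')} < e"
      using n[rule_format, of "Suc n"] by auto
    obtain V V' where V: "prob {x \<in> G. (x \<in> A) \<noteq> (I n x \<in> V)} < e"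
      and V': "prob {x \<in> G. (x \<in> A) \<noteq> (I (Suc n) x \<in> V')} < e"
      using invariant_set_towers[OF A U] invariant_set_towers[OF A U'] by (elim exE)
    define c where "c = card (V \<inter> {..<tow n})"
    define \<beta> where "\<beta> = real c / real (tow n)"
    define N where "N = (\<Sum>j<blk n. \<Sum>i<tow (Suc n). of_bool ((lab n i j \<in> V) \<noteq> (i \<in> V')) :: real)"
    have "prob {x \<in> G. (I n x \<in> V) \<noteq> (I (Suc n) x \<in> V')} \<le>
        prob ({x \<in> G. (x \<in> A) \<noteq> (I n x \<in> V)} \<union> {x \<in> G. (x \<in> A) \<noteq> (I (Suc n) x \<in> V')})"
      by (intro finite_measure_mono sets.Un sets_G_Collect) (auto, measurable)
    also have "\<dots> \<le> prob {x \<in> G. (x \<in> A) \<noteq> (I n x \<in> V)} + prob {x \<in> G. (x \<in> A) \<noteq> (I (Suc n) x \<in> V')}"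
      by (intro measure_Un_le sets_G_Collect) measurable
    finally have le: "prob {x \<in> G. (I n x \<in> V) \<noteq> (I (Suc n) x \<in> V')} \<le> 2 * e"
      using V V' by linarith
    have "{x \<in> G. (I n x \<in> V) \<noteq> (I (Suc n) x \<in> V')} =
        {x \<in> G. (lab n (I (Suc n) x) (s (Suc n) x div per n) \<in> V) \<noteq> (I (Suc n) x \<in> V')}"
      using I_proj[of _ n] by (intro Collect_cong conj_cong refl) simp
    then have "prob {x \<in> G. (I n x \<in> V) \<noteq> (I (Suc n) x \<in> V')} =
        (\<Sum>i<tow (Suc n). \<Sum>\<sigma><h (Suc n). of_bool ((lab n i (\<sigma> div per n) \<in> V) \<noteq> (i \<in> V'))) /
          (real (tow (Suc n)) * real (h (Suc n)))"
      by (simp only: prob_label[where P = "\<lambda>i \<sigma>. (lab n i (\<sigma> div per n) \<in> V) \<noteq> (i \<in> V')"])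
    also have "(\<Sum>i<tow (Suc n). \<Sum>\<sigma><h (Suc n). of_bool ((lab n i (\<sigma> div per n) \<in> V) \<noteq> (i \<in> V')) :: real) =
        (\<Sum>i<tow (Suc n). \<Sum>j<blk n. \<Sum>r<per n. of_bool ((lab n i j \<in> V) \<noteq> (i \<in> V')))"
      unfolding h_Suc sum_pair_index[where p = "blk n" and q = "per n"] by (intro sum.cong refl) simp
    also have "\<dots> = (\<Sum>i<tow (Suc n). \<Sum>j<blk n. real (per n) * of_bool ((lab n i j \<in> V) \<noteq> (i \<in> V')))"
      by (intro sum.cong refl) simp
    also have "\<dots> = real (per n) * N"
      unfolding N_def sum_distrib_left by (rule sum.swap)
    also have "real (per n) * N / (real (tow (Suc n)) * real (h (Suc n))) =
        N / (real (tow (Suc n)) * real (blk n))"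
      by (simp add: h_Suc del: hgt.simps)
    finally have "N / (real (tow (Suc n)) * real (blk n)) \<le> 2 * e"
      using le by (simp only:)
    then have "N \<le> 2 * e * real (tow (Suc n)) * real (blk n)"
      by (subst (asm) pos_divide_le_eq) (simp_all add: mult.assoc)
    from lab_mixing[OF this[unfolded N_def]]
    have "real c * (real (tow n) - real c) \<le> 16 * e * (real (tow n))\<^sup>2"
      by (simp add: c_def)
    then have \<beta>: "\<beta> * (1 - \<beta>) \<le> 16 * e"
      by (simp add: \<beta>_def field_simps power2_eq_square)
    have \<beta>01: "0 \<le> \<beta>" "\<beta> \<le> 1"
      using card_mono[of "{..<tow n}" "V \<inter> {..<tow n}"] by (auto simp: \<beta>_def c_def field_simps)
    have \<alpha>01: "0 \<le> \<alpha>" "\<alpha> \<le> 1" by (auto simp: \<alpha>_def)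
    have "V \<inter> {..<tow n} = {i. i < tow n \<and> i \<in> V}" by auto
    then have "\<beta> = prob {x \<in> G. I n x \<in> V}"
      unfolding \<beta>_def c_def by (simp only: prob_tower[of "\<lambda>i. i \<in> V" n])
    moreover have "\<alpha> = prob {x \<in> G. x \<in> A}" unfolding \<alpha>_def by (rule prob_G_Collect[OF A(1)])
    moreover have "prob {x \<in> G. x \<in> A} \<le> prob ({x \<in> G. I n x \<in> V} \<union> {x \<in> G. (x \<in> A) \<noteq> (I n x \<in> V)})"
      by (intro finite_measure_mono sets.Un sets_G_Collect) (auto, measurable)
    moreover have "\<dots> \<le> prob {x \<in> G. I n x \<in> V} + prob {x \<in> G. (x \<in> A) \<noteq> (I n x \<in> V)}"
      by (intro measure_Un_le sets_G_Collect) measurable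
    moreover have "prob {x \<in> G. I n x \<in> V} \<le> prob ({x \<in> G. x \<in> A} \<union> {x \<in> G. (x \<in> A) \<noteq> (I n x \<in> V)})"
      by (intro finite_measure_mono sets.Un sets_G_Collect) (auto, measurable)
    moreover have "\<dots> \<le> prob {x \<in> G. x \<in> A} + prob {x \<in> G. (x \<in> A) \<noteq> (I n x \<in> V)}"
      by (intro measure_Un_le sets_G_Collect) measurable
    ultimately have \<alpha>\<beta>: "\<bar>\<alpha> - \<beta>\<bar> \<le> e" using V by linarith
    have "\<alpha> * (1 - \<alpha>) - \<beta> * (1 - \<beta>) = (\<alpha> - \<beta>) * (1 - \<alpha> - \<beta>)" by (simp add: algebra_simps)
    also have "\<dots> \<le> \<bar>\<alpha> - \<beta>\<bar> * \<bar>1 - \<alpha> - \<beta>\<bar>" by (simp flip: abs_mult)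
    also have "\<dots> \<le> e * 1" using \<alpha>01 \<beta>01 \<alpha>\<beta> by (intro mult_mono) auto
    finally show ?thesis using \<beta> by linarith
  qed
  have "\<alpha> * (1 - \<alpha>) \<le> 0"
  proof (rule field_le_epsilon)
    show "\<alpha> * (1 - \<alpha>) \<le> 0 + e" if "e > 0" for e using bound[of "e / 17"] that by simp
  qed
  moreover have "0 \<le> \<alpha>" "\<alpha> \<le> 1" by (auto simp: \<alpha>_def)
  ultimately show "measure M A = 0 \<or> measure M A = 1"
    unfolding \<alpha>_def[symmetric] by (smt (verit) mult_pos_pos)
qed

end

section \<open>Rigidity\<close>

text \<open>\<open>L\<^sup>2\<close> convergence is reduced to \<open>L\<^sup>1\<close> convergence of the four functions \<open>sqpart c \<circ> f\<close> by means of
  \<open>(a - b)\<^sup>2 \<le> \<bar>a\<^sup>2 - b\<^sup>2\<bar>\<close> for nonnegative \<open>a\<close>, \<open>b\<close>.\<close>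

definition sqpart :: "complex \<Rightarrow> complex \<Rightarrow> real" where
  "sqpart c z = (max 0 (Re (c * z)))\<^sup>2"

lemma sqpart_diff: "(a - b)\<^sup>2 \<le>
    2 * (\<bar>(max 0 a)\<^sup>2 - (max 0 b)\<^sup>2\<bar> + \<bar>(max 0 (- a))\<^sup>2 - (max 0 (- b))\<^sup>2\<bar>)"
  for a b :: real
proof -
  have diff: "(max 0 a - max 0 b)\<^sup>2 \<le> \<bar>(max 0 a)\<^sup>2 - (max 0 b)\<^sup>2\<bar>" for a b :: real
  proof -
    have "\<bar>max 0 a - max 0 b\<bar> * \<bar>max 0 a - max 0 b\<bar> \<le> \<bar>max 0 a - max 0 b\<bar> * \<bar>max 0 a + max 0 b\<bar>"
      by (intro mult_left_mono) auto
    moreover have "\<bar>(max 0 a)\<^sup>2 - (max 0 b)\<^sup>2\<bar> = \<bar>max 0 a - max 0 b\<bar> * \<bar>max 0 a + max 0 b\<bar>"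
      by (simp only: power2_eq_square square_diff_square_factored abs_mult mult.commute)
    ultimately show ?thesis by (simp add: power2_eq_square)
  qed
  have "a - b = (max 0 a - max 0 b) + (max 0 (- b) - max 0 (- a))" by auto
  then have "(a - b)\<^sup>2 \<le> 2 * (max 0 a - max 0 b)\<^sup>2 + 2 * (max 0 (- b) - max 0 (- a))\<^sup>2"
    using sum_squares_bound[of "max 0 a - max 0 b" "max 0 (- b) - max 0 (- a)"]
    by (simp add: power2_sum)
  then show ?thesis
    using diff[of a b] diff[of "- a" "- b"] by (simp add: power2_commute[of "max 0 (- b)"])
qed

text \<open>The four multipliers select the positive and negative parts of the real and of the
  imaginary part.\<close>

lemma cmod_diff_le_sqpart:
  "(cmod (u - v))\<^sup>2 \<le> 2 * (\<bar>sqpart 1 u - sqpart 1 v\<bar> + \<bar>sqpart (- 1) u - sqpart (- 1) v\<bar> +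
     (\<bar>sqpart \<i> u - sqpart \<i> v\<bar> + \<bar>sqpart (- \<i>) u - sqpart (- \<i>) v\<bar>))"
proof -
  have eq: "sqpart 1 z = (max 0 (Re z))\<^sup>2" "sqpart (- 1) z = (max 0 (- Re z))\<^sup>2"
    "sqpart \<i> z = (max 0 (- Im z))\<^sup>2" "sqpart (- \<i>) z = (max 0 (Im z))\<^sup>2" for z
    by (simp_all add: sqpart_def)
  show ?thesis
    unfolding eq cmod_power2 minus_complex.sel
    using add_mono[OF sqpart_diff[of "Re u" "Re v"] sqpart_diff[of "Im u" "Im v"]]
    by (simp only: distrib_left ac_simps)
qed

context tower_system
begin

lemma distr_funpow: "distr M M (T ^^ k) = M"
proof (rule measure_eqI)
  fix A assume "A \<in> sets (distr M M (T ^^ k))"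
  then have A: "A \<in> sets M" by simp
  then have "emeasure (distr M M (T ^^ k)) A = emeasure M ((T ^^ k) -` A \<inter> space M)"
    by (intro emeasure_distr) auto
  also have "\<dots> = emeasure M A"
    using prob_funpow_vimage[OF A, of k] by (simp add: emeasure_eq_measure)
  finally show "emeasure (distr M M (T ^^ k)) A = emeasure M A" .
qed simp

lemma integrable_funpow:
  fixes g :: "'a \<Rightarrow> real"
  assumes "integrable M g"
  shows "integrable M (\<lambda>x. g ((T ^^ k) x))"
  using assms integrable_distr[of "T ^^ k" M M g] by (simp add: distr_funpow)

lemma integral_funpow:
  fixes g :: "'a \<Rightarrow> real"
  assumes "g \<in> borel_measurable M"
  shows "(\<integral>x. g ((T ^^ k) x) \<partial>M) = (\<integral>x. g x \<partial>M)"
  using assms integral_distr[of "T ^^ k" M M g] by (simp add: distr_funpow)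

text \<open>After \<open>h n\<close> steps a point has the same label unless it was in the last of
  the \<open>L n\<close> copies of its pile, an event of probability \<open>1 / L n\<close>. The
  other errors are that \<open>x\<close> or its image is misclassified by \<open>U\<close>; they
  have equal measure by invariance.\<close>

lemma set_return:
  assumes L: "filterlim L at_top sequentially" and A: "A \<in> sets M"
  shows "(\<lambda>n. prob {x \<in> space M. ((T ^^ h n) x \<in> A) \<noteq> (x \<in> A)}) \<longlonglongrightarrow> 0"
proof (rule tendstoI)
  fix e :: real assume "e > 0"
  then have e: "e / 3 > 0" by simp
  note [measurable] = A
  have "eventually (\<lambda>n. real (L n) > 3 / e) sequentially"
    using filterlim_compose[OF filterlim_real_sequentially L] by (simp add: filterlim_at_top_dense)
  then show "\<forall>\<^sub>F n in sequentially. dist (prob {x \<in> space M. ((T ^^ h n) x \<in> A) \<noteq> (x \<in> A)}) 0 < e"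
    using cells_dense[OF A e]
  proof eventually_elim
    case (elim n)
    then obtain U where U: "prob {x \<in> G. (x \<in> A) \<noteq> ((I n x, s n x) \<in> U)} < e / 3" by blast
    define E where "E = {x \<in> G. (x \<in> A) \<noteq> ((I n x, s n x) \<in> U)}"
    define F where "F = {x \<in> G. per n - h n \<le> s (Suc n) x mod per n}"
    have E [measurable]: "E \<in> sets M" unfolding E_def by (intro sets_G_Collect) measurable
    have F [measurable]: "F \<in> sets M" unfolding F_def by (intro sets_G_Collect) measurable
    let ?E' = "(T ^^ h n) -` E \<inter> space M"
    have E': "?E' \<in> sets M" by measurable
    have "{x \<in> space M. ((T ^^ h n) x \<in> A) \<noteq> (x \<in> A)} \<subseteq> (space M - G) \<union> (E \<union> (?E' \<union> F))"
    proof
      fix x assume x: "x \<in> {x \<in> space M. ((T ^^ h n) x \<in> A) \<noteq> (x \<in> A)}"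
      show "x \<in> (space M - G) \<union> (E \<union> (?E' \<union> F))"
      proof (rule ccontr)
        assume c: "x \<notin> (space M - G) \<union> (E \<union> (?E' \<union> F))"
        then have xG: "x \<in> G" "x \<notin> F" "x \<notin> E" "(T ^^ h n) x \<notin> E" using x by auto
        then have "s (Suc n) x mod per n + h n < per n" by (auto simp: F_def)
        then have "I n ((T ^^ h n) x) = I n x" "s n ((T ^^ h n) x) = s n x"
          using funpow_label_in_block[OF xG(1), of n "h n"] s_less[OF xG(1), of n] by auto
        then show False using xG(3,4) x xG(1) funpow_G[OF xG(1)] by (auto simp: E_def)
      qed
    qed
    then have "prob {x \<in> space M. ((T ^^ h n) x \<in> A) \<noteq> (x \<in> A)} \<le> prob ((space M - G) \<union> (E \<union> (?E' \<union> F)))"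
      using E' by (intro finite_measure_mono) auto
    also have "\<dots> \<le> prob (space M - G) + (prob E + (prob ?E' + prob F))"
      using E' by (intro order_trans[OF measure_Un_le] add_mono order_refl) auto
    also have "prob (space M - G) = 0" using prob_compl[OF G_sets] G_full by simp
    also have "prob ?E' = prob E" by (rule prob_funpow_vimage[OF E])
    also have "prob F = 1 / real (L n)"
      unfolding F_def using Suc_leI[OF L_pos] by (subst prob_late_in_block) auto
    also have "\<dots> < e / 3"
      using elim(1) \<open>e > 0\<close> by (simp add: field_simps)
    finally show ?case using U by (simp add: E_def)
  qed
qed

text \<open>The functions with this property form a closed subspace of L1, because composition with
  a power of \<open>T\<close> is an isometry; by \<open>set_return\<close> the subspace contains the
  indicators.\<close>

lemma L1_return:
  fixes f :: "'a \<Rightarrow> real"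
  assumes L: "filterlim L at_top sequentially" and f: "integrable M f"
  shows "(\<lambda>n. \<integral>x. \<bar>f ((T ^^ h n) x) - f x\<bar> \<partial>M) \<longlonglongrightarrow> 0"
  using f
proof (induction rule: integrable_induct)
  case (base A c)
  note [measurable] = base(1)
  have "(\<integral>x. \<bar>indicator A ((T ^^ h n) x) *\<^sub>R c - indicator A x *\<^sub>R c\<bar> \<partial>M) =
      \<bar>c\<bar> * prob {x \<in> space M. ((T ^^ h n) x \<in> A) \<noteq> (x \<in> A)}" for n
  proof -
    have "(\<integral>x. \<bar>indicator A ((T ^^ h n) x) *\<^sub>R c - indicator A x *\<^sub>R c\<bar> \<partial>M) =
        (\<integral>x. \<bar>c\<bar> * indicator {x \<in> space M. ((T ^^ h n) x \<in> A) \<noteq> (x \<in> A)} x \<partial>M)"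
      by (intro Bochner_Integration.integral_cong) (auto simp: indicator_def)
    then show ?thesis by simp
  qed
  then show ?case using tendsto_mult_right_zero[OF set_return[OF L base(1)], of "\<bar>c\<bar>"] by simp
next
  case (add f g)
  note [measurable] = borel_measurable_integrable[OF add(1)] borel_measurable_integrable[OF add(2)]
  show ?case
  proof (rule tendsto_sandwich[OF _ _ tendsto_const])
    show "\<forall>\<^sub>F n in sequentially. (\<integral>x. \<bar>f ((T ^^ h n) x) + g ((T ^^ h n) x) - (f x + g x)\<bar> \<partial>M) \<le>
        (\<integral>x. \<bar>f ((T ^^ h n) x) - f x\<bar> \<partial>M) + (\<integral>x. \<bar>g ((T ^^ h n) x) - g x\<bar> \<partial>M)"
    proof (intro always_eventually allI)
      fix n
      have "(\<integral>x. \<bar>f ((T ^^ h n) x) + g ((T ^^ h n) x) - (f x + g x)\<bar> \<partial>M) \<le>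
          (\<integral>x. \<bar>f ((T ^^ h n) x) - f x\<bar> + \<bar>g ((T ^^ h n) x) - g x\<bar> \<partial>M)"
        using add(1,2)
        by (intro integral_mono' Bochner_Integration.integrable_add integrable_abs
            Bochner_Integration.integrable_diff integrable_funpow) auto
      also have "\<dots> = (\<integral>x. \<bar>f ((T ^^ h n) x) - f x\<bar> \<partial>M) + (\<integral>x. \<bar>g ((T ^^ h n) x) - g x\<bar> \<partial>M)"
        using add(1,2) by (intro Bochner_Integration.integral_add integrable_abs
            Bochner_Integration.integrable_diff integrable_funpow)
      finally show "(\<integral>x. \<bar>f ((T ^^ h n) x) + g ((T ^^ h n) x) - (f x + g x)\<bar> \<partial>M) \<le>
        (\<integral>x. \<bar>f ((T ^^ h n) x) - f x\<bar> \<partial>M) + (\<integral>x. \<bar>g ((T ^^ h n) x) - g x\<bar> \<partial>M)" .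
    qed
    show "(\<lambda>n. (\<integral>x. \<bar>f ((T ^^ h n) x) - f x\<bar> \<partial>M) + (\<integral>x. \<bar>g ((T ^^ h n) x) - g x\<bar> \<partial>M)) \<longlonglongrightarrow> 0"
      using tendsto_add[OF add(3,4)] by simp
  qed (auto intro!: always_eventually integral_nonneg)
next
  case (lim f q)
  have [measurable]: "f \<in> borel_measurable M" "\<And>i. q i \<in> borel_measurable M"
    using lim(1,4) by auto
  have q_lim: "(\<lambda>i. \<integral>x. \<bar>q i x - f x\<bar> \<partial>M) \<longlonglongrightarrow> (\<integral>x. 0 \<partial>M)"
  proof (rule integral_dominated_convergence[where w = "\<lambda>x. 3 * \<bar>f x\<bar>"])
    show "AE x in M. (\<lambda>i. \<bar>q i x - f x\<bar>) \<longlonglongrightarrow> 0"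
      using lim(2) by (auto intro!: tendsto_rabs_zero LIM_zero)
    show "AE x in M. norm \<bar>q i x - f x\<bar> \<le> 3 * \<bar>f x\<bar>" for i
    proof (rule AE_I2)
      fix x assume "x \<in> space M"
      then show "norm \<bar>q i x - f x\<bar> \<le> 3 * \<bar>f x\<bar>" using lim(3)[of x i] by simp
    qed
  qed (use lim(4) in auto)
  show ?case
  proof (rule tendstoI)
    fix e :: real assume e: "e > 0"
    have "eventually (\<lambda>i. (\<integral>x. \<bar>q i x - f x\<bar> \<partial>M) < e / 3) sequentially"
      using q_lim e by (intro order_tendstoD) auto
    then obtain i where i: "(\<integral>x. \<bar>q i x - f x\<bar> \<partial>M) < e / 3"
      by (auto simp: eventually_sequentially)
    have "eventually (\<lambda>n. (\<integral>x. \<bar>q i ((T ^^ h n) x) - q i x\<bar> \<partial>M) < e / 3) sequentially"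
      using lim(5)[of i] e by (intro order_tendstoD) auto
    then show "\<forall>\<^sub>F n in sequentially. dist (\<integral>x. \<bar>f ((T ^^ h n) x) - f x\<bar> \<partial>M) 0 < e"
    proof eventually_elim
      case (elim n)
      note int = Bochner_Integration.integrable_add integrable_abs
            Bochner_Integration.integrable_diff integrable_funpow lim(1,4)
      have "(\<integral>x. \<bar>f ((T ^^ h n) x) - f x\<bar> \<partial>M) \<le> (\<integral>x. \<bar>q i ((T ^^ h n) x) - f ((T ^^ h n) x)\<bar> +
          (\<bar>q i ((T ^^ h n) x) - q i x\<bar> + \<bar>q i x - f x\<bar>) \<partial>M)"
        by (intro integral_mono' int) auto
      also have "\<dots> = (\<integral>x. \<bar>q i ((T ^^ h n) x) - f ((T ^^ h n) x)\<bar> \<partial>M) +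
          ((\<integral>x. \<bar>q i ((T ^^ h n) x) - q i x\<bar> \<partial>M) + (\<integral>x. \<bar>q i x - f x\<bar> \<partial>M))"
        by (subst Bochner_Integration.integral_add; (intro int)?)+ simp
      also have "(\<integral>x. \<bar>q i ((T ^^ h n) x) - f ((T ^^ h n) x)\<bar> \<partial>M) = (\<integral>x. \<bar>q i x - f x\<bar> \<partial>M)"
        by (rule integral_funpow[where g = "\<lambda>x. \<bar>q i x - f x\<bar>"]) measurable
      finally show ?case using i elim by (simp add: integral_nonneg)
    qed
  qed
qed

lemma rigid:
  assumes L: "filterlim L at_top sequentially"
  shows "rigid M T"
  unfolding rigid_def
proof (intro exI[of _ h] conjI allI impI strict_mono_h h_pos)
  fix f assume f: "square_integrable M f"
  then have [measurable]: "f \<in> borel_measurable M" and int: "integrable M (\<lambda>x. (cmod (f x))\<^sup>2)"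
    by (auto simp: square_integrable_def)
  define p where "p c x = sqpart c (f x)" for c x
  have p_int: "integrable M (p c)" if "cmod c = 1" for c
  proof (rule Bochner_Integration.integrable_bound[OF int])
    show "p c \<in> borel_measurable M" unfolding p_def sqpart_def by measurable
    have "p c x \<le> (cmod (f x))\<^sup>2" for x
      using complex_Re_le_cmod[of "c * f x"] that unfolding p_def sqpart_def
      by (intro power_mono) (auto simp: norm_mult)
    then show "AE x in M. norm (p c x) \<le> norm ((cmod (f x))\<^sup>2)" by (simp add: p_def sqpart_def)
  qed
  define d where "d c n x = \<bar>p c ((T ^^ h n) x) - p c x\<bar>" for c n x
  define R where "R n x = 2 * (d 1 n x + d (- 1) n x + (d \<i> n x + d (- \<i>) n x))" for n x
  have d_int: "integrable M (d c n)" if "cmod c = 1" for c n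
    unfolding d_def
    by (intro integrable_abs Bochner_Integration.integrable_diff integrable_funpow p_int that)
  have le: "(cmod (f ((T ^^ h n) x) - f x))\<^sup>2 \<le> R n x" for n x
    unfolding R_def d_def p_def by (rule cmod_diff_le_sqpart)
  have "(\<integral>x. R n x \<partial>M) = 2 * ((\<integral>x. d 1 n x \<partial>M) + (\<integral>x. d (- 1) n x \<partial>M) +
      ((\<integral>x. d \<i> n x \<partial>M) + (\<integral>x. d (- \<i>) n x \<partial>M)))" for n
    unfolding R_def by (simp add: d_int)
  moreover have "(\<lambda>n. 2 * ((\<integral>x. d 1 n x \<partial>M) + (\<integral>x. d (- 1) n x \<partial>M) +
      ((\<integral>x. d \<i> n x \<partial>M) + (\<integral>x. d (- \<i>) n x \<partial>M)))) \<longlonglongrightarrow> 2 * (0 + 0 + (0 + 0))"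
    unfolding d_def by (intro tendsto_mult tendsto_add tendsto_const L1_return[OF L] p_int) auto
  ultimately have R0: "(\<lambda>n. \<integral>x. R n x \<partial>M) \<longlonglongrightarrow> 0" by simp
  have "(\<lambda>n. \<integral>x. (cmod (f ((T ^^ h n) x) - f x))\<^sup>2 \<partial>M) \<longlonglongrightarrow> 0"
  proof (rule tendsto_sandwich[OF _ _ tendsto_const R0])
    show "\<forall>\<^sub>F n in sequentially. (\<integral>x. (cmod (f ((T ^^ h n) x) - f x))\<^sup>2 \<partial>M) \<le> (\<integral>x. R n x \<partial>M)"
    proof (intro always_eventually allI integral_mono' le)
      show "integrable M (R n)" for n
        unfolding R_def by (simp add: d_int)
    qed (auto simp: R_def d_def)
  qed (auto intro!: always_eventually integral_nonneg)
  from tendsto_real_sqrt[OF this]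
  show "(\<lambda>n. l2_norm M (\<lambda>x. f ((T ^^ h n) x) - f x)) \<longlonglongrightarrow> 0"
    by (simp add: l2_norm_def)
qed

end

section \<open>Covering numbers\<close>

lemma length_name_of [simp]: "length (name_of P T n x) = n"
  by (simp add: name_of_def)

definition cell :: "'a set set \<Rightarrow> 'a \<Rightarrow> 'a set" where
  "cell P y = (THE p. p \<in> P \<and> y \<in> p)"

lemma hamming_dist_name_of:
  "hamming_dist (name_of P T n x) (name_of P T n y) =
     (\<Sum>k<n. of_bool (cell P ((T ^^ k) x) \<noteq> cell P ((T ^^ k) y))) / real n"
proof -
  have "{k. k < length (name_of P T n x) \<and> name_of P T n x ! k \<noteq> name_of P T n y ! k} =
      {..<n} \<inter> {k. cell P ((T ^^ k) x) \<noteq> cell P ((T ^^ k) y)}"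
    by (auto simp: name_of_def cell_def)
  then show ?thesis by (simp add: hamming_dist_def)
qed

lemma cell_unique:
  assumes "partition_on X P" "p \<in> P" "y \<in> p"
  shows "cell P y = p"
  unfolding cell_def using assms by (intro the_equality) (auto simp: partition_on_def disjoint_def)

lemma cell_in:
  assumes "partition_on X P" "y \<in> X"
  shows "cell P y \<in> P" "y \<in> cell P y"
proof -
  obtain p where p: "p \<in> P" "y \<in> p" using assms by (auto simp: partition_on_def)
  then show "cell P y \<in> P" "y \<in> cell P y" using cell_unique[OF assms(1) p] by auto
qed

locale partitioned_system = prob_space M for M :: "'a measure" +
  fixes T :: "'a \<Rightarrow> 'a" and P :: "'a set set"
  assumes T_measurable' [measurable]: "T \<in> measurable M M"
    and P: "finite_measurable_partition M P"
begin

lemma P_partition: "partition_on (space M) P" and P_finite: "finite P" and P_sets: "P \<subseteq> sets M"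
  using P by (auto simp: finite_measurable_partition_def)

lemma funpow_measurable' [measurable]: "(T ^^ k) \<in> measurable M M"
  by (induction k) (auto simp: comp_def)

lemma funpow_space: "x \<in> space M \<Longrightarrow> (T ^^ k) x \<in> space M"
  by (rule measurable_space[OF funpow_measurable'])

lemma cell_measurable [measurable]: "cell P \<in> measurable M (count_space UNIV)"
proof (rule measurableI)
  fix Q :: "'a set set"
  have "cell P -` Q \<inter> space M = \<Union>(P \<inter> Q)"
  proof (intro set_eqI iffI)
    fix x assume "x \<in> cell P -` Q \<inter> space M"
    then show "x \<in> \<Union>(P \<inter> Q)" using cell_in[OF P_partition, of x] by auto
  next
    fix x assume "x \<in> \<Union>(P \<inter> Q)"
    then obtain p where p: "p \<in> P" "p \<in> Q" "x \<in> p" by auto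
    then show "x \<in> cell P -` Q \<inter> space M"
      using cell_unique[OF P_partition p(1,3)] P_sets sets.sets_into_space by auto
  qed
  also have "\<dots> \<in> sets M"
    using P_finite P_sets by (intro sets.finite_Union) auto
  finally show "cell P -` Q \<inter> space M \<in> sets M" .
qed simp

lemma hamming_ball_eq:
  "hamming_ball M P T n e x = {y \<in> space M.
     (\<Sum>k<n. of_bool (cell P ((T ^^ k) x) \<noteq> cell P ((T ^^ k) y))) / real n < e}"
  by (simp only: hamming_ball_def hamming_dist_name_of)

lemma hamming_ball_sets [measurable]: "hamming_ball M P T n e x \<in> sets M"
  unfolding hamming_ball_eq by measurable

lemma hamming_ball_center: "0 < e \<Longrightarrow> x \<in> space M \<Longrightarrow> x \<in> hamming_ball M P T n e x"
  by (simp add: hamming_ball_eq)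

lemma finite_hamming_balls: "finite (hamming_ball M P T n e ` space M)"
proof -
  have "name_of P T n ` space M \<subseteq> {w. set w \<subseteq> P \<and> length w = n}"
    using cell_in(1)[OF P_partition funpow_space] by (auto simp: name_of_def cell_def)
  then have "finite (name_of P T n ` space M)"
    using finite_lists_length_eq[OF P_finite, of n] finite_subset by blast
  moreover have "hamming_ball M P T n e ` space M =
      (\<lambda>w. {y \<in> space M. hamming_dist w (name_of P T n y) < e}) ` name_of P T n ` space M"
    by (auto simp: hamming_ball_def image_image)
  ultimately show ?thesis by simp
qed

lemma covering_number_le:
  assumes "finite F" "F \<subseteq> hamming_ball M P T n e ` space M" "prob (\<Union>F) > 1 - e"
  shows "covering_number M P T n e \<le> card F"
  unfolding covering_number_def using assms by (intro Least_le) blast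

lemma covering_number_attained:
  assumes "e > 0"
  obtains F where "finite F" "card F = covering_number M P T n e"
    "F \<subseteq> hamming_ball M P T n e ` space M" "prob (\<Union>F) > 1 - e"
proof -
  let ?F = "hamming_ball M P T n e ` space M"
  have "\<Union>?F = space M"
    using hamming_ball_center[OF assms] by (auto simp: hamming_ball_def)
  then have "\<exists>F. finite F \<and> card F = card ?F \<and> F \<subseteq> ?F \<and> prob (\<Union>F) > 1 - e"
    using finite_hamming_balls assms by (intro exI[of _ ?F]) (simp add: prob_space)
  from LeastI[where P = "\<lambda>c. \<exists>F. finite F \<and> card F = c \<and> F \<subseteq> ?F \<and> prob (\<Union>F) > 1 - e", OF this]
  show ?thesis using that unfolding covering_number_def by blast
qed

text \<open>The same centres are used with the larger radius. Selecting one centre for each ball of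
  the family ensures that the number of balls does not grow.\<close>

lemma covering_number_antimono:
  assumes "0 < e" "e \<le> e'"
  shows "covering_number M P T n e' \<le> covering_number M P T n e"
proof -
  obtain F where F: "finite F" "card F = covering_number M P T n e"
    "F \<subseteq> hamming_ball M P T n e ` space M" "prob (\<Union>F) > 1 - e"
    by (rule covering_number_attained[OF assms(1)])
  obtain C where C: "C \<subseteq> space M" "inj_on (hamming_ball M P T n e) C" "F = hamming_ball M P T n e ` C"
    using F(3) unfolding subset_image_inj by blast
  let ?F = "hamming_ball M P T n e' ` C"
  have finC: "finite C" using F(1) C(2,3) by (simp add: finite_image_iff)
  have "prob (\<Union>F) \<le> prob (\<Union>?F)"
    using assms(2) finC unfolding C(3)
    by (intro finite_measure_mono UN_mono sets.finite_UN hamming_ball_sets)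
       (force simp: hamming_ball_def)+
  then have "covering_number M P T n e' \<le> card ?F"
    using F(4) C(1) finC assms(2) by (intro covering_number_le) auto
  also have "\<dots> \<le> card C" by (rule card_image_le[OF finC])
  also have "\<dots> = card F" using C by (simp add: card_image)
  finally show ?thesis using F(2) by simp
qed

lemma slow_growth_exponent_antimono:
  assumes "0 < e" "e \<le> e'"
  shows "slow_growth_exponent (\<lambda>n t. real n powr t) M T e' P \<le>
    slow_growth_exponent (\<lambda>n t. real n powr t) M T e P"
  unfolding slow_growth_exponent_def
proof (rule SUP_subset_mono)
  show "slow_growth_set (\<lambda>n t. real n powr t) M T e' P \<subseteq> slow_growth_set (\<lambda>n t. real n powr t) M T e P"
  proof
    fix t assume t: "t \<in> slow_growth_set (\<lambda>n t. real n powr t) M T e' P"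
    have "liminf (\<lambda>n. ereal (real (covering_number M P T n e') / real n powr t)) \<le>
        liminf (\<lambda>n. ereal (real (covering_number M P T n e) / real n powr t))"
      using covering_number_antimono[OF assms]
      by (intro Liminf_mono always_eventually) (auto intro!: divide_right_mono)
    then show "t \<in> slow_growth_set (\<lambda>n t. real n powr t) M T e P"
      using t by (auto simp: slow_growth_set_def)
  qed
qed simp

end

lemma tendsto_at_right_antimono:
  fixes f :: "real \<Rightarrow> ennreal"
  assumes "\<And>x y. 0 < x \<Longrightarrow> x \<le> y \<Longrightarrow> f y \<le> f x"
  shows "(f \<longlongrightarrow> (SUP x\<in>{0<..}. f x)) (at_right 0)"
proof (rule order_tendstoI)
  fix a assume "a < (SUP x\<in>{0<..}. f x)"
  then obtain x where x: "x > 0" "a < f x" by (auto simp: less_SUP_iff)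
  then have "\<forall>\<^sub>F y in at_right 0. 0 < y \<and> y < x"
    by (intro eventually_conj eventually_at_right_less eventually_at_right_real[of 0 x, THEN eventually_mono]) auto
  then show "\<forall>\<^sub>F y in at_right 0. a < f y"
    by eventually_elim (use assms x in \<open>force intro: less_le_trans\<close>)
next
  fix a assume a: "(SUP x\<in>{0<..}. f x) < a"
  show "\<forall>\<^sub>F y in at_right 0. f y < a"
    using eventually_at_right_less[of "0 :: real"]
    by eventually_elim (use a in \<open>auto intro: le_less_trans[OF SUP_upper]\<close>)
qed

lemma Lim_slow_growth_exponent:
  assumes "prob_space M" "T \<in> measurable M M" "finite_measurable_partition M P"
  shows "Lim (at_right 0) (\<lambda>e. slow_growth_exponent (\<lambda>n t. real n powr t) M T e P) =
    (SUP e\<in>{0<..}. slow_growth_exponent (\<lambda>n t. real n powr t) M T e P)"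
proof -
  interpret prob_space M by fact
  interpret partitioned_system M T P using assms(2,3) by unfold_locales
  show ?thesis
    by (intro tendsto_Lim tendsto_at_right_antimono slow_growth_exponent_antimono) auto
qed

lemma lower_slow_entropy_le:
  assumes "prob_space M" "T \<in> measurable M M"
    and "\<And>P e. finite_measurable_partition M P \<Longrightarrow> 0 < e \<Longrightarrow>
      slow_growth_exponent (\<lambda>n t. real n powr t) M T e P \<le> u"
  shows "lower_slow_entropy (\<lambda>n t. real n powr t) M T \<le> u"
  unfolding lower_slow_entropy_def
  using assms by (auto intro!: SUP_least simp: Lim_slow_growth_exponent)

lemma lower_slow_entropy_ge:
  assumes "prob_space M" "T \<in> measurable M M" "finite_measurable_partition M P" "0 < e"
  shows "slow_growth_exponent (\<lambda>n t. real n powr t) M T e P \<le> lower_slow_entropy (\<lambda>n t. real n powr t) M T"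
proof -
  have "slow_growth_exponent (\<lambda>n t. real n powr t) M T e P \<le>
      Lim (at_right 0) (\<lambda>e. slow_growth_exponent (\<lambda>n t. real n powr t) M T e P)"
    unfolding Lim_slow_growth_exponent[OF assms(1-3)] using assms(4) by (intro SUP_upper) auto
  also have "\<dots> \<le> lower_slow_entropy (\<lambda>n t. real n powr t) M T"
    unfolding lower_slow_entropy_def using assms(3) by (intro SUP_upper) auto
  finally show ?thesis .
qed

section \<open>Covering numbers of tower systems\<close>

context tower_system
begin

text \<open>The value \<open>0\<close> outside the full set \<open>G\<close> only serves to make \<open>base\<close> a partition of the whole space.\<close>

definition sym :: "'a \<Rightarrow> nat" where
  "sym x = (if x \<in> G then I 0 x else 0)"

definition base :: "'a set set" where
  "base = (\<lambda>i. {x \<in> space M. sym x = i}) ` {..<tow 0} - {{}}"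

lemma sym_less: "sym x < tow 0"
  using I_less[of x 0] by (simp add: sym_def)

lemma sym_measurable [measurable]: "sym \<in> measurable M (count_space UNIV)"
  unfolding sym_def by measurable

lemma base_partition: "finite_measurable_partition M base"
  unfolding finite_measurable_partition_def partition_on_def
proof (intro conjI)
  show "base \<subseteq> sets M" unfolding base_def by auto
  show "\<Union>base = space M" using sym_less by (auto simp: base_def)
  show "disjoint base" by (auto simp: base_def disjoint_def)
qed (auto simp: base_def)

lemma cell_base:
  assumes "y \<in> space M"
  shows "cell base y = {x \<in> space M. sym x = sym y}"
proof (rule cell_unique)
  show "partition_on (space M) base"
    using base_partition by (simp add: finite_measurable_partition_def)
  show "{x \<in> space M. sym x = sym y} \<in> base"
    using assms sym_less[of y] by (auto simp: base_def)
qed (use assms in simp)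

lemma cell_base_eq_iff:
  "x \<in> space M \<Longrightarrow> y \<in> space M \<Longrightarrow> cell base x = cell base y \<longleftrightarrow> sym x = sym y"
  by (auto simp: cell_base)

section \<open>Lower bound for covering numbers: separation of names along different towers\<close>

lemma I_0_word: "x \<in> G \<Longrightarrow> I 0 x = word L n (I n x) (s n x)"
proof (induction n)
  case (Suc n)
  then show ?case using I_proj[OF Suc.prems, of n] s_proj[OF Suc.prems, of n] by simp
qed simp

lemma sym_funpow:
  assumes "x \<in> G" "s n x + k < h n"
  shows "sym ((T ^^ k) x) = word L n (I n x) (s n x + k)"
  using I_0_word[OF funpow_G[OF assms(1)], of k n] funpow_label[OF assms] funpow_G[OF assms(1), of k]
  by (simp add: sym_def)

text \<open>A Hamming ball meets a given level of stage \<open>n + 2\<close> only in towers with one common value at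
  some \<open>j\<close>, that is, in a fraction \<open>1 / tow (n + 1)\<close> of the level.\<close>

lemma ball_level_label:
  assumes N: "16 * per n \<le> N" "N < 16 * per (Suc n)" and e: "0 < e" "e \<le> 1/256"
    and \<sigma>: "\<sigma> + per (Suc n) \<le> h (Suc (Suc n))"
  shows "prob {y \<in> G. y \<in> hamming_ball M base T N e x \<and> s (Suc (Suc n)) y = \<sigma>}
    \<le> 1 / (real (tow (Suc n)) * real (h (Suc (Suc n))))"
proof -
  define n2 where "n2 = Suc (Suc n)"
  \<comment> \<open>\<open>window_distance\<close> only admits windows within the length of a block;
    shortening \<open>N\<close> to that length costs at most a factor 16.\<close>
  define M' where "M' = min N (per (Suc n))"
  have M'_le: "M' \<le> N" "M' \<le> per (Suc n)" by (auto simp: M'_def)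
  have N_le: "N \<le> 16 * M'" using N(2) by (auto simp: M'_def)
  have "2 * (8 * per n) \<le> L (Suc n) * (blk n * per n)"
    by (intro mult_le_mono L_ge_2 blk_ge_8 order_refl)
  then have "16 * per n \<le> per (Suc n)" by simp
  then have M'_ge: "16 * per n \<le> M'" using N(1) by (simp add: M'_def)
  have N0: "N > 0" using N(1) per_pos[of n] by linarith
  have "\<sigma> + M' \<le> h (Suc (Suc n))" using \<sigma> M'_le by linarith
  from window_distance[OF M'_ge M'_le(2) this] obtain j where
    j: "\<And>i i'. lab (Suc n) i j \<noteq> lab (Suc n) i' j \<Longrightarrow>
      (\<Sum>k<M'. differ n2 i i' (\<sigma> + k)) \<ge> real M' / 8"
    unfolding n2_def by blast
  define S where "S = {y \<in> G. y \<in> hamming_ball M base T N e x \<and> s n2 y = \<sigma>}"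
  interpret partitioned_system M T base
    using base_partition by unfold_locales auto
  have same: "lab (Suc n) (I n2 y) j = lab (Suc n) (I n2 z) j" if "y \<in> S" "z \<in> S" for y z
  proof (rule ccontr)
    assume "lab (Suc n) (I n2 y) j \<noteq> lab (Suc n) (I n2 z) j"
    then have "real M' / 8 \<le> (\<Sum>k<M'. differ n2 (I n2 y) (I n2 z) (\<sigma> + k))" by (rule j)
    also have "\<dots> = (\<Sum>k<M'. of_bool (cell base ((T ^^ k) y) \<noteq> cell base ((T ^^ k) z)))"
    proof (intro sum.cong refl)
      fix k assume "k \<in> {..<M'}"
      then have k: "\<sigma> + k < h n2" using \<sigma> M'_le unfolding n2_def by simp
      have y: "y \<in> G" "s n2 y = \<sigma>" and z: "z \<in> G" "s n2 z = \<sigma>"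
        using that by (auto simp: S_def)
      have "cell base ((T ^^ k) y) = cell base ((T ^^ k) z) \<longleftrightarrow> sym ((T ^^ k) y) = sym ((T ^^ k) z)"
        using y z by (intro cell_base_eq_iff funpow_space G_space)
      also have "\<dots> \<longleftrightarrow> word L n2 (I n2 y) (\<sigma> + k) = word L n2 (I n2 z) (\<sigma> + k)"
        using sym_funpow[OF y(1), of n2 k] sym_funpow[OF z(1), of n2 k] y z k by simp
      finally show "differ n2 (I n2 y) (I n2 z) (\<sigma> + k) =
          of_bool (cell base ((T ^^ k) y) \<noteq> cell base ((T ^^ k) z))" by simp
    qed
    also have "\<dots> \<le> (\<Sum>k<N. of_bool (cell base ((T ^^ k) y) \<noteq> cell base ((T ^^ k) z)))"
      using M'_le by (intro sum_mono2) auto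
    also have "\<dots> \<le> (\<Sum>k<N. of_bool (cell base ((T ^^ k) x) \<noteq> cell base ((T ^^ k) y)) +
        of_bool (cell base ((T ^^ k) x) \<noteq> cell base ((T ^^ k) z)))"
      by (intro sum_mono) auto
    also have "\<dots> < real N * e + real N * e"
      using that N0 unfolding sum.distrib S_def hamming_ball_eq
      by (intro add_strict_mono) (simp_all add: pos_divide_less_eq mult.commute)
    also have "\<dots> \<le> real M' / 8"
    proof -
      \<comment> \<open>Two points of one ball differ at fewer than \<open>2 * N * e\<close> times,
        and \<open>N\<close> is at most \<open>16 * M'\<close>. Staying below \<open>M' / 8\<close>
        thus asks for \<open>e\<close> at most 1/(2 * 16 * 8) = 1/256.\<close>
      have "real N * e \<le> (16 * real M') * (1/256)"
        using N_le e by (intro mult_mono) auto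
      then show ?thesis by simp argo
    qed
    finally show False by simp
  qed
  show ?thesis
  proof (cases "S = {}")
    case True
    then have "prob S = 0" by simp
    then show ?thesis unfolding S_def n2_def by (simp del: hgt.simps)
  next
    case False
    then obtain z where z: "z \<in> S" by auto
    define c where "c = lab (Suc n) (I n2 z) j"
    have "prob S \<le> prob {y \<in> G. lab (Suc n) (I n2 y) j = c \<and> s n2 y = \<sigma>}"
    proof (intro finite_measure_mono sets_G_Collect)
      show "S \<subseteq> {y \<in> G. lab (Suc n) (I n2 y) j = c \<and> s n2 y = \<sigma>}"
        using same[OF _ z] by (auto simp: S_def c_def)
    qed measurable
    also have "\<dots> = (\<Sum>i<tow n2. \<Sum>l<h n2. of_bool (lab (Suc n) i j = c \<and> l = \<sigma>)) /
        (real (tow n2) * real (h n2))"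
      by (rule prob_label[where P = "\<lambda>i l. lab (Suc n) i j = c \<and> l = \<sigma>"])
    also have "(\<Sum>i<tow n2. \<Sum>l<h n2. of_bool (lab (Suc n) i j = c \<and> l = \<sigma>)) =
        (\<Sum>i<tow n2. of_bool (lab (Suc n) i j = c) :: real)"
    proof (intro sum.cong refl)
      fix i
      have "\<sigma> < h n2" using \<sigma> per_pos[of "Suc n"] unfolding n2_def by linarith
      then have "{..<h n2} \<inter> {l. lab (Suc n) i j = c \<and> l = \<sigma>} = (if lab (Suc n) i j = c then {\<sigma>} else {})"
        by auto
      then show "(\<Sum>l<h n2. of_bool (lab (Suc n) i j = c \<and> l = \<sigma>)) = (of_bool (lab (Suc n) i j = c) :: real)"
        by (simp del: hgt.simps)
    qed
    also have "\<dots> = real (card {i. i < tow n2 \<and> lab (Suc n) i j = c})"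
      by (subst card_less_Collect) simp
    also have "\<dots> = real (slp (Suc n))"
      unfolding n2_def c_def by (subst card_lab_fiber) auto
    also have "real (slp (Suc n)) / (real (tow n2) * real (h n2)) =
        1 / (real (tow (Suc n)) * real (h n2))"
      unfolding n2_def tow_Suc[of "Suc n"] using slp_pos[of "Suc n"] by (simp add: field_simps del: hgt.simps slp_pos)
    finally show ?thesis by (simp add: S_def n2_def del: hgt.simps)
  qed
qed

text \<open>Summed over the levels that leave room for a full window,
  \<open>ball_level_label\<close> shows that a ball covers at most \<open>1 / tow (n + 1)\<close> of
  the space. The remaining levels, one block out of \<open>blk (n + 1)\<close>, have measure at most
  1/8, so more than half of \<open>tow (n + 1)\<close> balls are needed for the rest.\<close>

lemma covering_number_ge:
  assumes N: "16 * per n \<le> N" "N < 16 * per (Suc n)" and e: "0 < e" "e \<le> 1/256"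
  shows "real (covering_number M base T N e) \<ge> real (tow (Suc n)) / 2"
proof -
  define n2 where "n2 = Suc (Suc n)"
  define K where "K = real (tow (Suc n))"
  have K: "K > 0" by (simp add: K_def)
  interpret partitioned_system M T base
    using base_partition by unfold_locales auto
  obtain F where F: "finite F" "card F = covering_number M base T N e"
    "F \<subseteq> hamming_ball M base T N e ` space M" "prob (\<Union>F) > 1 - e"
    by (rule covering_number_attained[OF e(1)])
  have F_sets: "b \<in> sets M" if "b \<in> F" for b using F(3) that by auto
  define late where "late = {y \<in> G. h n2 < s n2 y + per (Suc n)}"
  define early where "early b = {y \<in> G. y \<in> b \<and> s n2 y + per (Suc n) \<le> h n2}" for b
  have late_sets: "late \<in> sets M" unfolding late_def by (intro sets_G_Collect) measurable
  have early_sets: "early b \<in> sets M" if "b \<in> F" for b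
  proof -
    note [measurable] = F_sets[OF that]
    show ?thesis unfolding early_def by (intro sets_G_Collect) measurable
  qed
  have early: "prob (early b) \<le> 1 / K" if b: "b \<in> F" for b
  proof -
    obtain x where x: "b = hamming_ball M base T N e x" using F(3) b by auto
    let ?lev = "\<lambda>\<sigma>. {y \<in> G. y \<in> b \<and> s n2 y = \<sigma>}"
    let ?A = "{\<sigma>. \<sigma> < h n2 \<and> \<sigma> + per (Suc n) \<le> h n2}"
    have eq: "early b = (\<Union>\<sigma>\<in>?A. ?lev \<sigma>)"
      using s_less[of _ n2] by (auto simp: early_def)
    have lev_sets: "?lev \<sigma> \<in> sets M" for \<sigma>
    proof -
      note [measurable] = F_sets[OF b]
      show ?thesis by (intro sets_G_Collect) measurable
    qed
    have "prob (early b) \<le> (\<Sum>\<sigma>\<in>?A. prob (?lev \<sigma>))"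
      unfolding eq using lev_sets by (intro measure_UNION_le) auto
    also have "\<dots> \<le> (\<Sum>\<sigma>\<in>?A. 1 / (K * real (h n2)))"
      unfolding x K_def n2_def by (intro sum_mono ball_level_label[OF N e]) simp
    also have "\<dots> = real (card ?A) * (1 / (K * real (h n2)))" by (rule sum_constant)
    also have "\<dots> \<le> real (h n2) * (1 / (K * real (h n2)))"
    proof (rule mult_right_mono)
      have "card ?A \<le> card {..<h n2}" by (intro card_mono) auto
      then show "real (card ?A) \<le> real (h n2)" by simp
    qed (use K in simp)
    also have "\<dots> = 1 / K" by (simp del: hgt.simps)
    finally show ?thesis .
  qed
  have late: "prob late \<le> 1/8"
  proof -
    have "prob late = real (card {j. j < h n2 \<and> h n2 < j + per (Suc n)}) / real (h n2)"
      unfolding late_def by (rule prob_level)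
    also have "\<dots> \<le> real (per (Suc n)) / real (h n2)"
    proof (intro divide_right_mono of_nat_mono)
      have "card {j. j < h n2 \<and> h n2 < j + per (Suc n)} \<le> card {h n2 - per (Suc n)..<h n2}"
        by (intro card_mono) auto
      then show "card {j. j < h n2 \<and> h n2 < j + per (Suc n)} \<le> per (Suc n)" by simp
    qed simp
    also have "\<dots> = 1 / real (blk (Suc n))"
      unfolding n2_def h_Suc[of "Suc n"] by (simp del: hgt.simps)
    also have "\<dots> \<le> 1/8" using blk_ge_8[of "Suc n"] by (intro divide_left_mono) auto
    finally show ?thesis .
  qed
  have "1 - e < prob (\<Union>F)" by (rule F(4))
  also have "\<dots> = prob {y \<in> G. y \<in> \<Union>F}"
    using F(1) F_sets by (intro prob_G_Collect) auto
  also have "\<dots> \<le> prob (late \<union> (\<Union>b\<in>F. early b))"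
  proof (rule finite_measure_mono)
    show "late \<union> (\<Union>b\<in>F. early b) \<in> sets M" using F(1) late_sets early_sets by auto
  qed (auto simp: late_def early_def not_less)
  also have "\<dots> \<le> prob late + prob (\<Union>b\<in>F. early b)"
    using F(1) late_sets early_sets by (intro measure_Un_le) auto
  also have "prob (\<Union>b\<in>F. early b) \<le> (\<Sum>b\<in>F. prob (early b))"
    using F(1) early_sets by (intro measure_UNION_le) auto
  also have "\<dots> \<le> (\<Sum>b\<in>F. 1 / K)" by (intro sum_mono early)
  also have "\<dots> = real (card F) / K" by simp
  finally have "1 - e < prob late + real (card F) / K" by simp
  then have "real (card F) / K > 1 / 2"
    using late e(2) by argo
  then show ?thesis using K F(2) by (simp add: K_def field_simps)
qed

section \<open>Upper bound for covering numbers: labels code most names\<close>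

lemma label_coding:
  assumes P: "finite_measurable_partition M P" and \<eta>: "\<eta> > 0"
  shows "\<forall>\<^sub>F n in sequentially. \<exists>Q. prob {x \<in> G. cell P x \<noteq> Q (I n x, s n x)} < \<eta>"
proof -
  interpret partitioned_system M T P using P by unfold_locales auto
  have PM: "p \<in> sets M" if "p \<in> P" for p using that P_sets by auto
  define \<delta> where "\<delta> = \<eta> / real (card P + 1)"
  have \<delta>: "\<delta> > 0" using \<eta> by (simp add: \<delta>_def)
  have "\<forall>\<^sub>F n in sequentially. \<forall>p\<in>P. \<exists>U. prob {x \<in> G. (x \<in> p) \<noteq> ((I n x, s n x) \<in> U)} < \<delta>"
    using P_finite by (intro eventually_ball_finite ballI cells_dense PM \<delta>)
  then show ?thesis
  proof eventually_elim
    case (elim n)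
    then obtain U where U: "\<And>p. p \<in> P \<Longrightarrow> prob {x \<in> G. (x \<in> p) \<noteq> ((I n x, s n x) \<in> U p)} < \<delta>"
      by metis
    \<comment> \<open>Off the union of the approximation errors, \<open>U p\<close> contains the
      label of \<open>x\<close> for exactly one atom \<open>p\<close>, the one containing
      \<open>x\<close>, so the choice is forced there.\<close>
    define Q where "Q l = (SOME p. p \<in> P \<and> l \<in> U p)" for l
    have E_sets: "{x \<in> G. (x \<in> p) \<noteq> ((I n x, s n x) \<in> U p)} \<in> sets M" if "p \<in> P" for p
    proof (rule sets_G_Collect)
      have [measurable]: "p \<in> sets M" using PM[OF that] .
      show "Measurable.pred M (\<lambda>x. (x \<in> p) \<noteq> ((I n x, s n x) \<in> U p))" by measurable
    qed
    have "{x \<in> G. cell P x \<noteq> Q (I n x, s n x)} \<subseteq> (\<Union>p\<in>P. {x \<in> G. (x \<in> p) \<noteq> ((I n x, s n x) \<in> U p)})"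
    proof (rule subsetI, rule ccontr)
      fix x assume x: "x \<in> {x \<in> G. cell P x \<noteq> Q (I n x, s n x)}"
        "x \<notin> (\<Union>p\<in>P. {x \<in> G. (x \<in> p) \<noteq> ((I n x, s n x) \<in> U p)})"
      then have xG: "x \<in> G" and iff: "\<And>p. p \<in> P \<Longrightarrow> x \<in> p \<longleftrightarrow> (I n x, s n x) \<in> U p" by auto
      note c = cell_in[OF P_partition G_space[OF xG]]
      have "cell P x \<in> P \<and> (I n x, s n x) \<in> U (cell P x)" using c iff by blast
      then have "Q (I n x, s n x) \<in> P \<and> (I n x, s n x) \<in> U (Q (I n x, s n x))"
        unfolding Q_def by (rule someI)
      then have "cell P x = Q (I n x, s n x)"
        using iff cell_unique[OF P_partition] by blast
      then show False using x(1) by simp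
    qed
    then have "prob {x \<in> G. cell P x \<noteq> Q (I n x, s n x)} \<le>
        prob (\<Union>p\<in>P. {x \<in> G. (x \<in> p) \<noteq> ((I n x, s n x) \<in> U p)})"
      using E_sets P_finite by (intro finite_measure_mono sets.finite_UN)
    also have "\<dots> \<le> (\<Sum>p\<in>P. prob {x \<in> G. (x \<in> p) \<noteq> ((I n x, s n x) \<in> U p)})"
      using E_sets P_finite by (intro measure_UNION_le)
    also have "\<dots> \<le> (\<Sum>p\<in>P. \<delta>)" using U by (intro sum_mono) (auto intro: less_imp_le)
    also have "\<dots> < \<eta>" using \<eta> by (simp add: \<delta>_def field_simps)
    finally show ?case by blast
  qed
qed

text \<open>Two points with the same label that are not about to leave their piles keep equal labels
  for \<open>N\<close> steps. Their names then differ only at visits to the set \<open>D\<close>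
  where the label fails to determine the atom, and for most points such visits are rare. One ball
  per label therefore suffices.\<close>

lemma covering_number_le_labels:
  assumes P: "finite_measurable_partition M P" and e: "e > 0"
  shows "\<forall>\<^sub>F n in sequentially. \<forall>N. 0 < N \<and> real N \<le> e / 2 * real (per n) \<longrightarrow>
    covering_number M P T N e \<le> tow n * h n"
proof -
  interpret partitioned_system M T P using P by unfold_locales auto
  \<comment> \<open>By Markov's inequality a set of measure below \<open>e\<^sup>2 / 8\<close> is
    visited with frequency \<open>e / 2\<close> or more only by points of measure below
    \<open>e / 4\<close>. Together with the late points, of measure at most \<open>e / 2\<close>,
    less than \<open>e\<close> is discarded.\<close>
  have "e\<^sup>2 / 8 > 0" using e by simp
  from label_coding[OF P this] show ?thesis
  proof eventually_elim
    case (elim n)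
    then obtain Q where Q: "prob {x \<in> G. cell P x \<noteq> Q (I n x, s n x)} < e\<^sup>2 / 8" by blast
    define D where "D = {x \<in> G. cell P x \<noteq> Q (I n x, s n x)}"
    have D [measurable]: "D \<in> sets M" unfolding D_def by (intro sets_G_Collect) measurable
    show ?case
    proof (intro allI impI)
      fix N assume "0 < N \<and> real N \<le> e / 2 * real (per n)"
      then have N: "0 < N" "real N \<le> e / 2 * real (per n)" by auto
      define Z where "Z x = (\<Sum>k<N. indicator D ((T ^^ k) x)) / real N" for x :: 'a
      have Z [measurable]: "Z \<in> borel_measurable M" unfolding Z_def by measurable
      have Z_nonneg: "Z x \<ge> 0" for x by (simp add: Z_def sum_nonneg)
      have iD: "integrable M (indicator D :: 'a \<Rightarrow> real)" by (simp add: integrable_indicator_iff less_top[symmetric])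
      have Z_int: "integrable M Z"
        unfolding Z_def by (intro integrable_divide_zero Bochner_Integration.integrable_sum integrable_funpow iD)
      have "(\<integral>x. Z x \<partial>M) = (\<Sum>k<N. \<integral>x. indicator D ((T ^^ k) x) \<partial>M) / real N"
        unfolding Z_def integral_divide_zero
        by (subst Bochner_Integration.integral_sum) (auto intro!: integrable_funpow iD)
      also have "\<dots> = prob D"
        using N(1) by (simp add: integral_funpow)
      finally have Z_mean: "(\<integral>x. Z x \<partial>M) = prob D" .
      define bad where "bad = {x \<in> space M. Z x \<ge> e / 2}"
      have bad [measurable]: "bad \<in> sets M" unfolding bad_def by measurable
      have "prob bad \<le> (\<integral>x. Z x \<partial>M) / (e / 2)"
        unfolding bad_def using e Z_int Z_nonneg by (intro integral_Markov_inequality_measure[where A = "{}"]) auto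
      also have "\<dots> < (e\<^sup>2 / 8) / (e / 2)"
        unfolding Z_mean D_def using Q e by (intro divide_strict_right_mono) auto
      also have "\<dots> = e / 4" using e by (simp add: power2_eq_square field_simps)
      finally have bad_less: "prob bad < e / 4" .
      define late where "late = {x \<in> G. per n - N \<le> s (Suc n) x mod per n}"
      have late [measurable]: "late \<in> sets M" unfolding late_def by (intro sets_G_Collect) measurable
      have late_le: "prob late \<le> e / 2"
      proof (cases "N \<le> per n")
        case True
        then show ?thesis
          using N per_pos[of n] unfolding late_def by (subst prob_late_in_block) (auto simp: field_simps)
      next
        \<comment> \<open>This case requires \<open>e\<close> to be at least 2, and the bound is
          then trivial.\<close>
        case False
        then have "1 * real (per n) \<le> e / 2 * real (per n)" using N(2) by linarith
        then have "1 \<le> e / 2" using per_pos[of n] by (simp only: mult_le_cancel_right)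
        then show ?thesis using prob_le_1[of late] by linarith
      qed
      define W where "W = G - (bad \<union> late)"
      have W [measurable]: "W \<in> sets M" unfolding W_def by measurable
      have "1 - prob W = prob (space M - W)" by (simp add: prob_compl)
      also have "\<dots> \<le> prob ((space M - G) \<union> (bad \<union> late))"
        by (intro finite_measure_mono) (auto simp: W_def)
      also have "\<dots> \<le> prob (space M - G) + (prob bad + prob late)"
        by (intro order_trans[OF measure_Un_le] add_mono order_refl) auto
      also have "prob (space M - G) = 0" using prob_compl[OF G_sets] G_full by simp
      finally have W_big: "prob W > 1 - e" using bad_less late_le e by linarith
      have close: "y \<in> hamming_ball M P T N e x"
        if x: "x \<in> W" and y: "y \<in> W" and eq: "I n x = I n y" "s n x = s n y" for x y
      proof -
        have xG: "x \<in> G" and yG: "y \<in> G" using x y by (auto simp: W_def)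
        have lab: "I n ((T ^^ k) x) = I n ((T ^^ k) y)" "s n ((T ^^ k) x) = s n ((T ^^ k) y)"
          if "k < N" for k
        proof -
          have "s (Suc n) x mod per n + k < per n" "s (Suc n) y mod per n + k < per n"
            using x y xG yG that by (auto simp: W_def late_def)
          then show "I n ((T ^^ k) x) = I n ((T ^^ k) y)" "s n ((T ^^ k) x) = s n ((T ^^ k) y)"
            using funpow_label_in_block[OF xG, of n k] funpow_label_in_block[OF yG, of n k] eq by auto
        qed
        have "(\<Sum>k<N. of_bool (cell P ((T ^^ k) x) \<noteq> cell P ((T ^^ k) y))) \<le>
            (\<Sum>k<N. indicator D ((T ^^ k) x) + indicator D ((T ^^ k) y) :: real)"
        proof (intro sum_mono)
          fix k assume "k \<in> {..<N}"
          then have k: "k < N" by simp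
          show "of_bool (cell P ((T ^^ k) x) \<noteq> cell P ((T ^^ k) y)) \<le>
              (indicator D ((T ^^ k) x) + indicator D ((T ^^ k) y) :: real)"
            using lab[OF k] funpow_G[OF xG, of k] funpow_G[OF yG, of k]
            by (auto simp: D_def indicator_def)
        qed
        then have "(\<Sum>k<N. of_bool (cell P ((T ^^ k) x) \<noteq> cell P ((T ^^ k) y))) / real N \<le> Z x + Z y"
          unfolding Z_def add_divide_distrib[symmetric] sum.distrib[symmetric]
          by (intro divide_right_mono) auto
        also have "\<dots> < e / 2 + e / 2"
          using x y G_space[OF xG] G_space[OF yG] by (intro add_strict_mono) (auto simp: W_def bad_def)
        finally show ?thesis using G_space[OF yG] by (simp add: hamming_ball_eq)
      qed
      define rep where "rep l = (SOME x. x \<in> W \<and> (I n x, s n x) = l)" for l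
      have rep: "rep (I n x, s n x) \<in> W" "I n (rep (I n x, s n x)) = I n x" "s n (rep (I n x, s n x)) = s n x"
        if "x \<in> W" for x
        using someI[of "\<lambda>z. z \<in> W \<and> (I n z, s n z) = (I n x, s n x)" x] that
        unfolding rep_def by auto
      let ?A = "(\<lambda>x. (I n x, s n x)) ` W"
      have A_sub: "?A \<subseteq> {..<tow n} \<times> {..<h n}"
        using I_less s_less by (auto simp: W_def)
      then have A_fin: "finite ?A" by (rule finite_subset) simp
      let ?F = "(\<lambda>l. hamming_ball M P T N e (rep l)) ` ?A"
      have F_sub: "?F \<subseteq> hamming_ball M P T N e ` space M"
        using rep(1) G_space by (auto simp: W_def)
      have "W \<subseteq> \<Union>?F"
        using close rep by auto
      then have "prob W \<le> prob (\<Union>?F)"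
        using A_fin by (intro finite_measure_mono sets.finite_Union) auto
      then have "covering_number M P T N e \<le> card ?F"
        using A_fin F_sub W_big by (intro covering_number_le) auto
      also have "\<dots> \<le> card ?A" by (rule card_image_le[OF A_fin])
      also have "\<dots> \<le> card ({..<tow n} \<times> {..<h n})" by (rule card_mono[OF _ A_sub]) simp
      finally show "covering_number M P T N e \<le> tow n * h n" by simp
    qed
  qed
qed

end

section \<open>From growth rates to slow entropy\<close>

context tower_system
begin

text \<open>Every large \<open>N\<close> lies between \<open>16 * per n\<close> and
  \<open>16 * per (n + 1)\<close> for some \<open>n\<close>, where \<open>tow (n + 1) / 2\<close>
  balls are needed; the worst case for \<open>N powr t\<close> is the right end, which is what the
  hypothesis controls. A single radius is enough, because the exponent only increases as the radius
  shrinks.\<close>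

lemma lower_slow_entropy_ge_of_growth:
  assumes grow: "\<And>t. 0 < t \<Longrightarrow> ennreal t < u \<Longrightarrow>
      \<forall>\<^sub>F n in sequentially. (16 * real (per n)) powr t \<le> real (tow n)"
  shows "u \<le> lower_slow_entropy (\<lambda>n t. real n powr t) M T"
proof -
  let ?a = "\<lambda>n t. real n powr t"
  define e :: real where "e = 1/256"
  have "u \<le> slow_growth_exponent ?a M T e base"
  proof (rule dense_le)
    fix x assume x: "x < u"
    then obtain t where t: "x = ennreal t" "t \<ge> 0" by (cases x) auto
    show "x \<le> slow_growth_exponent ?a M T e base"
    proof (cases "t = 0")
      case False
      with t have t0: "t > 0" by simp
      obtain n0 where n0: "\<And>n. n \<ge> n0 \<Longrightarrow> (16 * real (per n)) powr t \<le> real (tow n)"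
        using grow[OF t0] x t unfolding eventually_sequentially by blast
      have ge: "1/2 \<le> real (covering_number M base T N e) / real N powr t" if N: "N \<ge> 16 * per n0" for N
      proof -
        have per_mono: "per n \<le> per n'" if "n \<le> n'" for n n'
          using that
        proof (induction n' rule: dec_induct)
          case (step k)
          have "1 * (1 * per k) \<le> L (Suc k) * (blk k * per k)"
            by (intro mult_le_mono) (auto simp: Suc_le_eq)
          then have "per k \<le> per (Suc k)" by (simp only: h_Suc mult_1)
          then show ?case using step(3) by linarith
        qed simp
        have per_ge: "n < per n" for n
        proof -
          have "1 * h n \<le> L n * h n" by (intro mult_le_mono1) (simp add: Suc_le_eq)
          then show ?thesis using h_ge[of n] by linarith
        qed
        define m where "m = (LEAST m. N < 16 * per m)"
        have "N < 16 * per N" using per_ge[of N] by linarith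
        then have m: "N < 16 * per m" unfolding m_def by (rule LeastI)
        have "\<not> m \<le> n0" using m N per_mono[of m n0] by linarith
        then obtain n where n: "m = Suc n" "n \<ge> n0" by (cases m) auto
        have "16 * per n \<le> N"
          using not_less_Least[of n "\<lambda>m. N < 16 * per m"] n(1) unfolding m_def[symmetric] by simp
        then have "real (tow (Suc n)) / 2 \<le> real (covering_number M base T N e)"
          using m unfolding n(1) by (intro covering_number_ge) (auto simp: e_def)
        moreover have "real N powr t \<le> (16 * real (per (Suc n))) powr t"
        proof (intro powr_mono2)
          have "real N \<le> real (16 * per (Suc n))"
            using m unfolding n(1) by (intro of_nat_mono) simp
          then show "real N \<le> 16 * real (per (Suc n))" by simp
        qed (use t0 in auto)
        moreover have "(16 * real (per (Suc n))) powr t \<le> real (tow (Suc n))"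
          using n(2) by (intro n0) simp
        moreover have "N > 0" using N per_pos[of n0] by linarith
        ultimately show ?thesis by (simp add: pos_le_divide_eq)
      qed
      have "ereal (1/2) \<le> liminf (\<lambda>N. ereal (real (covering_number M base T N e) / real N powr t))"
        using ge by (intro Liminf_bounded) (auto simp: eventually_sequentially)
      then have "liminf (\<lambda>N. ereal (real (covering_number M base T N e) / real N powr t)) > 0"
        by (rule less_le_trans[rotated]) simp
      then have "t \<in> slow_growth_set ?a M T e base"
        using t0 by (simp add: slow_growth_set_def)
      then show ?thesis unfolding slow_growth_exponent_def t(1) by (rule SUP_upper)
    qed (use t in simp)
  qed
  also have "\<dots> \<le> lower_slow_entropy ?a M T"
    by (intro lower_slow_entropy_ge base_partition T_measurable prob_space_axioms) (simp add: e_def)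
  finally show ?thesis .
qed

text \<open>A positive liminf is refuted along a single sequence of lengths, here the integer parts
  of \<open>e / 2 * per n\<close> for the stages \<open>n\<close> supplied by the hypothesis. Hence
  frequent validity is all that is asked.\<close>

lemma lower_slow_entropy_le_of_growth:
  assumes grow: "\<And>t \<delta>. 0 < t \<Longrightarrow> u < ennreal t \<Longrightarrow> 0 < \<delta> \<Longrightarrow>
      \<exists>\<^sub>F n in sequentially. real (tow n) * real (h n) \<le> \<delta> * real (per n) powr t"
  shows "lower_slow_entropy (\<lambda>n t. real n powr t) M T \<le> u"
proof (rule lower_slow_entropy_le)
  fix P :: "'a set set" and e :: real
  assume P: "finite_measurable_partition M P" and e: "0 < e"
  show "slow_growth_exponent (\<lambda>n t. real n powr t) M T e P \<le> u"
    unfolding slow_growth_exponent_def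
  proof (rule SUP_least, rule ccontr)
    fix t assume t: "t \<in> slow_growth_set (\<lambda>n t. real n powr t) M T e P" and "\<not> ennreal t \<le> u"
    then have ut: "u < ennreal t" and t0: "t > 0" by (auto simp: slow_growth_set_def)
    have "0 < liminf (\<lambda>N. ereal (real (covering_number M P T N e) / real N powr t))"
      using t by (simp add: slow_growth_set_def)
    then obtain y where y: "0 < y" "ereal y < liminf (\<lambda>N. ereal (real (covering_number M P T N e) / real N powr t))"
      using ereal_dense2[of 0] by (auto simp flip: zero_ereal_def)
    from less_LiminfD[OF y(2)] obtain N0 where
      N0: "\<And>N. N \<ge> N0 \<Longrightarrow> y < real (covering_number M P T N e) / real N powr t"
      by (auto simp: eventually_sequentially)
    \<comment> \<open>The length \<open>N\<close> chosen below is at least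
      \<open>e / 4 * per n\<close>, so \<open>\<delta> * per n powr t\<close> is at most
      \<open>y * N powr t\<close>.\<close>
    define \<delta> where "\<delta> = y * (e / 4) powr t"
    have \<delta>: "\<delta> > 0" using y e by (simp add: \<delta>_def)
    have "\<forall>\<^sub>F n in sequentially. real n > 2 / e * (real N0 + 2)"
      using filterlim_real_sequentially by (simp add: filterlim_at_top_dense)
    with covering_number_le_labels[OF P e]
    have "\<forall>\<^sub>F n in sequentially. \<not> real (tow n) * real (h n) \<le> \<delta> * real (per n) powr t"
    proof eventually_elim
      case (elim n)
      define x where "x = e / 2 * real (per n)"
      define N where "N = nat \<lfloor>x\<rfloor>"
      have "1 * h n \<le> L n * h n" by (intro mult_le_mono1) (simp add: Suc_le_eq)
      then have "n \<le> per n" using h_ge[of n] by linarith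
      then have "2 / e * (real N0 + 2) < real (per n)" using elim(2) by linarith
      then have x: "x > real N0 + 2" using e by (simp add: x_def field_simps)
      have N: "real N \<le> x" "x / 2 \<le> real N" "N \<ge> N0" "N > 0"
      proof -
        have "real N = real_of_int \<lfloor>x\<rfloor>" using x by (simp add: N_def)
        then show "real N \<le> x" "x / 2 \<le> real N" "N \<ge> N0" "N > 0" using x by linarith+
      qed
      have "covering_number M P T N e \<le> tow n * h n"
        using elim(1) N(1,4) unfolding x_def by blast
      then have cov: "real (covering_number M P T N e) \<le> real (tow n) * real (h n)"
        by (metis of_nat_le_iff of_nat_mult)
      have "\<delta> * real (per n) powr t = y * (x / 2) powr t"
        using e by (simp add: \<delta>_def x_def powr_mult powr_divide)
      also have "\<dots> \<le> y * real N powr t"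
        using y N x t0 by (intro mult_left_mono powr_mono2) auto
      also have "\<dots> < real (covering_number M P T N e)"
        using N0[OF N(3)] N(4) by (simp add: pos_less_divide_eq)
      finally show ?case using cov by linarith
    qed
    then show False using grow[OF t0 ut \<delta>] by (simp add: frequently_def)
  qed
qed (auto intro: prob_space_axioms)

end

section \<open>Choice of the repetition numbers\<close>

text \<open>
  For \<open>u \<in> (0, \<infinity>)\<close> the sequence \<open>v\<close> will be constantly \<open>1 / u\<close>. The extra factor \<open>2 ^ boost v n\<close> occurs only
  at powers of two, so that at such \<open>n\<close> all earlier ones contribute \<open>2 ^ o(2 ^ n)\<close> to the height.
\<close>

definition boost :: "(nat \<Rightarrow> real) \<Rightarrow> nat \<Rightarrow> nat" where
  "boost v n = (if \<exists>l. n = 2 ^ l then nat \<lfloor>v n * 2 ^ n\<rfloor> else 0)"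

text \<open>As \<open>2 ^ n\<close> is the leading term of the binary logarithm of
  \<open>tow n\<close>, a boosted factor is about \<open>tow n\<close> to the power
  \<open>v n\<close>. The summand \<open>n + 1\<close> alone already makes the numbers at least 2
  and unbounded, as rigidity requires, without affecting the leading order.\<close>

definition reps :: "(nat \<Rightarrow> real) \<Rightarrow> nat \<Rightarrow> nat" where
  "reps v n = 2 ^ (n + 1 + boost v n)"

lemma hgt_reps: "hgt (reps v) n = 2 ^ (\<Sum>k<n. 2 * k + 4 + boost v k)"
  by (induction n) (simp_all add: reps_def blk_def power_add power_mult flip: power_mult_distrib)

lemma repetitions_reps: "repetitions (reps v)"
proof
  show "2 \<le> reps v n" for n
    unfolding reps_def using power_increasing[of 1 "n + 1 + boost v n" "2 :: nat"] by simp
qed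

lemma filterlim_reps: "filterlim (reps v) at_top sequentially"
proof (rule filterlim_at_top_mono[OF filterlim_ident])
  have "n < 2 ^ (n + 1 + boost v n)" for n
    using less_exp[of "n + 1 + boost v n"] by linarith
  then show "\<forall>\<^sub>F n in sequentially. n \<le> reps v n"
    by (auto simp: reps_def intro!: always_eventually less_imp_le)
qed

lemma boost_le: "0 \<le> v n \<Longrightarrow> real (boost v n) \<le> v n * 2 ^ n"
  by (simp add: boost_def)

text \<open>The powers of two below \<open>n = 2 ^ l\<close> are at most \<open>n / 2\<close>, so
  the earlier boosts add up to the order of \<open>2 ^ (n / 2)\<close> instead of
  \<open>2 ^ n\<close>. The bound \<open>w + k\<close> on \<open>v\<close> covers both constant
  sequences and \<open>v k = k\<close>.\<close>

lemma sum_boost_pow2: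
  assumes v: "\<And>k. 0 \<le> v k" "\<And>k. v k \<le> w + real k" and n: "n = 2 ^ l" and w: "w \<ge> 0"
  shows "real (\<Sum>k<n. boost v k) \<le> (w + real n) * (2 * 2 powr (real n / 2))"
proof -
  have "(\<Sum>k<n. boost v k) = (\<Sum>k\<in>{..n div 2} \<inter> {..<n}. boost v k)"
  proof (intro sum.mono_neutral_right ballI)
    fix k assume k: "k \<in> {..<n} - {..n div 2} \<inter> {..<n}"
    have "\<not> (\<exists>j. k = 2 ^ j)"
    proof
      assume "\<exists>j. k = 2 ^ j"
      then obtain j where j: "k = 2 ^ j" ..
      then have "j < l" using k n by simp
      then have "2 ^ Suc j \<le> (2 :: nat) ^ l" by (intro power_increasing) auto
      then show False using k n j by auto
    qed
    then show "boost v k = 0" by (simp add: boost_def)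
  qed auto
  also have "real \<dots> \<le> (\<Sum>k\<in>{..n div 2} \<inter> {..<n}. (w + real n) * 2 ^ k)"
    unfolding of_nat_sum
  proof (intro sum_mono)
    fix k assume "k \<in> {..n div 2} \<inter> {..<n}"
    then have "v k \<le> w + real n" using v(2)[of k] by simp
    then show "real (boost v k) \<le> (w + real n) * 2 ^ k"
      using boost_le[of v k] v(1)[of k] by (meson mult_right_mono order_trans zero_le_numeral zero_le_power)
  qed
  also have "\<dots> \<le> (\<Sum>k\<le>n div 2. (w + real n) * 2 ^ k)"
    using w by (intro sum_mono2) auto
  also have "\<dots> = (w + real n) * (2 * 2 ^ (n div 2) - 1)"
    unfolding sum_distrib_left[symmetric] lessThan_Suc_atMost[symmetric]
    by (subst geometric_sum) auto
  also have "\<dots> \<le> (w + real n) * (2 * 2 powr (real n / 2))"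
  proof (intro mult_left_mono)
    have "(2 :: real) ^ (n div 2) = 2 powr real (n div 2)" by (simp add: powr_realpow)
    also have "\<dots> \<le> 2 powr (real n / 2)" by (intro powr_mono) auto
    finally show "2 * 2 ^ (n div 2) - 1 \<le> 2 * 2 powr (real n / 2)" by simp
  qed (use w in simp)
  finally show ?thesis .
qed

text \<open>The lower bound needs an estimate at all stages. Either \<open>n\<close> is a power of
  two and the earlier boosts are negligible, or \<open>boost\<close> vanishes at \<open>n\<close>
  and the geometric sum of the earlier ones stays below \<open>w * 2 ^ n\<close>.\<close>

lemma sum_boost_const:
  assumes w: "w \<ge> 0"
  shows "real (boost (\<lambda>_. w) n) + real (\<Sum>k<n. boost (\<lambda>_. w) k)
    \<le> w * 2 ^ n + (w + real n) * (2 * 2 powr (real n / 2))"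
proof (cases "\<exists>l. n = 2 ^ l")
  case True
  then show ?thesis
    using sum_boost_pow2[of "\<lambda>_. w" w n] boost_le[of "\<lambda>_. w" n] w by (auto intro!: add_mono)
next
  case False
  have "real (\<Sum>k<n. boost (\<lambda>_. w) k) \<le> (\<Sum>k<n. w * 2 ^ k)"
    unfolding of_nat_sum using w by (intro sum_mono boost_le)
  also have "\<dots> = w * (2 ^ n - 1)"
    unfolding sum_distrib_left[symmetric] by (subst geometric_sum) auto
  also have "\<dots> \<le> w * 2 ^ n" using w by (intro mult_left_mono) auto
  also have "\<dots> \<le> w * 2 ^ n + (w + real n) * (2 * 2 powr (real n / 2))" using w by simp
  finally show ?thesis using False by (simp add: boost_def)
qed

lemma sum_linear: "(\<Sum>k<n. 2 * k + 4 + b k) = n\<^sup>2 + 3 * n + (\<Sum>k<n. b k)" for n :: nat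
  by (induction n) (simp_all add: power2_eq_square)

text \<open>Collects the lower-order terms of the exponents in both growth lemmas; \<open>c\<close>
  is 5 in the first and \<open>4 + t\<close> in the second.\<close>

lemma remainder_small:
  fixes w \<kappa> :: real
  assumes "\<kappa> > 0"
  shows "\<forall>\<^sub>F n in sequentially. (real n)\<^sup>2 + 5 * real n + c + (w + real n) * (2 * 2 powr (real n / 2)) \<le> \<kappa> * 2 ^ n"
proof -
  have "(\<lambda>n. ((real n)\<^sup>2 + 5 * real n) / 2 ^ n) \<longlonglongrightarrow> 0" by real_asymp
  moreover have "(\<lambda>n. 1 / 2 ^ n :: real) \<longlonglongrightarrow> 0" by real_asymp
  moreover have "(\<lambda>n. 2 * 2 powr (real n / 2) / 2 ^ n) \<longlonglongrightarrow> 0" by real_asymp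
  moreover have "(\<lambda>n. real n * (2 * 2 powr (real n / 2)) / 2 ^ n) \<longlonglongrightarrow> 0" by real_asymp
  ultimately have "(\<lambda>n. ((real n)\<^sup>2 + 5 * real n) / 2 ^ n + c * (1 / 2 ^ n) +
      (w * (2 * 2 powr (real n / 2) / 2 ^ n) + real n * (2 * 2 powr (real n / 2)) / 2 ^ n)) \<longlonglongrightarrow> 0 + c * 0 + (w * 0 + 0)"
    by (intro tendsto_add tendsto_mult tendsto_const)
  then have "\<forall>\<^sub>F n in sequentially. ((real n)\<^sup>2 + 5 * real n) / 2 ^ n + c * (1 / 2 ^ n) +
      (w * (2 * 2 powr (real n / 2) / 2 ^ n) + real n * (2 * 2 powr (real n / 2)) / 2 ^ n) < \<kappa>"
    by (rule order_tendstoD) (use assms in simp)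
  then show ?thesis
  proof eventually_elim
    case (elim n)
    have "((real n)\<^sup>2 + 5 * real n) / 2 ^ n + c * (1 / 2 ^ n) +
        (w * (2 * 2 powr (real n / 2) / 2 ^ n) + real n * (2 * 2 powr (real n / 2)) / 2 ^ n) =
        ((real n)\<^sup>2 + 5 * real n + c + (w + real n) * (2 * 2 powr (real n / 2))) / 2 ^ n"
      by (simp add: add_divide_distrib distrib_right)
    with elim show ?case by (simp add: pos_divide_less_eq)
  qed
qed

lemma powr_two_power: "((2 :: real) ^ a) powr t = 2 powr (t * real a)"
  by (simp add: powr_powr mult.commute flip: powr_realpow)

lemma tow_powr: "real (tow n) = 2 powr (2 ^ n + real n + 4)"
proof -
  have "real (tow n) = 2 powr real (2 ^ n + n + 4)"
    unfolding tow_def by (subst powr_realpow) auto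
  then show ?thesis by simp
qed

lemma lower_growth:
  fixes w t :: real
  assumes w: "w \<ge> 0" and t: "t > 0" "t * w < 1"
  defines "L \<equiv> reps (\<lambda>_. w)"
  shows "\<forall>\<^sub>F n in sequentially. (16 * real (L n * hgt L n)) powr t \<le> real (tow n)"
proof -
  \<comment> \<open>Chosen such that \<open>t * (w + \<kappa>) = 1\<close>.\<close>
  define \<kappa> where "\<kappa> = (1 - t * w) / t"
  have \<kappa>: "\<kappa> > 0" using t by (simp add: \<kappa>_def)
  show ?thesis
    using remainder_small[OF \<kappa>, of 5 w]
  proof eventually_elim
    case (elim n)
    define b where "b k = boost (\<lambda>_. w) k" for k
    define e where "e = 4 + (n + 1 + b n + (n\<^sup>2 + 3 * n + (\<Sum>k<n. b k)))"
    have "16 * real (L n * hgt L n) = 2 ^ e"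
      unfolding L_def hgt_reps reps_def e_def b_def sum_linear by (simp add: power_add power_mult flip: power_mult_distrib)
    then have "(16 * real (L n * hgt L n)) powr t = 2 powr (t * real e)"
      by (simp only: powr_two_power)
    also have "\<dots> \<le> 2 powr (2 ^ n + real n + 4)"
    proof (rule powr_mono)
      have "real e = (real n)\<^sup>2 + 4 * real n + 5 + (real (b n) + real (\<Sum>k<n. b k))"
        by (simp add: e_def)
      also have "\<dots> \<le> (real n)\<^sup>2 + 4 * real n + 5 + (w * 2 ^ n + (w + real n) * (2 * 2 powr (real n / 2)))"
        unfolding b_def by (intro add_left_mono sum_boost_const w)
      also have "\<dots> \<le> w * 2 ^ n + \<kappa> * 2 ^ n" using elim by simp
      finally have "t * real e \<le> t * (w * 2 ^ n + \<kappa> * 2 ^ n)" using t by simp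
      also have "\<dots> = 2 ^ n" using t by (simp add: \<kappa>_def field_simps)
      finally show "t * real e \<le> 2 ^ n + real n + 4" by simp
    qed simp
    finally show ?case by (simp only: tow_powr)
  qed
qed

text \<open>At powers of two the boost at \<open>n\<close> dominates everything collected in
  \<open>h n\<close>. The surplus \<open>\<kappa> * 2 ^ n\<close> in the exponent absorbs
  \<open>h n\<close>, the lower-order part of \<open>tow n\<close> and a further
  \<open>n\<close>.\<close>

lemma upper_growth:
  fixes w t \<kappa> \<delta> :: real and v :: "nat \<Rightarrow> real"
  assumes v: "\<And>k. 0 \<le> v k" "\<And>k. v k \<le> w + real k" and w: "w \<ge> 0" and t: "t > 0" and \<kappa>: "\<kappa> > 0"
    and big: "\<forall>\<^sub>F n in sequentially. 1 + \<kappa> \<le> t * v n" and \<delta>: "\<delta> > 0"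
  defines "L \<equiv> reps v"
  shows "\<exists>\<^sub>F n in sequentially. real (tow n) * real (hgt L n) \<le> \<delta> * real (L n * hgt L n) powr t"
proof -
  have "\<forall>\<^sub>F n in sequentially. 2 powr (- real n) \<le> \<delta>"
  proof -
    have "(\<lambda>n. 2 powr (- real n)) \<longlonglongrightarrow> 0" by real_asymp
    from order_tendstoD(2)[OF this \<delta>] show ?thesis by eventually_elim simp
  qed
  with big remainder_small[OF \<kappa>, of "4 + t" w]
  have ev: "\<forall>\<^sub>F n in sequentially. (\<exists>l. n = 2 ^ l) \<longrightarrow>
      real (tow n) * real (hgt L n) \<le> \<delta> * real (L n * hgt L n) powr t"
  proof eventually_elim
    case (elim n)
    show ?case
    proof
      assume "\<exists>l. n = 2 ^ l"
      then obtain l where l: "n = 2 ^ l" ..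
      define S where "S = (\<Sum>k<n. boost v k)"
      define H where "H = n\<^sup>2 + 3 * n + S"
      have h: "hgt L n = 2 ^ H" unfolding L_def hgt_reps sum_linear H_def S_def ..
      have S: "real S \<le> (w + real n) * (2 * 2 powr (real n / 2))"
        unfolding S_def by (rule sum_boost_pow2[OF v l w])
      have "v n * 2 ^ n - 1 \<le> real (boost v n)"
        unfolding boost_def using l v(1)[of n] by auto
      then have "t * (v n * 2 ^ n - 1) \<le> t * real (boost v n)" using t by simp
      moreover have "(1 + \<kappa>) * 2 ^ n \<le> t * v n * 2 ^ n" using elim(1) by (intro mult_right_mono) auto
      ultimately have "(1 + \<kappa>) * 2 ^ n \<le> t * real (boost v n) + t" by (simp add: algebra_simps)
      then have key: "2 ^ n + real n + 4 + real H + real n \<le> t * real (boost v n)"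
        using elim(2) S by (simp add: H_def algebra_simps)
      have "real (tow n) * real (hgt L n) = 2 powr (2 ^ n + real n + 4 + real H)"
        unfolding tow_powr h by (simp add: powr_add powr_realpow)
      \<comment> \<open>The spare factor \<open>2 powr (- n)\<close> eventually falls below any
        given \<open>\<delta>\<close>.\<close>
      also have "\<dots> = 2 powr (- real n) * 2 powr (2 ^ n + real n + 4 + real H + real n)"
        by (simp add: ac_simps flip: powr_add)
      also have "\<dots> \<le> \<delta> * 2 powr (t * real (n + 1 + boost v n + H))"
      proof (intro mult_mono elim(3) powr_mono)
        have "t * real (boost v n) \<le> t * real (n + 1 + boost v n + H)"
          using t by (intro mult_left_mono) auto
        then show "2 ^ n + real n + 4 + real H + real n \<le> t * real (n + 1 + boost v n + H)"
          using key by linarith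
      qed (use \<delta> in auto)
      also have "2 powr (t * real (n + 1 + boost v n + H)) = real (L n * hgt L n) powr t"
        unfolding powr_two_power[symmetric] h by (simp add: L_def reps_def power_add ac_simps)
      finally show "real (tow n) * real (hgt L n) \<le> \<delta> * real (L n * hgt L n) powr t" .
    qed
  qed
  have "\<exists>\<^sub>F n in sequentially. \<exists>l. n = (2 :: nat) ^ l"
    unfolding frequently_sequentially using less_imp_le[OF less_exp] by blast
  from frequently_mp[OF ev this] show ?thesis .
qed

section \<open>A tower system on the unit square\<close>

text \<open>The intercept \<open>i - j * b\<close> modulo \<open>tow n\<close> of the line with
  slope \<open>b\<close> that takes the value \<open>i\<close> at \<open>j\<close>, written so that
  no truncated subtraction interferes.\<close>

definition unlab :: "nat \<Rightarrow> nat \<Rightarrow> nat \<Rightarrow> nat \<Rightarrow> nat" where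
  "unlab n i j b = (i + (tow n - (j * b) mod tow n)) mod tow n"

lemma unlab_less [simp]: "unlab n i j b < tow n"
  by (simp add: unlab_def)

lemma lab_unlab:
  assumes "i < tow n" "b < slp n"
  shows "lab n (unlab n i j b * slp n + b) j = i"
proof -
  have v: "(j * b) mod tow n < tow n" by simp
  have "lab n (unlab n i j b * slp n + b) j = (unlab n i j b + j * b) mod tow n"
    using assms(2) by (simp add: lab_def)
  also have "\<dots> = ((i + (tow n - (j * b) mod tow n)) + (j * b) mod tow n) mod tow n"
    unfolding unlab_def by (metis mod_add_left_eq mod_add_right_eq)
  also have "(i + (tow n - (j * b) mod tow n)) + (j * b) mod tow n = i + tow n"
    by (simp only: add.assoc le_add_diff_inverse2[OF less_imp_le[OF v]])
  finally show ?thesis using assms(1) by simp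
qed

text \<open>
  Horizontal strips encode the tower, vertical ones the level. \<open>slab n e\<close> reads the mixed radix digits of the column
  \<open>e\<close> in reverse order, as in an odometer; \<open>ilab n e f\<close> recovers the line from one of its values
  and its slope, the last digit of the row \<open>f\<close>.
\<close>

context repetitions
begin

abbreviation deg :: "nat \<Rightarrow> nat" where "deg n \<equiv> blk n * L n"

lemma h_Suc': "h (Suc n) = deg n * h n"
  by simp

primrec slab :: "nat \<Rightarrow> nat \<Rightarrow> nat" where
  "slab 0 e = 0"
| "slab (Suc n) e = (e mod deg n) * h n + slab n (e div deg n)"

primrec ilab :: "nat \<Rightarrow> nat \<Rightarrow> nat \<Rightarrow> nat" where
  "ilab 0 e f = f"
| "ilab (Suc n) e f =
     unlab n (ilab n (e div deg n) (f div slp n)) ((e mod deg n) div L n) (f mod slp n) * slp n + f mod slp n"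

lemma slab_less: "e < h n \<Longrightarrow> slab n e < h n"
proof (induction n arbitrary: e)
  case (Suc n)
  have "e div deg n < h n" using Suc.prems unfolding h_Suc' by (simp add: less_mult_imp_div_less mult.commute)
  then have "slab n (e div deg n) < h n" by (rule Suc.IH)
  moreover have "Suc (e mod deg n) * h n \<le> deg n * h n"
    by (intro mult_le_mono1) (simp add: Suc_le_eq)
  ultimately show ?case unfolding h_Suc' by simp
qed simp

lemma ilab_less: "f < tow n \<Longrightarrow> ilab n e f < tow n"
proof (cases n)
  case (Suc m)
  have "Suc (unlab m (ilab m (e div deg m) (f div slp m)) ((e mod deg m) div L m) (f mod slp m)) * slp m
      \<le> tow m * slp m"
    by (intro mult_le_mono1) (simp add: Suc_le_eq)
  moreover have "f mod slp m < slp m" by simp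
  ultimately show ?thesis unfolding Suc tow_Suc ilab.simps mult_Suc by linarith
qed simp

lemma slab_proj:
  assumes "e < h (Suc n)"
  shows "slab (Suc n) e mod h n = slab n (e div deg n)"
    and "slab (Suc n) e div per n = (e mod deg n) div L n"
proof -
  have "e div deg n < h n" using assms unfolding h_Suc' by (simp add: less_mult_imp_div_less mult.commute)
  then have lt: "slab n (e div deg n) < h n" by (rule slab_less)
  then show "slab (Suc n) e mod h n = slab n (e div deg n)" by simp
  have "slab (Suc n) e div h n = e mod deg n" using lt by simp
  then show "slab (Suc n) e div per n = (e mod deg n) div L n"
    by (metis div_mult2_eq mult.commute)
qed

lemma ilab_proj:
  assumes "e < h (Suc n)" "f < tow (Suc n)"
  shows "lab n (ilab (Suc n) e f) (slab (Suc n) e div per n) = ilab n (e div deg n) (f div slp n)"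
proof -
  have "f div slp n < tow n" using assms(2) by (rule tow_index_div)
  then show ?thesis
    unfolding slab_proj(2)[OF assms(1)] ilab.simps(2) by (intro lab_unlab ilab_less) auto
qed

text \<open>The projections turn equal labels of stage \<open>n + 1\<close> into equal labels of
  stage \<open>n\<close>, which settles the leading digits by induction. The last column digit can
  then be read off from \<open>slab\<close>, and the last row digit is the slope, the remainder of
  \<open>ilab\<close> by \<open>slp n\<close>.\<close>

lemma label_inj:
  assumes "e < h n" "e' < h n" "f < tow n" "f' < tow n"
    and "slab n e = slab n e'" "ilab n e f = ilab n e' f'"
  shows "e = e' \<and> f = f'"
  using assms
proof (induction n arbitrary: e e' f f')
  case (Suc n)
  have "e div deg n < h n" "e' div deg n < h n"
    using Suc.prems unfolding h_Suc' by (simp_all add: less_mult_imp_div_less mult.commute)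
  moreover have "f div slp n < tow n" "f' div slp n < tow n"
    using Suc.prems by (auto intro: tow_index_div)
  moreover have s: "slab n (e div deg n) = slab n (e' div deg n)"
    using slab_proj(1)[OF Suc.prems(1)] slab_proj(1)[OF Suc.prems(2)] Suc.prems(5) by metis
  moreover have "ilab n (e div deg n) (f div slp n) = ilab n (e' div deg n) (f' div slp n)"
    using ilab_proj[OF Suc.prems(1,3)] ilab_proj[OF Suc.prems(2,4)] Suc.prems(5,6) by metis
  ultimately have eq: "e div deg n = e' div deg n \<and> f div slp n = f' div slp n"
    by (intro Suc.IH)
  have "e mod deg n = e' mod deg n"
    using Suc.prems(5) s by simp
  moreover have "f mod slp n = f' mod slp n"
  proof -
    have "ilab (Suc n) e f mod slp n = f mod slp n" "ilab (Suc n) e' f' mod slp n = f' mod slp n" by simp_all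
    then show ?thesis using Suc.prems(6) by metis
  qed
  ultimately show ?case using eq by (metis div_mult_mod_eq)
qed auto

lemma label_surj:
  assumes "i < tow n" "s < h n"
  shows "\<exists>e f. e < h n \<and> f < tow n \<and> ilab n e f = i \<and> slab n e = s"
proof -
  let ?A = "{..<h n} \<times> {..<tow n}"
  let ?l = "\<lambda>(e, f). (slab n e, ilab n e f)"
  have "inj_on ?l ?A"
    by (rule inj_onI) (use label_inj in \<open>auto split: prod.splits\<close>)
  moreover have "?l ` ?A \<subseteq> ?A" using slab_less ilab_less by auto
  ultimately have "?l ` ?A = ?A" by (intro endo_inj_surj) auto
  moreover have "(s, i) \<in> ?A" using assms by simp
  ultimately have "(s, i) \<in> ?l ` ?A" by blast
  then show ?thesis by auto
qed

text \<open>The column and row of the cell with a given label, unique by \<open>label_inj\<close>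
  when the label is in range.\<close>

definition cellof :: "nat \<Rightarrow> nat \<Rightarrow> nat \<Rightarrow> nat \<times> nat" where
  "cellof n i s = (SOME p. fst p < h n \<and> snd p < tow n \<and> ilab n (fst p) (snd p) = i \<and> slab n (fst p) = s)"

lemma cellof:
  assumes "i < tow n" "s < h n"
  shows "fst (cellof n i s) < h n" "snd (cellof n i s) < tow n"
    "ilab n (fst (cellof n i s)) (snd (cellof n i s)) = i" "slab n (fst (cellof n i s)) = s"
proof -
  have "\<exists>p. fst p < h n \<and> snd p < tow n \<and> ilab n (fst p) (snd p) = i \<and> slab n (fst p) = s"
    using label_surj[OF assms] by auto
  from someI_ex[OF this] show "fst (cellof n i s) < h n" "snd (cellof n i s) < tow n"
    "ilab n (fst (cellof n i s)) (snd (cellof n i s)) = i" "slab n (fst (cellof n i s)) = s"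
    unfolding cellof_def by auto
qed

text \<open>Reversing mixed radix digits fixes the string of zeros and, in \<open>slab_top\<close>,
  the string of maximal digits. Being at the bottom or at the top of the towers of all stages would
  therefore push the first coordinate to 0 or 1, which \<open>good\<close> excludes.\<close>

lemma slab_0_iff: "e < h n \<Longrightarrow> slab n e = 0 \<Longrightarrow> e = 0"
proof (induction n arbitrary: e)
  case (Suc n)
  have "e div deg n < h n" using Suc.prems unfolding h_Suc' by (simp add: less_mult_imp_div_less mult.commute)
  then have "e div deg n = 0" using Suc by simp
  moreover have "e mod deg n = 0" using Suc.prems by simp
  ultimately show ?case by (metis div_mult_mod_eq mult_0 add_0)
qed auto

lemma slab_top: "e < h n \<Longrightarrow> Suc (slab n e) = h n \<Longrightarrow> Suc e = h n"
proof (induction n arbitrary: e)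
  case (Suc n)
  let ?q = "e div deg n" and ?r = "e mod deg n"
  have q: "?q < h n" using Suc.prems unfolding h_Suc' by (simp add: less_mult_imp_div_less mult.commute)
  have eq: "?r * h n + Suc (slab n ?q) = deg n * h n" using Suc.prems(2) unfolding h_Suc' by simp
  have le: "Suc (slab n ?q) \<le> h n" using slab_less[OF q] by simp
  have r: "?r < deg n" by simp
  have "deg n * h n \<le> Suc ?r * h n" using eq le by simp
  then have "deg n \<le> Suc ?r" using h_pos[of n] by (metis mult_le_cancel2)
  then have "Suc ?r = deg n" using r by linarith
  then have "Suc (slab n ?q) = h n"
    using eq by (metis add_left_cancel mult_Suc add.commute)
  then have "Suc ?q = h n" using Suc.IH[OF q] by simp
  then have "Suc e = Suc ?q * deg n"
    using \<open>Suc ?r = deg n\<close> div_mult_mod_eq[of e "deg n"] unfolding mult_Suc by linarith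
  then show ?case unfolding h_Suc' using \<open>Suc ?q = h n\<close> by (simp only: mult.commute)
qed auto

subsection \<open>Labels of points\<close>

text \<open>Discarding rational coordinates keeps clear of the boundaries of all cells, and the moves below
  are translations by rational vectors.\<close>

definition irr :: "real set" where "irr = {0<..<1} - \<rat>"

definition good :: "(real \<times> real) set" where "good = irr \<times> irr"

definition col :: "nat \<Rightarrow> real \<times> real \<Rightarrow> nat" where "col n p = nat \<lfloor>real (h n) * fst p\<rfloor>"
definition row :: "nat \<Rightarrow> real \<times> real \<Rightarrow> nat" where "row n p = nat \<lfloor>real (tow n) * snd p\<rfloor>"

definition pos :: "nat \<Rightarrow> real \<times> real \<Rightarrow> nat" where "pos n p = slab n (col n p)"
definition ind :: "nat \<Rightarrow> real \<times> real \<Rightarrow> nat" where "ind n p = ilab n (col n p) (row n p)"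

lemma nat_floor_div: "c > 0 \<Longrightarrow> 0 \<le> x \<Longrightarrow> nat \<lfloor>real (c * a) * x\<rfloor> div c = nat \<lfloor>real a * x\<rfloor>"
proof -
  assume c: "c > 0" and x: "0 \<le> x"
  have "\<lfloor>real a * x\<rfloor> = \<lfloor>(real (c * a) * x) / real_of_int (int c)\<rfloor>" using c by simp
  also have "\<dots> = \<lfloor>real (c * a) * x\<rfloor> div int c" by (rule floor_divide_real_eq_div) simp
  finally show ?thesis using x by (simp add: nat_div_distrib)
qed

lemma nat_floor_less: "0 \<le> x \<Longrightarrow> x < 1 \<Longrightarrow> a > 0 \<Longrightarrow> nat \<lfloor>real a * x\<rfloor> < a"
proof -
  assume "0 \<le> x" "x < 1" "a > 0"
  then have "real a * x < real a * 1" by (intro mult_strict_left_mono) auto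
  then have "\<lfloor>real a * x\<rfloor> < int a" by (simp add: floor_less_iff)
  then show ?thesis using \<open>0 \<le> x\<close> by (simp add: nat_less_iff)
qed

lemma good_bounds: "p \<in> good \<Longrightarrow> 0 < fst p \<and> fst p < 1 \<and> 0 < snd p \<and> snd p < 1"
  by (auto simp: good_def irr_def)

lemma col_less: "p \<in> good \<Longrightarrow> col n p < h n"
  using good_bounds[of p] by (auto simp: col_def intro!: nat_floor_less)

lemma row_less: "p \<in> good \<Longrightarrow> row n p < tow n"
  using good_bounds[of p] by (auto simp: row_def intro!: nat_floor_less)

lemma col_div: "p \<in> good \<Longrightarrow> col (Suc n) p div deg n = col n p"
  using good_bounds[of p] unfolding col_def h_Suc' by (intro nat_floor_div) auto

lemma row_div: "p \<in> good \<Longrightarrow> row (Suc n) p div slp n = row n p"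
  using good_bounds[of p] nat_floor_div[of "slp n" "snd p" "tow n"]
  by (simp add: row_def tow_Suc mult.commute)

lemma pos_less: "p \<in> good \<Longrightarrow> pos n p < h n"
  unfolding pos_def by (intro slab_less col_less)

lemma ind_less: "p \<in> good \<Longrightarrow> ind n p < tow n"
  unfolding ind_def by (intro ilab_less row_less)

lemma pos_proj: "p \<in> good \<Longrightarrow> pos n p = pos (Suc n) p mod h n"
  unfolding pos_def using slab_proj(1)[OF col_less[of p "Suc n"]] col_div[of p n] by simp

lemma ind_proj: "p \<in> good \<Longrightarrow> ind n p = lab n (ind (Suc n) p) (pos (Suc n) p div per n)"
  unfolding ind_def pos_def using ilab_proj[OF col_less[of p "Suc n"] row_less[of p "Suc n"]] col_div[of p n] row_div[of p n] by simp

lemma label_eq_imp_cell_eq: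
  assumes "p \<in> good" "q \<in> good" "pos n p = pos n q" "ind n p = ind n q"
  shows "col n p = col n q" "row n p = row n q"
  using label_inj[OF col_less col_less row_less row_less, OF assms(1,2) assms(1,2)] assms(3,4)
  unfolding pos_def ind_def by auto

lemma n_less_tow: "n < tow n"
  unfolding tow_def using less_exp[of "2 ^ n + n + 4"] by linarith

lemma nat_floor_eq_imp_close:
  assumes "nat \<lfloor>real a * x\<rfloor> = nat \<lfloor>real a * y\<rfloor>" "0 \<le> x" "0 \<le> y" "a > 0"
  shows "\<bar>x - y\<bar> \<le> 1 / real a"
proof -
  have "\<lfloor>real a * x\<rfloor> = \<lfloor>real a * y\<rfloor>" using assms by (simp add: eq_nat_nat_iff)
  then have "\<bar>real a * x - real a * y\<bar> \<le> 1" by linarith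
  then have "real a * \<bar>x - y\<bar> \<le> 1" by (simp add: abs_mult flip: right_diff_distrib)
  then show ?thesis using assms(4) by (simp add: field_simps)
qed

text \<open>The cells shrink to points. Agreement from some stage on is all that is available when
  \<open>up\<close> and \<open>down\<close> are shown to be mutually inverse, since the earlier
  stages may see the point leave a tower.\<close>

lemma label_separates:
  assumes p: "p \<in> good" "q \<in> good" and eq: "\<And>N. N \<ge> n \<Longrightarrow> pos N p = pos N q \<and> ind N p = ind N q"
  shows "p = q"
proof -
  have small: "x = 0" if "\<And>N. N \<ge> n \<Longrightarrow> \<bar>x\<bar> \<le> 1 / real (a N)" "\<And>N. N < a N" for x :: real and a :: "nat \<Rightarrow> nat"
  proof (rule ccontr)
    assume "x \<noteq> 0"
    then obtain N where N: "1 / \<bar>x\<bar> < real N" using reals_Archimedean2 by blast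
    define N' where "N' = max n N"
    have "real N \<le> real (a N')" using that(2)[of N'] by (simp add: N'_def)
    then have "1 / \<bar>x\<bar> < real (a N')" using N by linarith
    then have "1 / real (a N') < \<bar>x\<bar>" using \<open>x \<noteq> 0\<close> that(2)[of N'] by (simp add: field_simps)
    then show False using that(1)[of N'] by (simp add: N'_def)
  qed
  have "\<bar>fst p - fst q\<bar> \<le> 1 / real (h N)" if "N \<ge> n" for N
    using label_eq_imp_cell_eq(1)[OF p, of N] eq[OF that] good_bounds[OF p(1)] good_bounds[OF p(2)]
    by (intro nat_floor_eq_imp_close) (auto simp: col_def)
  then have "fst p - fst q = 0" using h_ge by (rule small)
  moreover have "\<bar>snd p - snd q\<bar> \<le> 1 / real (tow N)" if "N \<ge> n" for N
    using label_eq_imp_cell_eq(2)[OF p, of N] eq[OF that] good_bounds[OF p(1)] good_bounds[OF p(2)]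
    by (intro nat_floor_eq_imp_close) (auto simp: row_def)
  then have "snd p - snd q = 0" using n_less_tow by (rule small)
  ultimately show ?thesis by (simp add: prod_eq_iff)
qed

subsection \<open>Moving points along a tower\<close>

text \<open>The vector that carries the cell of \<open>p\<close> onto the cell at level
  \<open>s\<close> of the same tower. It is rational and depends on \<open>p\<close> only through
  its cell.\<close>

definition shift :: "nat \<Rightarrow> nat \<Rightarrow> real \<times> real \<Rightarrow> real \<times> real" where
  "shift n s p =
     ((real (fst (cellof n (ind n p) s)) - real (col n p)) / real (h n),
      (real (snd (cellof n (ind n p) s)) - real (row n p)) / real (tow n))"

definition move :: "nat \<Rightarrow> nat \<Rightarrow> real \<times> real \<Rightarrow> real \<times> real" where
  "move n s p = p + shift n s p"

lemma shift_rat: "shift n s p \<in> \<rat> \<times> \<rat>"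
  unfolding shift_def by (auto intro!: Rats_divide Rats_diff)

text \<open>The translation moves whole cells of width \<open>1 / a\<close>, so at the finer width
  \<open>1 / (c * a)\<close> the index changes by \<open>c * (e' - e)\<close>. The last claim says
  this additively, to avoid subtraction of naturals.\<close>

lemma translate_floor:
  fixes x :: real and a e e' :: nat
  assumes x: "0 < x" "x < 1" "x \<notin> \<rat>" and e: "e = nat \<lfloor>real a * x\<rfloor>" and e': "e' < a"
  defines "y \<equiv> x + (real e' - real e) / real a"
  shows "0 < y" "y < 1" "y \<notin> \<rat>" "nat \<lfloor>real a * y\<rfloor> = e'"
    and "c > 0 \<Longrightarrow> nat \<lfloor>real (c * a) * y\<rfloor> + c * e = nat \<lfloor>real (c * a) * x\<rfloor> + c * e'"
proof -
  have a: "a > 0" using e' by simp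
  have ay: "real a * y = real a * x - real e + real e'" using a by (simp add: y_def field_simps)
  have e0: "real e = real_of_int \<lfloor>real a * x\<rfloor>" using x a by (simp add: e)
  have fr: "0 \<le> real a * x - real e" "real a * x - real e < 1" unfolding e0 by linarith+
  show irr: "y \<notin> \<rat>"
  proof
    assume "y \<in> \<rat>"
    then have "y - (real e' - real e) / real a \<in> \<rat>" by (intro Rats_diff Rats_divide) auto
    then show False using x by (simp add: y_def)
  qed
  have "0 \<le> real a * y" "real a * y < real a * 1"
    using ay fr e' by (auto simp: less_eq_real_def)
  then have y01: "0 \<le> y" "y < 1"
    using a by (auto simp: zero_le_mult_iff)
  then show "0 < y" "y < 1" using irr by (auto simp: less_le)
  have "\<lfloor>real a * y\<rfloor> = int e'" unfolding ay using fr by linarith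
  then show "nat \<lfloor>real a * y\<rfloor> = e'" by simp
  assume c: "c > 0"
  have "real (c * a) * y = real c * (real a * y)" by simp
  also have "\<dots> = real c * (real a * x) + real c * (real e' - real e)"
    unfolding ay by (simp add: algebra_simps)
  finally have "real (c * a) * y = real (c * a) * x + real_of_int (int c * (int e' - int e))" by simp
  then have "\<lfloor>real (c * a) * y\<rfloor> = \<lfloor>real (c * a) * x\<rfloor> + int c * (int e' - int e)" by linarith
  moreover have "\<lfloor>real (c * a) * y\<rfloor> \<ge> 0" "\<lfloor>real (c * a) * x\<rfloor> \<ge> 0" using y01 x by simp_all
  ultimately show "nat \<lfloor>real (c * a) * y\<rfloor> + c * e = nat \<lfloor>real (c * a) * x\<rfloor> + c * e'"
    by (simp add: algebra_simps flip: of_nat_eq_iff[where 'a = int])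
qed

lemma move_cell:
  assumes p: "p \<in> good" and s: "s < h n"
  shows "move n s p \<in> good" "pos n (move n s p) = s" "ind n (move n s p) = ind n p"
    and "c > 0 \<Longrightarrow> nat \<lfloor>real (c * h n) * fst (move n s p)\<rfloor> + c * col n p =
      nat \<lfloor>real (c * h n) * fst p\<rfloor> + c * fst (cellof n (ind n p) s)"
    and "c > 0 \<Longrightarrow> nat \<lfloor>real (c * tow n) * snd (move n s p)\<rfloor> + c * row n p =
      nat \<lfloor>real (c * tow n) * snd p\<rfloor> + c * snd (cellof n (ind n p) s)"
proof -
  note c = cellof[OF ind_less[OF p, of n] s]
  have p': "0 < fst p" "fst p < 1" "fst p \<notin> \<rat>" "0 < snd p" "snd p < 1" "snd p \<notin> \<rat>"
    using p by (auto simp: good_def irr_def)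
  note X = translate_floor[OF p'(1-3) col_def c(1)]
  note Y = translate_floor[OF p'(4-6) row_def c(2)]
  have fs: "fst (move n s p) = fst p + (real (fst (cellof n (ind n p) s)) - real (col n p)) / real (h n)"
    "snd (move n s p) = snd p + (real (snd (cellof n (ind n p) s)) - real (row n p)) / real (tow n)"
    by (simp_all add: move_def shift_def)
  show "move n s p \<in> good"
    using X(1-3) Y(1-3) unfolding good_def irr_def mem_Times_iff fs by simp
  have col: "col n (move n s p) = fst (cellof n (ind n p) s)" and row: "row n (move n s p) = snd (cellof n (ind n p) s)"
    using X(4) Y(4) unfolding col_def[of n "move n s p"] row_def[of n "move n s p"] fs by simp_all
  show "pos n (move n s p) = s" "ind n (move n s p) = ind n p"
    using c(3,4) by (simp_all add: pos_def ind_def col row)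
  show "c > 0 \<Longrightarrow> nat \<lfloor>real (c * h n) * fst (move n s p)\<rfloor> + c * col n p =
      nat \<lfloor>real (c * h n) * fst p\<rfloor> + c * fst (cellof n (ind n p) s)"
    unfolding fs by (rule X(5))
  show "c > 0 \<Longrightarrow> nat \<lfloor>real (c * tow n) * snd (move n s p)\<rfloor> + c * row n p =
      nat \<lfloor>real (c * tow n) * snd p\<rfloor> + c * snd (cellof n (ind n p) s)"
    unfolding fs by (rule Y(5))
qed

text \<open>By the last claim of \<open>translate_floor\<close> a move at stage \<open>n\<close>
  changes the indices of stage \<open>N + 1\<close> by multiples of \<open>deg N\<close> and
  \<open>slp N\<close> respectively, and so leaves the last digits alone.\<close>

lemma move_digits:
  assumes p: "p \<in> good" and s: "s < h n" and N: "n \<le> N"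
  shows "col (Suc N) (move n s p) mod deg N = col (Suc N) p mod deg N"
    and "row (Suc N) (move n s p) mod slp N = row (Suc N) p mod slp N"
proof -
  obtain c where c: "h N = c * h n" using h_dvd_mono[OF N] by (auto simp: dvd_def mult.commute)
  have c0: "deg N * c > 0" using c h_pos[of N] by (auto intro: gr0I)
  have "h (Suc N) = deg N * c * h n" unfolding h_Suc' c by simp
  then have "col (Suc N) (move n s p) + deg N * c * col n p = col (Suc N) p + deg N * c * fst (cellof n (ind n p) s)"
    using move_cell(4)[OF p s c0] by (simp only: col_def[of "Suc N"])
  then have "(col (Suc N) (move n s p) + deg N * (c * col n p)) mod deg N =
      (col (Suc N) p + deg N * (c * fst (cellof n (ind n p) s))) mod deg N"
    by (simp only: mult.assoc)
  then show "col (Suc N) (move n s p) mod deg N = col (Suc N) p mod deg N"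
    by (simp only: mod_mult_self2)
  have "tow n dvd tow N" using N by (induction N rule: dec_induct) (auto simp: tow_Suc)
  then obtain d where d: "tow N = d * tow n" by (auto simp: dvd_def mult.commute)
  have d0: "slp N * d > 0" using d tow_pos[of N] slp_pos[of N] by (auto intro: gr0I)
  have "tow (Suc N) = slp N * d * tow n" unfolding tow_Suc d by simp
  then have "row (Suc N) (move n s p) + slp N * d * row n p = row (Suc N) p + slp N * d * snd (cellof n (ind n p) s)"
    using move_cell(5)[OF p s d0] by (simp only: row_def[of "Suc N"])
  then have "(row (Suc N) (move n s p) + slp N * (d * row n p)) mod slp N =
      (row (Suc N) p + slp N * (d * snd (cellof n (ind n p) s))) mod slp N"
    by (simp only: mult.assoc)
  then show "row (Suc N) (move n s p) mod slp N = row (Suc N) p mod slp N"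
    by (simp only: mod_mult_self2)
qed

text \<open>The label of stage \<open>N + 1\<close> is computed from that of stage \<open>N\<close>
  and the digits that the move preserves. Consequently all later stages see the same displacement
  along one tower, and the stage at which a point is moved is immaterial.\<close>

lemma move_label:
  assumes p: "p \<in> good" and s: "s < h n" and N: "n \<le> N"
  shows "pos N (move n s p) + pos n p = pos N p + s \<and> ind N (move n s p) = ind N p"
  using N
proof (induction N rule: dec_induct)
  case base
  then show ?case using move_cell(2,3)[OF p s] by simp
next
  case (step N)
  note q = move_cell(1)[OF p s]
  note d = move_digits[OF p s step(1)]
  have pos: "pos (Suc N) z = (col (Suc N) z mod deg N) * h N + pos N z" if "z \<in> good" for z
    using col_div[OF that, of N] by (simp add: pos_def)
  have ind: "ind (Suc N) z = unlab N (ind N z) ((col (Suc N) z mod deg N) div L N) (row (Suc N) z mod slp N) * slp N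
      + row (Suc N) z mod slp N" if "z \<in> good" for z
    using col_div[OF that, of N] row_div[OF that, of N] by (simp add: ind_def)
  show ?case
    unfolding pos[OF p] pos[OF q] ind[OF p] ind[OF q] d using step(3) by simp
qed

text \<open>The first stage at which the point is not on top is used; by \<open>move_label\<close>
  every later stage agrees with the outcome.\<close>

definition up :: "real \<times> real \<Rightarrow> real \<times> real" where
  "up p = (let n = (LEAST n. Suc (pos n p) < h n) in move n (Suc (pos n p)) p)"

definition down :: "real \<times> real \<Rightarrow> real \<times> real" where
  "down p = (let n = (LEAST n. 0 < pos n p) in move n (pos n p - 1) p)"

lemma not_always_top:
  assumes "p \<in> good"
  shows "\<exists>n. Suc (pos n p) < h n"
proof (rule ccontr)
  assume "\<not> ?thesis"
  then have "Suc (pos n p) = h n" for n using pos_less[OF assms, of n] by (metis Suc_lessI)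
  then have c: "Suc (col n p) = h n" for n
    using slab_top[OF col_less[OF assms]] by (simp add: pos_def)
  have "fst p < 1" "0 < fst p" using good_bounds[OF assms] by auto
  obtain n where n: "1 / (1 - fst p) < real n" using reals_Archimedean2 by blast
  have "real n < real (h n)" using h_ge[of n] by simp
  then have "1 < real (h n) * (1 - fst p)"
  proof -
    have "1 < real n * (1 - fst p)" using n \<open>fst p < 1\<close> by (simp add: pos_divide_less_eq)
    also have "\<dots> \<le> real (h n) * (1 - fst p)"
      using \<open>real n < real (h n)\<close> \<open>fst p < 1\<close> by (intro mult_right_mono) auto
    finally show ?thesis .
  qed
  moreover have "real (col n p) \<le> real (h n) * fst p"
    unfolding col_def using \<open>0 < fst p\<close> by simp
  moreover have "real (h n) = real (col n p) + 1" using c[of n] by linarith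
  ultimately show False by (simp add: algebra_simps)
qed

lemma not_always_bottom:
  assumes "p \<in> good"
  shows "\<exists>n. 0 < pos n p"
proof (rule ccontr)
  assume "\<not> ?thesis"
  then have "col n p = 0" for n
    using slab_0_iff[OF col_less[OF assms], of n] by (simp add: pos_def)
  then have "real (h n) * fst p < 1" for n by (simp add: col_def)
  moreover have "0 < fst p" using good_bounds[OF assms] by auto
  ultimately have "real (h n) < 1 / fst p" for n by (simp add: field_simps)
  then have "real n < 1 / fst p" for n using h_ge[of n] by (meson less_trans of_nat_less_iff)
  then show False using reals_Archimedean2[of "1 / fst p"] by (meson less_asym)
qed

lemma up:
  assumes p: "p \<in> good"
  shows "up p \<in> good"
    and "Suc (pos N p) < h N \<Longrightarrow> pos N (up p) = Suc (pos N p) \<and> ind N (up p) = ind N p"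
proof -
  define n where "n = (LEAST n. Suc (pos n p) < h n)"
  have n: "Suc (pos n p) < h n"
    unfolding n_def using not_always_top[OF p] by (rule LeastI_ex)
  have eq: "up p = move n (Suc (pos n p)) p" by (simp add: up_def n_def Let_def)
  show "up p \<in> good" unfolding eq by (rule move_cell(1)[OF p n])
  assume "Suc (pos N p) < h N"
  then have "n \<le> N" unfolding n_def by (rule Least_le)
  from move_label[OF p n this] show "pos N (up p) = Suc (pos N p) \<and> ind N (up p) = ind N p"
    unfolding eq by simp
qed

lemma down:
  assumes p: "p \<in> good"
  shows "down p \<in> good"
    and "0 < pos N p \<Longrightarrow> Suc (pos N (down p)) = pos N p \<and> ind N (down p) = ind N p"
proof -
  define n where "n = (LEAST n. 0 < pos n p)"
  have n: "0 < pos n p"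
    unfolding n_def using not_always_bottom[OF p] by (rule LeastI_ex)
  have n': "pos n p - 1 < h n" using pos_less[OF p, of n] by simp
  have eq: "down p = move n (pos n p - 1) p" by (simp add: down_def n_def Let_def)
  show "down p \<in> good" unfolding eq by (rule move_cell(1)[OF p n'])
  assume "0 < pos N p"
  then have "n \<le> N" unfolding n_def by (rule Least_le)
  from move_label[OF p n' this] n show "Suc (pos N (down p)) = pos N p \<and> ind N (down p) = ind N p"
    unfolding eq by auto
qed

lemma pos_Suc_ge: "p \<in> good \<Longrightarrow> pos n p \<le> pos (Suc n) p"
  using pos_proj[of p n] by (metis mod_less_eq_dividend)

lemma pos_mono:
  assumes "p \<in> good" "n \<le> N"
  shows "pos n p \<le> pos N p"
  using assms(2) by (induction N rule: dec_induct) (auto intro: order_trans[OF _ pos_Suc_ge[OF assms(1)]])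

text \<open>The top level of stage \<open>N + 1\<close> lies in the last copy of its pile, at the
  top level of stage \<open>N\<close>.\<close>

lemma top_mono:
  assumes p: "p \<in> good" and n: "Suc (pos n p) < h n" and N: "n \<le> N"
  shows "Suc (pos N p) < h N"
  using N
proof (induction N rule: dec_induct)
  case (step N)
  show ?case
  proof (rule ccontr)
    assume "\<not> Suc (pos (Suc N) p) < h (Suc N)"
    then have "Suc (pos (Suc N) p) = h (Suc N)" using pos_less[OF p, of "Suc N"] by linarith
    moreover obtain d where d: "deg N = Suc d"
      using L_pos blk_pos by (metis gr0_conv_Suc nat_0_less_mult_iff)
    ultimately have eq: "pos (Suc N) p = d * h N + (h N - 1)"
      using h_pos[of N] unfolding h_Suc' d mult_Suc by linarith
    have "pos N p = h N - 1"
      unfolding pos_proj[OF p, of N] eq by simp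
    then show False using step(3) by simp
  qed
qed (rule n)

lemma down_up:
  assumes p: "p \<in> good"
  shows "down (up p) = p"
proof -
  obtain n where n: "Suc (pos n p) < h n" using not_always_top[OF p] by blast
  show ?thesis
  proof (rule label_separates[OF down(1)[OF up(1)[OF p]] p, where n = n])
    fix N assume "n \<le> N"
    then have "Suc (pos N p) < h N" by (rule top_mono[OF p n])
    note u = up(2)[OF p this]
    then show "pos N (down (up p)) = pos N p \<and> ind N (down (up p)) = ind N p"
      using down(2)[OF up(1)[OF p], of N] by auto
  qed
qed

lemma up_down:
  assumes p: "p \<in> good"
  shows "up (down p) = p"
proof -
  obtain n where n: "0 < pos n p" using not_always_bottom[OF p] by blast
  show ?thesis
  proof (rule label_separates[OF up(1)[OF down(1)[OF p]] p, where n = n])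
    fix N assume "n \<le> N"
    then have "0 < pos N p" using pos_mono[OF p, of n N] n by simp
    note d = down(2)[OF p this]
    then have "Suc (pos N (down p)) < h N" using pos_less[OF p, of N] by simp
    from up(2)[OF down(1)[OF p] this] d
    show "pos N (up (down p)) = pos N p \<and> ind N (up (down p)) = ind N p" by simp
  qed
qed

lemma up_minus_rat: "up p - p \<in> \<rat> \<times> \<rat>"
  using shift_rat by (simp add: up_def Let_def move_def)

end

section \<open>Lebesgue measure on the unit square\<close>

definition sq :: "(real \<times> real) set" where "sq = {0..<1} \<times> {0..<1}"

text \<open>Kept on the whole plane and merely concentrated on \<open>sq\<close>, so that
  measurability remains plain Borel measurability.\<close>

definition sqm :: "(real \<times> real) measure" where "sqm = uniform_measure lborel sq"

lemma sq_borel [measurable]: "sq \<in> sets borel"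
  unfolding sq_def by (intro borel_Times) auto

lemma emeasure_lborel_Times:
  fixes A B :: "real set"
  assumes "A \<in> sets borel" "B \<in> sets borel"
  shows "emeasure lborel (A \<times> B) = emeasure lborel A * emeasure lborel B"
proof -
  have "emeasure (lborel \<Otimes>\<^sub>M lborel) (A \<times> B) = emeasure lborel A * emeasure lborel B"
    using assms by (intro lborel.emeasure_pair_measure_Times) auto
  then show ?thesis by (simp add: lborel_prod)
qed

lemma emeasure_sq: "emeasure lborel sq = 1"
  unfolding sq_def by (subst emeasure_lborel_Times) auto

lemma prob_space_sqm: "prob_space sqm"
  unfolding sqm_def by (rule prob_space_uniform_measure) (auto simp: emeasure_sq)

interpretation sqm: prob_space sqm by (rule prob_space_sqm)

lemma space_sqm [simp]: "space sqm = UNIV" and sets_sqm [simp, measurable_cong]: "sets sqm = sets borel"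
  by (simp_all add: sqm_def)

lemma emeasure_sqm: "A \<in> sets borel \<Longrightarrow> emeasure sqm A = emeasure lborel (sq \<inter> A)"
  unfolding sqm_def by (subst emeasure_uniform_measure) (auto simp: emeasure_sq divide_ennreal_def)

lemma measure_sqm_Times:
  assumes "0 \<le> a" "a \<le> b" "b \<le> 1" "0 \<le> c" "c \<le> d" "d \<le> 1"
  shows "measure sqm ({a..<b} \<times> {c..<d}) = (b - a) * (d - c)"
proof -
  have "sq \<inter> {a..<b} \<times> {c..<d} = {a..<b} \<times> {c..<d}" using assms by (auto simp: sq_def)
  then have "emeasure sqm ({a..<b} \<times> {c..<d}) = ennreal ((b - a) * (d - c))"
    using assms by (subst emeasure_sqm) (auto simp: emeasure_lborel_Times borel_Times ennreal_mult)
  then show ?thesis using assms by (simp add: measure_def)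
qed

text \<open>\<open>G\<close> is cut into countably many pieces according to the displacement
  \<open>T x - x\<close>. On each piece \<open>T\<close> is a translation, and the images are
  disjoint, being determined by the displacement that \<open>T'\<close> undoes. For
  \<open>up\<close> the displacements are rational vectors.\<close>

lemma countable_translations_preserve:
  fixes T T' :: "'a::euclidean_space \<Rightarrow> 'a"
  assumes [measurable]: "T \<in> borel_measurable borel" "T' \<in> borel_measurable borel"
      "G \<in> sets borel" "A \<in> sets borel"
    and W: "countable W" "\<And>x. x \<in> G \<Longrightarrow> T x - x \<in> W"
    and T: "\<And>x. x \<in> G \<Longrightarrow> T x \<in> G" "\<And>x. x \<in> G \<Longrightarrow> T' x \<in> G"
      "\<And>x. x \<in> G \<Longrightarrow> T' (T x) = x" "\<And>x. x \<in> G \<Longrightarrow> T (T' x) = x"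
  shows "emeasure lborel {x \<in> G. T x \<in> A} = emeasure lborel (G \<inter> A)"
proof -
  define P where "P w = {x \<in> G. T x - x = w \<and> T x \<in> A}" for w
  define Q where "Q w = {x \<in> G \<inter> A. x - T' x = w}" for w
  have P [measurable]: "P w \<in> sets borel" for w
  proof -
    have "P w = G \<inter> {x \<in> space borel. T x - x = w \<and> T x \<in> A}" by (auto simp: P_def)
    also have "\<dots> \<in> sets borel" by measurable
    finally show ?thesis .
  qed
  have Q [measurable]: "Q w \<in> sets borel" for w
  proof -
    have "Q w = (G \<inter> A) \<inter> {x \<in> space borel. x - T' x = w}" by (auto simp: Q_def)
    also have "\<dots> \<in> sets borel" by measurable
    finally show ?thesis .
  qed
  have PQ: "emeasure lborel (P w) = emeasure lborel (Q w)" for w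
  proof -
    have "emeasure lborel (Q w) = emeasure (distr lborel borel ((+) w)) (Q w)"
      by (simp add: lborel_distr_plus)
    also have "\<dots> = emeasure lborel ((+) w -` Q w \<inter> space lborel)"
      by (intro emeasure_distr) auto
    also have "(+) w -` Q w \<inter> space lborel = P w"
    proof (intro set_eqI iffI)
      fix x assume "x \<in> (+) w -` Q w \<inter> space lborel"
      then have x: "w + x \<in> G" "w + x \<in> A" "T' (w + x) = x" by (auto simp: Q_def algebra_simps)
      then have "x \<in> G" "T x = w + x" using T(2,4)[of "w + x"] by auto
      then show "x \<in> P w" using x by (simp add: P_def)
    next
      fix x assume x: "x \<in> P w"
      then have "T x = w + x" by (auto simp: P_def algebra_simps)
      then show "x \<in> (+) w -` Q w \<inter> space lborel"
        using x T(1,3)[of x] by (simp add: P_def Q_def)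
    qed
    finally show ?thesis ..
  qed
  have "{x \<in> G. T x \<in> A} = (\<Union>w\<in>W. P w)" using W(2) by (auto simp: P_def)
  moreover have "G \<inter> A = (\<Union>w\<in>W. Q w)"
    using W(2)[OF T(2)] T(4) by (auto simp: Q_def)
  moreover have "emeasure lborel (\<Union>w\<in>W. P w) = (\<integral>\<^sup>+w. emeasure lborel (P w) \<partial>count_space W)"
  proof (rule emeasure_UN_countable)
    show "disjoint_family_on P W" unfolding disjoint_family_on_def P_def by auto
  qed (use W(1) in auto)
  moreover have "emeasure lborel (\<Union>w\<in>W. Q w) = (\<integral>\<^sup>+w. emeasure lborel (Q w) \<partial>count_space W)"
  proof (rule emeasure_UN_countable)
    show "disjoint_family_on Q W" unfolding disjoint_family_on_def Q_def by auto
  qed (use W(1) in auto)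
  ultimately show ?thesis by (simp add: PQ)
qed

lemma fst_borel: "fst \<in> borel_measurable (borel :: (real \<times> real) measure)"
  and snd_borel: "snd \<in> borel_measurable (borel :: (real \<times> real) measure)"
  by (intro borel_measurable_continuous_onI continuous_intros)+

section \<open>Measurability of the moves and full measure of the good points\<close>

context repetitions
begin

lemma irr_borel [measurable]: "irr \<in> sets borel"
  unfolding irr_def using countable_rat by (intro sets.Diff sets.countable[of \<rat>]) auto

lemma emeasure_irr: "emeasure lborel irr = 1"
proof -
  have "emeasure lborel irr = emeasure lborel {0<..<1 :: real}"
    unfolding irr_def
    by (intro emeasure_Diff_null_set countable_imp_null_set_lborel countable_rat) auto
  then show ?thesis by simp
qed

lemma good_borel [measurable]: "good \<in> sets borel"
  unfolding good_def by (intro borel_Times irr_borel)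

lemma prob_good: "measure sqm good = 1"
proof -
  have "sq \<inter> good = good" using good_bounds by (force simp: sq_def)
  moreover have "emeasure lborel good = 1"
    unfolding good_def by (simp add: emeasure_lborel_Times irr_borel emeasure_irr)
  ultimately have "emeasure sqm good = 1" using emeasure_sqm[OF good_borel] by simp
  then show ?thesis by (simp add: measure_def)
qed

lemma col_measurable [measurable]: "col n \<in> measurable borel (count_space UNIV)"
  unfolding col_def using fst_borel by measurable

lemma row_measurable [measurable]: "row n \<in> measurable borel (count_space UNIV)"
  unfolding row_def using snd_borel by measurable

lemma pos_measurable [measurable]: "pos n \<in> measurable borel (count_space UNIV)"
  unfolding pos_def by measurable

lemma ind_measurable [measurable]: "ind n \<in> measurable borel (count_space UNIV)"
proof -
  have "(\<lambda>p. ilab n e (row n p)) \<in> measurable borel (count_space UNIV)" for e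
    by measurable
  then have "(\<lambda>p. ilab n (col n p) (row n p)) \<in> measurable borel (count_space UNIV)"
    by (rule measurable_compose_countable[where g = "col n"]) measurable
  then show ?thesis by (simp add: ind_def[abs_def])
qed

lemma move_measurable:
  assumes [measurable]: "g \<in> measurable borel (count_space UNIV)"
  shows "(\<lambda>p. move n (g p) p) \<in> borel_measurable borel"
proof -
  have fst: "(\<lambda>p. real (fst (cellof n i s)) - real (col n p)) \<in> borel_measurable borel" for i s by measurable
  have snd: "(\<lambda>p. real (snd (cellof n i s)) - real (row n p)) \<in> borel_measurable borel" for i s by measurable
  have "(\<lambda>p. real (fst (cellof n (ind n p) (g p))) - real (col n p)) \<in> borel_measurable borel"
    by (rule measurable_compose_countable[where g = g, OF
        measurable_compose_countable[where g = "ind n", OF fst]]) measurable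
  moreover have "(\<lambda>p. real (snd (cellof n (ind n p) (g p))) - real (row n p)) \<in> borel_measurable borel"
    by (rule measurable_compose_countable[where g = g, OF
        measurable_compose_countable[where g = "ind n", OF snd]]) measurable
  ultimately show ?thesis
    unfolding move_def shift_def by (intro borel_measurable_add borel_measurable_Pair borel_measurable_divide) auto
qed

lemma up_measurable [measurable]: "up \<in> borel_measurable borel"
proof -
  have "(\<lambda>p. LEAST n. Suc (pos n p) < h n) \<in> measurable borel (count_space UNIV)" by measurable
  moreover have "(\<lambda>p. move n (Suc (pos n p)) p) \<in> borel_measurable borel" for n
    by (rule move_measurable) measurable
  ultimately have "(\<lambda>p. move (LEAST n. Suc (pos n p) < h n) (Suc (pos (LEAST n. Suc (pos n p) < h n) p)) p)
      \<in> borel_measurable borel"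
    by (rule measurable_compose_countable[where f = "\<lambda>n p. move n (Suc (pos n p)) p", rotated])
  then show ?thesis by (simp only: up_def[abs_def] Let_def)
qed

lemma down_measurable [measurable]: "down \<in> borel_measurable borel"
proof -
  have "(\<lambda>p. LEAST n. 0 < pos n p) \<in> measurable borel (count_space UNIV)" by measurable
  moreover have "(\<lambda>p. move n (pos n p - 1) p) \<in> borel_measurable borel" for n
    by (rule move_measurable) measurable
  ultimately have "(\<lambda>p. move (LEAST n. 0 < pos n p) (pos (LEAST n. 0 < pos n p) p - 1) p)
      \<in> borel_measurable borel"
    by (rule measurable_compose_countable[where f = "\<lambda>n p. move n (pos n p - 1) p", rotated])
  then show ?thesis by (simp only: down_def[abs_def] Let_def)
qed

end

section \<open>Invariance of Lebesgue measure, measure and density of the cells\<close>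

context repetitions
begin

lemma AE_good: "AE x in sqm. x \<in> good"
  using prob_good sqm.prob_eq_1[of good] by simp

lemma emeasure_sqm_good:
  assumes "A \<in> sets borel"
  shows "emeasure sqm A = emeasure lborel (good \<inter> A)"
proof -
  have "emeasure sqm A = emeasure sqm (good \<inter> A)"
    using AE_good assms by (intro emeasure_eq_AE) auto
  also have "\<dots> = emeasure lborel (sq \<inter> (good \<inter> A))"
    using assms by (intro emeasure_sqm) auto
  also have "sq \<inter> (good \<inter> A) = good \<inter> A" using good_bounds by (force simp: sq_def)
  finally show ?thesis .
qed

lemma measure_sqm_good: "A \<in> sets borel \<Longrightarrow> measure sqm (good \<inter> A) = measure sqm A"
  using AE_good by (intro sqm.finite_measure_eq_AE) auto

lemma emeasure_up:
  assumes "A \<in> sets borel"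
  shows "emeasure lborel {x \<in> good. up x \<in> A} = emeasure lborel (good \<inter> A)"
  using assms up_minus_rat up(1) down(1) down_up up_down
  by (intro countable_translations_preserve[where T' = down and W = "\<rat> \<times> \<rat>"])
     (auto intro!: countable_rat)

lemma good_Collect_borel:
  assumes "Measurable.pred borel P"
  shows "{x \<in> good. P x} \<in> sets borel"
proof -
  have "{x \<in> good. P x} = good \<inter> {x \<in> space borel. P x}" by auto
  also have "\<dots> \<in> sets borel" using assms by measurable
  finally show ?thesis .
qed

lemma cellof_eq:
  assumes "x \<in> good" "i < tow n" "s < h n"
  shows "ind n x = i \<and> pos n x = s \<longleftrightarrow> col n x = fst (cellof n i s) \<and> row n x = snd (cellof n i s)"
proof
  note c = cellof[OF assms(2,3)]
  assume "ind n x = i \<and> pos n x = s"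
  then show "col n x = fst (cellof n i s) \<and> row n x = snd (cellof n i s)"
    using c col_less[OF assms(1)] row_less[OF assms(1)] by (intro label_inj) (auto simp: ind_def pos_def)
next
  assume "col n x = fst (cellof n i s) \<and> row n x = snd (cellof n i s)"
  then show "ind n x = i \<and> pos n x = s"
    using cellof[OF assms(2,3)] by (simp add: ind_def pos_def)
qed

lemma nat_floor_eq_iff:
  assumes "0 \<le> x" "a > 0"
  shows "nat \<lfloor>real a * x\<rfloor> = e \<longleftrightarrow> real e / real a \<le> x \<and> x < real (Suc e) / real a"
proof -
  have "nat \<lfloor>real a * x\<rfloor> = e \<longleftrightarrow> \<lfloor>real a * x\<rfloor> = int e"
    using assms by (auto simp: nat_eq_iff)
  also have "\<dots> \<longleftrightarrow> real e \<le> real a * x \<and> real a * x < real (Suc e)"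
    by (simp add: floor_eq_iff add.commute)
  also have "\<dots> \<longleftrightarrow> real e / real a \<le> x \<and> x < real (Suc e) / real a"
    using assms(2) by (simp add: field_simps)
  finally show ?thesis .
qed

lemma measure_label:
  assumes "i < tow n" "s < h n"
  shows "measure sqm {x \<in> good. ind n x = i \<and> pos n x = s} = 1 / (real (tow n) * real (h n))"
proof -
  define e where "e = fst (cellof n i s)"
  define f where "f = snd (cellof n i s)"
  have ef: "e < h n" "f < tow n" using cellof[OF assms] by (auto simp: e_def f_def)
  let ?R = "{real e / real (h n)..<real (Suc e) / real (h n)} \<times> {real f / real (tow n)..<real (Suc f) / real (tow n)}"
  have "{x \<in> good. ind n x = i \<and> pos n x = s} = {x \<in> good. col n x = e \<and> row n x = f}"
    using cellof_eq[OF _ assms] by (auto simp: e_def f_def)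
  also have "\<dots> = good \<inter> ?R"
  proof (intro set_eqI)
    fix x
    show "x \<in> {x \<in> good. col n x = e \<and> row n x = f} \<longleftrightarrow> x \<in> good \<inter> ?R"
      using good_bounds[of x] nat_floor_eq_iff[of "fst x" "h n" e] nat_floor_eq_iff[of "snd x" "tow n" f]
      by (cases x) (auto simp: col_def row_def)
  qed
  finally have "{x \<in> good. ind n x = i \<and> pos n x = s} = good \<inter> ?R" .
  then have "measure sqm {x \<in> good. ind n x = i \<and> pos n x = s} = measure sqm ?R"
    using measure_sqm_good[of ?R] by (simp add: borel_Times)
  also have "\<dots> = (real (Suc e) / real (h n) - real e / real (h n)) * (real (Suc f) / real (tow n) - real f / real (tow n))"
    using ef by (intro measure_sqm_Times) (auto simp: divide_right_mono)
  also have "\<dots> = 1 / (real (tow n) * real (h n))"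
    by (simp flip: diff_divide_distrib)
  finally show ?thesis .
qed

definition mismatch :: "nat \<Rightarrow> (real \<times> real) set \<Rightarrow> (nat \<times> nat) set \<Rightarrow> (real \<times> real) set" where
  "mismatch n A U = {x \<in> good. (x \<in> A) \<noteq> ((col n x, row n x) \<in> U)}"

lemma mismatch_borel [measurable]:
  assumes [measurable]: "A \<in> sets borel"
  shows "mismatch n A U \<in> sets borel"
  unfolding mismatch_def by (intro good_Collect_borel) measurable

lemma measure_strip:
  assumes "d \<ge> 0"
  shows "measure sqm (sq \<inter> {x. a < fst x \<and> fst x \<le> a + d}) \<le> d"
    and "measure sqm (sq \<inter> {x. a < snd x \<and> snd x \<le> a + d}) \<le> d"
proof -
  have le: "measure sqm (sq \<inter> S) \<le> d" if "sq \<inter> S \<subseteq> A \<times> B" "A \<in> sets borel" "B \<in> sets borel"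
    "emeasure lborel A * emeasure lborel B = ennreal d" for S A B
  proof -
    have "measure sqm (sq \<inter> S) \<le> measure sqm (sq \<inter> (A \<times> B))"
      using that by (intro sqm.finite_measure_mono) (auto intro!: borel_Times)
    also have "emeasure sqm (sq \<inter> (A \<times> B)) \<le> ennreal d"
    proof -
      have "emeasure sqm (sq \<inter> (A \<times> B)) \<le> emeasure lborel (A \<times> B)"
        using that by (subst emeasure_sqm) (auto simp: borel_Times intro!: emeasure_mono)
      then show ?thesis using that by (simp add: emeasure_lborel_Times)
    qed
    then have "measure sqm (sq \<inter> (A \<times> B)) \<le> d"
      using assms by (simp add: sqm.emeasure_eq_measure)
    finally show ?thesis .
  qed
  show "measure sqm (sq \<inter> {x. a < fst x \<and> fst x \<le> a + d}) \<le> d"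
    by (rule le[of _ "{a..a + d}" "{0..<1}"]) (use assms in \<open>auto simp: sq_def\<close>)
  show "measure sqm (sq \<inter> {x. a < snd x \<and> snd x \<le> a + d}) \<le> d"
    by (rule le[of _ "{0..<1}" "{a..a + d}"]) (use assms in \<open>auto simp: sq_def\<close>)
qed

text \<open>The sets that cells approximate form a sigma-algebra. It contains the coordinate
  half-planes, because only the strip of cells meeting the boundary line can be misclassified; a
  countable union is first replaced by a finite one.\<close>

lemma cells_approximate:
  assumes "A \<in> sets borel" "e > 0"
  shows "\<forall>\<^sub>F n in sequentially. \<exists>U. measure sqm (mismatch n A U) < e"
proof -
  have "A \<in> sigma_sets UNIV ((\<lambda>(a, i). {x :: real \<times> real. x \<bullet> i \<le> a}) ` (UNIV \<times> Basis))"
    using assms(1) by (subst (asm) borel_eq_halfspace_le) simp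
  then show ?thesis using assms(2)
  proof (induction arbitrary: e rule: sigma_sets.induct)
    case (Basic A)
    have inv: "\<forall>\<^sub>F n in sequentially. 1 / real n < e"
      using order_tendstoD(2)[OF lim_1_over_n Basic.prems] .
    obtain a i where A: "A = {x. x \<bullet> i \<le> a}" "i = (1, 0) \<or> i = (0, 1)"
      using Basic.hyps by (auto simp: Basis_prod_def)
    define \<pi> :: "real \<times> real \<Rightarrow> real" where "\<pi> = (if i = (1, 0) then fst else snd)"
    have A: "A = {x. \<pi> x \<le> a}" using A by (auto simp: \<pi>_def inner_prod_def)
    have \<pi> [measurable]: "\<pi> \<in> borel_measurable borel"
      using fst_borel snd_borel by (simp add: \<pi>_def)
    show ?case
      using inv eventually_gt_at_top[of 0]
    proof eventually_elim
      case (elim n)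
      define r where "r = (if i = (1, 0) then h n else tow n)"
      define k where "k = (if i = (1, 0) then col n else row n)"
      \<comment> \<open>All strips whose left or lower edge is in the half-plane. Only the strip
        containing the boundary value \<open>a\<close> can then disagree with
        \<open>A\<close>.\<close>
      let ?U = "{(c, d). real (if i = (1, 0) then c else d) \<le> real r * a}"
      have r: "n < r" using h_ge[of n] n_less_tow[of n] by (simp add: r_def)
      have "mismatch n A ?U \<subseteq> sq \<inter> {x. a < \<pi> x \<and> \<pi> x \<le> a + 1 / real r}"
      proof
        fix x assume x: "x \<in> mismatch n A ?U"
        then have "x \<in> good" by (simp add: mismatch_def)
        note b = good_bounds[OF this]
        have c: "real (k x) \<le> real r * \<pi> x" "real r * \<pi> x < real (k x) + 1"
          using b by (auto simp: k_def r_def \<pi>_def col_def row_def)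
        have xU: "\<pi> x \<le> a \<longleftrightarrow> \<not> real (k x) \<le> real r * a"
          using x by (auto simp: mismatch_def A k_def)
        have "a < \<pi> x"
        proof (rule ccontr)
          assume le: "\<not> a < \<pi> x"
          then have "real r * \<pi> x \<le> real r * a" by (intro mult_left_mono) auto
          then show False using c le xU by linarith
        qed
        then have "real r * \<pi> x \<le> real r * a + 1" using c xU by linarith
        then have "\<pi> x \<le> a + 1 / real r" using r by (simp add: field_simps)
        then show "x \<in> sq \<inter> {x. a < \<pi> x \<and> \<pi> x \<le> a + 1 / real r}"
          using \<open>a < \<pi> x\<close> b by (simp add: sq_def mem_Times_iff)
      qed
      then have "measure sqm (mismatch n A ?U) \<le> measure sqm (sq \<inter> {x. a < \<pi> x \<and> \<pi> x \<le> a + 1 / real r})"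
        by (intro sqm.finite_measure_mono) auto
      also have "\<dots> \<le> 1 / real r"
        using measure_strip[of "1 / real r" a] by (auto simp: \<pi>_def)
      also have "\<dots> \<le> 1 / real n" using r elim(2) by (intro divide_left_mono) auto
      finally show ?case using elim(1) by (intro exI[of _ ?U]) simp
    qed
  next
    case Empty
    have "mismatch n {} {} = {}" for n by (simp add: mismatch_def)
    then have "\<exists>U. measure sqm (mismatch n {} U) < e" for n
      using Empty.prems by (intro exI[of _ "{}"]) simp
    then show ?case by (intro always_eventually allI)
  next
    case (Compl A)
    show ?case using Compl.IH[OF Compl.prems]
    proof eventually_elim
      case (elim n)
      then obtain U where "measure sqm (mismatch n A U) < e" by blast
      moreover have "mismatch n (UNIV - A) (- U) = mismatch n A U" by (auto simp: mismatch_def)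
      ultimately show ?case by metis
    qed
  next
    case (Union A)
    have A: "A i \<in> sets borel" for i
      using Union.hyps by (subst borel_eq_halfspace_le) simp
    define B where "B N = (\<Union>i<N. A i)" for N
    have B: "B N \<in> sets borel" for N using A by (auto simp: B_def)
    have "(\<lambda>N. measure sqm (B N)) \<longlonglongrightarrow> measure sqm (\<Union>N. B N)"
      using B by (intro sqm.finite_Lim_measure_incseq) (auto simp: incseq_def B_def, fastforce)
    moreover have "(\<Union>N. B N) = (\<Union>i. A i)" by (auto simp: B_def)
    ultimately have "(\<lambda>N. measure sqm (B N)) \<longlonglongrightarrow> measure sqm (\<Union>i. A i)" by simp
    then have "\<forall>\<^sub>F N in sequentially. measure sqm (\<Union>i. A i) - e / 2 < measure sqm (B N)"
      using Union.prems by (intro order_tendstoD(1)) auto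
    then obtain N where N: "measure sqm (\<Union>i. A i) - e / 2 < measure sqm (B N)"
      by (auto simp: eventually_sequentially)
    \<comment> \<open>The total error \<open>N * d\<close> stays strictly below
      \<open>e / 2\<close>, also for \<open>N = 0\<close>.\<close>
    define d where "d = e / (2 * (real N + 1))"
    have d: "d > 0" using Union.prems by (simp add: d_def)
    have "\<forall>\<^sub>F n in sequentially. \<forall>i\<in>{..<N}. \<exists>U. measure sqm (mismatch n (A i) U) < d"
      using Union.IH[OF d] by (intro eventually_ball_finite) auto
    then show ?case
    proof eventually_elim
      case (elim n)
      then obtain U where U: "\<And>i. i < N \<Longrightarrow> measure sqm (mismatch n (A i) (U i)) < d"
        unfolding Ball_def lessThan_iff by metis
      let ?C = "(\<Union>i. A i) - B N" and ?D = "\<Union>i<N. mismatch n (A i) (U i)"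
      have "mismatch n (\<Union>i. A i) (\<Union>i<N. U i) \<subseteq> ?C \<union> ?D"
        by (auto simp: mismatch_def B_def)
      then have "measure sqm (mismatch n (\<Union>i. A i) (\<Union>i<N. U i)) \<le> measure sqm (?C \<union> ?D)"
        using A B by (intro sqm.finite_measure_mono) auto
      also have "\<dots> \<le> measure sqm ?C + measure sqm ?D"
        using A B by (intro measure_Un_le) auto
      also have "measure sqm ?C = measure sqm (\<Union>i. A i) - measure sqm (B N)"
        using A B by (intro sqm.finite_measure_Diff) (auto simp: B_def)
      also have "measure sqm ?D \<le> (\<Sum>i<N. measure sqm (mismatch n (A i) (U i)))"
        using A by (intro measure_UNION_le) auto
      also have "\<dots> \<le> (\<Sum>i<N. d)" using U by (intro sum_mono) (auto intro: less_imp_le)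
      also have "\<dots> < e / 2" using Union.prems by (simp add: d_def field_simps)
      finally have "measure sqm (mismatch n (\<Union>i. A i) (\<Union>i<N. U i)) < e" using N by linarith
      then show ?case by blast
    qed
  qed
qed

lemma labels_approximate:
  assumes "A \<in> sets borel" "e > 0"
  shows "\<forall>\<^sub>F n in sequentially. \<exists>U. measure sqm {x \<in> good. (x \<in> A) \<noteq> ((ind n x, pos n x) \<in> U)} < e"
  using cells_approximate[OF assms]
proof eventually_elim
  case (elim n)
  then obtain U where U: "measure sqm (mismatch n A U) < e" by blast
  have "cellof n (ind n x) (pos n x) = (col n x, row n x)" if "x \<in> good" for x
    using cellof_eq[OF that ind_less[OF that] pos_less[OF that], of n] by (simp add: prod_eq_iff)
  then have eq: "{x \<in> good. (x \<in> A) \<noteq> ((ind n x, pos n x) \<in> {(i, s). cellof n i s \<in> U})} = mismatch n A U"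
    by (auto simp: mismatch_def)
  show ?case
    by (rule exI[of _ "{(i, s). cellof n i s \<in> U}"]) (use U in \<open>simp only: eq\<close>)
qed

end

section \<open>Transfer to other phase spaces\<close>

text \<open>An isomorphism modulo null sets between a phase space and the unit square. The maps need
  to be inverse to each other only over the open square, which contains \<open>good\<close>.\<close>

locale square_coordinates = prob_space M
  for M :: "'a measure" +
  fixes \<Phi> :: "'a \<Rightarrow> real \<times> real" and \<Psi> :: "real \<times> real \<Rightarrow> 'a"
  assumes \<Phi>_measurable [measurable]: "\<Phi> \<in> measurable M borel"
    and \<Psi>_measurable [measurable]: "\<Psi> \<in> measurable borel M"
    and distr_\<Phi>: "distr M borel \<Phi> = sqm"
    and \<Psi>_\<Phi>: "p \<in> space M \<Longrightarrow> \<Phi> p \<in> {0<..<1} \<times> {0<..<1} \<Longrightarrow> \<Psi> (\<Phi> p) = p"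
    and \<Phi>_\<Psi>: "q \<in> {0<..<1} \<times> {0<..<1} \<Longrightarrow> \<Phi> (\<Psi> q) = q"
begin

lemma emeasure_\<Phi>:
  assumes "A \<in> sets borel"
  shows "emeasure M {p \<in> space M. \<Phi> p \<in> A} = emeasure sqm A"
proof -
  have "{p \<in> space M. \<Phi> p \<in> A} = \<Phi> -` A \<inter> space M" by auto
  then show ?thesis
    using emeasure_distr[OF \<Phi>_measurable assms] by (simp add: distr_\<Phi>)
qed

lemma prob_\<Phi>: "A \<in> sets borel \<Longrightarrow> prob {p \<in> space M. \<Phi> p \<in> A} = measure sqm A"
  using emeasure_\<Phi>[of A] by (simp add: measure_def)

end

locale square_towers = square_coordinates M \<Phi> \<Psi> + repetitions L
  for M :: "'a measure" and \<Phi> \<Psi> L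
begin

definition G :: "'a set" where "G = {p \<in> space M. \<Phi> p \<in> good}"

text \<open>The identity off \<open>G\<close> makes \<open>T\<close> a bijection of the whole space,
  not merely of a set of full measure.\<close>

definition T :: "'a \<Rightarrow> 'a" where "T p = (if p \<in> G then \<Psi> (up (\<Phi> p)) else p)"

definition T' :: "'a \<Rightarrow> 'a" where "T' p = (if p \<in> G then \<Psi> (down (\<Phi> p)) else p)"

lemma good_open: "q \<in> good \<Longrightarrow> q \<in> {0<..<1} \<times> {0<..<1}"
  using good_bounds[of q] by (auto simp: mem_Times_iff)

lemma \<Psi>_space: "\<Psi> q \<in> space M"
  using measurable_space[OF \<Psi>_measurable, of q] by simp

lemma \<Psi>_good: "q \<in> good \<Longrightarrow> \<Psi> q \<in> G \<and> \<Phi> (\<Psi> q) = q"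
  using \<Phi>_\<Psi>[OF good_open, of q] \<Psi>_space[of q] by (simp add: G_def)

lemma \<Psi>_\<Phi>_G: "p \<in> G \<Longrightarrow> \<Psi> (\<Phi> p) = p"
  using \<Psi>_\<Phi>[OF _ good_open, of p] by (simp add: G_def)

lemma G_sets [measurable]: "G \<in> sets M"
  unfolding G_def by measurable

lemma \<Phi>_G: "p \<in> G \<Longrightarrow> \<Phi> p \<in> good" and G_space: "p \<in> G \<Longrightarrow> p \<in> space M"
  by (simp_all add: G_def)

lemma T_G: "p \<in> G \<Longrightarrow> T p \<in> G \<and> \<Phi> (T p) = up (\<Phi> p)"
  using \<Psi>_good[OF up(1)[OF \<Phi>_G]] by (simp add: T_def)

lemma T'_G: "p \<in> G \<Longrightarrow> T' p \<in> G \<and> \<Phi> (T' p) = down (\<Phi> p)"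
  using \<Psi>_good[OF down(1)[OF \<Phi>_G]] by (simp add: T'_def)

lemma T_measurable: "T \<in> measurable M M"
proof -
  have "(\<lambda>p. \<Psi> (up (\<Phi> p))) \<in> measurable M M"
    by (rule measurable_compose[OF measurable_compose[OF \<Phi>_measurable up_measurable] \<Psi>_measurable])
  then show ?thesis
    unfolding T_def by (intro measurable_If_set measurable_ident[unfolded id_def] sets.Int G_sets sets.top)
qed

lemma T'_measurable: "T' \<in> measurable M M"
proof -
  have "(\<lambda>p. \<Psi> (down (\<Phi> p))) \<in> measurable M M"
    by (rule measurable_compose[OF measurable_compose[OF \<Phi>_measurable down_measurable] \<Psi>_measurable])
  then show ?thesis
    unfolding T'_def by (intro measurable_If_set measurable_ident[unfolded id_def] sets.Int G_sets sets.top)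
qed

lemma T'_T: "p \<in> space M \<Longrightarrow> T' (T p) = p"
proof (cases "p \<in> G")
  case True
  then show ?thesis
    using T_G[OF True] down_up[OF \<Phi>_G[OF True]] \<Psi>_\<Phi>_G[OF True] by (simp add: T'_def)
qed (simp add: T_def T'_def)

lemma T_T': "p \<in> space M \<Longrightarrow> T (T' p) = p"
proof (cases "p \<in> G")
  case True
  then show ?thesis
    using T'_G[OF True] up_down[OF \<Phi>_G[OF True]] \<Psi>_\<Phi>_G[OF True] by (simp add: T_def)
qed (simp add: T_def T'_def)

lemma prob_G: "prob G = 1"
  unfolding G_def using prob_\<Phi>[OF good_borel] prob_good by simp

lemma emeasure_G: "A \<in> sets M \<Longrightarrow> emeasure M A = emeasure M (G \<inter> A)"
  using prob_eq_1[OF G_sets] prob_G by (intro emeasure_eq_AE) auto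

lemma distr_T: "distr M M T = M"
proof (rule measure_eqI)
  fix A assume "A \<in> sets (distr M M T)"
  then have A [measurable]: "A \<in> sets M" by simp
  have A' [measurable]: "\<Psi> -` A \<in> sets borel"
    using measurable_sets[OF \<Psi>_measurable A] by simp
  have up_A: "{q \<in> good. up q \<in> \<Psi> -` A} \<in> sets borel"
    by (intro good_Collect_borel) measurable
  have "emeasure (distr M M T) A = emeasure M (T -` A \<inter> space M)"
    by (intro emeasure_distr T_measurable A)
  also have "\<dots> = emeasure M (G \<inter> (T -` A \<inter> space M))"
    by (intro emeasure_G measurable_sets[OF T_measurable A])
  also have "G \<inter> (T -` A \<inter> space M) = {p \<in> space M. \<Phi> p \<in> {q \<in> good. up q \<in> \<Psi> -` A}}"
    by (auto simp: T_def G_def)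
  also have "emeasure M \<dots> = emeasure sqm {q \<in> good. up q \<in> \<Psi> -` A}"
    by (rule emeasure_\<Phi>[OF up_A])
  also have "\<dots> = emeasure lborel (good \<inter> {q \<in> good. up q \<in> \<Psi> -` A})"
    by (rule emeasure_sqm_good[OF up_A])
  also have "good \<inter> {q \<in> good. up q \<in> \<Psi> -` A} = {q \<in> good. up q \<in> \<Psi> -` A}" by auto
  also have "emeasure lborel \<dots> = emeasure lborel (good \<inter> \<Psi> -` A)"
    by (rule emeasure_up[OF A'])
  also have "\<dots> = emeasure lborel (good \<inter> (good \<inter> \<Psi> -` A))" by (simp add: Int_assoc[symmetric])
  also have "\<dots> = emeasure sqm (good \<inter> \<Psi> -` A)"
    by (rule emeasure_sqm_good[symmetric]) measurable
  also have "\<dots> = emeasure M {p \<in> space M. \<Phi> p \<in> good \<inter> \<Psi> -` A}"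
    by (rule emeasure_\<Phi>[symmetric]) measurable
  also have "{p \<in> space M. \<Phi> p \<in> good \<inter> \<Psi> -` A} = G \<inter> A"
    using \<Psi>_\<Phi>_G by (auto simp: G_def)
  also have "emeasure M \<dots> = emeasure M A" by (rule emeasure_G[symmetric, OF A])
  finally show "emeasure (distr M M T) A = emeasure M A" .
qed simp

lemma invertible: "invertible_measure_preserving M T"
  unfolding invertible_measure_preserving_def
proof (intro conjI T_measurable distr_T)
  have T_space: "T p \<in> space M" "T' p \<in> space M" if "p \<in> space M" for p
    using measurable_space[OF T_measurable that] measurable_space[OF T'_measurable that] by auto
  show bij: "bij_betw T (space M) (space M)"
    by (rule bij_betwI[where g = T']) (use T_space T'_T T_T' in auto)
  have "inv_into (space M) T p = T' p" if "p \<in> space M" for p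
    using that T_space bij by (intro inv_into_f_eq T_T') (auto simp: bij_betw_def)
  then show "inv_into (space M) T \<in> measurable M M"
    using T'_measurable by (subst measurable_cong) auto
qed

lemma tower_system: "tower_system L M T G (\<lambda>n p. ind n (\<Phi> p)) (\<lambda>n p. pos n (\<Phi> p))"
proof unfold_locales
  show "T \<in> measurable M M" by (rule T_measurable)
  show "distr M M T = M" by (rule distr_T)
  show "prob {x \<in> G. ind n (\<Phi> x) = i \<and> pos n (\<Phi> x) = j} = 1 / (real (tow n) * real (h n))"
    if "i < tow n" "j < h n" for i n j
  proof -
    have eq: "{x \<in> G. ind n (\<Phi> x) = i \<and> pos n (\<Phi> x) = j} =
        {x \<in> space M. \<Phi> x \<in> {q \<in> good. ind n q = i \<and> pos n q = j}}"
      by (auto simp: G_def)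
    have "{q \<in> good. ind n q = i \<and> pos n q = j} \<in> sets borel"
      by (intro good_Collect_borel) measurable
    from prob_\<Phi>[OF this] show ?thesis unfolding eq measure_label[OF that] .
  qed
  show "\<forall>\<^sub>F n in sequentially. \<exists>U. prob {x \<in> G. (x \<in> A) \<noteq> ((ind n (\<Phi> x), pos n (\<Phi> x)) \<in> U)} < e"
    if A: "A \<in> sets M" and e: "0 < e" for A and e :: real
  proof -
    have A' [measurable]: "\<Psi> -` A \<in> sets borel"
      using measurable_sets[OF \<Psi>_measurable A] by simp
    show ?thesis using labels_approximate[OF A' e]
    proof eventually_elim
      case (elim n)
      then obtain U where U: "measure sqm {q \<in> good. (q \<in> \<Psi> -` A) \<noteq> ((ind n q, pos n q) \<in> U)} < e" by blast
      have eq: "{x \<in> G. (x \<in> A) \<noteq> ((ind n (\<Phi> x), pos n (\<Phi> x)) \<in> U)} =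
          {x \<in> space M. \<Phi> x \<in> {q \<in> good. (q \<in> \<Psi> -` A) \<noteq> ((ind n q, pos n q) \<in> U)}}"
        using \<Psi>_\<Phi>_G by (auto simp: G_def)
      have "{q \<in> good. (q \<in> \<Psi> -` A) \<noteq> ((ind n q, pos n q) \<in> U)} \<in> sets borel"
        by (intro good_Collect_borel) measurable
      from prob_\<Phi>[OF this] show ?case using U unfolding eq[symmetric] by (intro exI[of _ U]) (simp only:)
    qed
  qed
  show "pos n (\<Phi> x) = pos (Suc n) (\<Phi> x) mod h n" if "x \<in> G" for x n
    by (rule pos_proj[OF \<Phi>_G[OF that]])
  show "ind n (\<Phi> x) = lab n (ind (Suc n) (\<Phi> x)) (pos (Suc n) (\<Phi> x) div per n)" if "x \<in> G" for x n
    by (rule ind_proj[OF \<Phi>_G[OF that]])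
  show "ind n (\<Phi> (T x)) = ind n (\<Phi> x) \<and> pos n (\<Phi> (T x)) = Suc (pos n (\<Phi> x))"
    if "x \<in> G" "Suc (pos n (\<Phi> x)) < h n" for x n
    using up(2)[OF \<Phi>_G[OF that(1)] that(2)] T_G[OF that(1)] by simp
  show "prob G = 1" by (rule prob_G)
  show "T x \<in> G" if "x \<in> G" for x using T_G[OF that] ..
  show "ind n (\<Phi> x) < tow n" if "x \<in> G" for x n by (rule ind_less[OF \<Phi>_G[OF that]])
  show "pos n (\<Phi> x) < h n" if "x \<in> G" for x n by (rule pos_less[OF \<Phi>_G[OF that]])
  show "(\<lambda>p. ind n (\<Phi> p)) \<in> measurable M (count_space UNIV)"
    "(\<lambda>p. pos n (\<Phi> p)) \<in> measurable M (count_space UNIV)" for n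
    by measurable
qed (rule G_sets)

end

context square_coordinates
begin

lemma transformation_of_growth:
  fixes u :: ennreal
  assumes ge: "\<And>t. 0 < t \<Longrightarrow> ennreal t < u \<Longrightarrow>
        \<forall>\<^sub>F n in sequentially. (16 * real (reps v n * hgt (reps v) n)) powr t \<le> real (tow n)"
    and le: "\<And>t \<delta>. 0 < t \<Longrightarrow> u < ennreal t \<Longrightarrow> 0 < \<delta> \<Longrightarrow>
        \<exists>\<^sub>F n in sequentially. real (tow n) * real (hgt (reps v) n) \<le> \<delta> * real (reps v n * hgt (reps v) n) powr t"
  shows "\<exists>T. invertible_measure_preserving M T \<and> ergodic M T \<and> rigid M T \<and>
    lower_slow_entropy (\<lambda>n t. real n powr t) M T = u"
proof -
  interpret square_towers M \<Phi> \<Psi> "reps v"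
    by (intro square_towers.intro square_coordinates_axioms repetitions_reps)
  have "lower_slow_entropy (\<lambda>n t. real n powr t) M T = u"
    using tower_system.lower_slow_entropy_le_of_growth[OF tower_system le]
      tower_system.lower_slow_entropy_ge_of_growth[OF tower_system ge]
    by (intro antisym)
  then show ?thesis
    using invertible tower_system.ergodic[OF tower_system]
      tower_system.rigid[OF tower_system filterlim_reps] by blast
qed

text \<open>The repetition numbers make \<open>per n\<close> about \<open>tow n\<close> to the power
  \<open>v n\<close> at the boosted stages, so \<open>v\<close> plays the part of
  \<open>1 / u\<close>: zero for infinite \<open>u\<close>, tending to infinity for
  \<open>u = 0\<close>. In these two extreme cases one of the growth conditions is vacuous.\<close>

lemma exists_transformation:
  fixes u :: ennreal
  shows "\<exists>T. invertible_measure_preserving M T \<and> ergodic M T \<and> rigid M T \<and>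
    lower_slow_entropy (\<lambda>n t. real n powr t) M T = u"
proof -
  show ?thesis
  proof (cases u)
    case top
    show ?thesis
    proof (rule transformation_of_growth[where v = "\<lambda>_. 0"])
      show "\<forall>\<^sub>F n in sequentially. (16 * real (reps (\<lambda>_. 0) n * hgt (reps (\<lambda>_. 0)) n)) powr t \<le> real (tow n)"
        if "0 < t" for t using that by (intro lower_growth) auto
    qed (use top in simp)
  next
    case (real r)
    show ?thesis
    proof (cases "r = 0")
      case True
      show ?thesis
      \<comment> \<open>Any \<open>v\<close> tending to infinity makes \<open>t * v n\<close> exceed
        \<open>1 + \<kappa>\<close> eventually for every positive \<open>t\<close>; linear growth
        also meets the bound in \<open>upper_growth\<close> with \<open>w = 0\<close>.\<close>
      proof (rule transformation_of_growth[where v = real])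
        fix t \<delta> :: real assume t: "0 < t" and \<delta>: "0 < \<delta>"
        have "\<forall>\<^sub>F n in sequentially. real n > 2 / t"
          using filterlim_real_sequentially by (simp add: filterlim_at_top_dense)
        then have "\<forall>\<^sub>F n in sequentially. 1 + 1 \<le> t * real n"
          by eventually_elim (use t in \<open>simp add: field_simps\<close>)
        then show "\<exists>\<^sub>F n in sequentially. real (tow n) * real (hgt (reps real) n) \<le>
            \<delta> * real (reps real n * hgt (reps real) n) powr t"
          using t \<delta> by (intro upper_growth[where w = 0 and \<kappa> = 1]) auto
      qed (use real True in simp)
    next
      case False
      then have r: "r > 0" using real by simp
      show ?thesis
      proof (rule transformation_of_growth[where v = "\<lambda>_. 1 / r"])
        fix t :: real assume t: "0 < t"
        {
          assume "ennreal t < u"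
          then have "t < r" using t real by (simp add: ennreal_less_iff)
          then show "\<forall>\<^sub>F n in sequentially.
              (16 * real (reps (\<lambda>_. 1 / r) n * hgt (reps (\<lambda>_. 1 / r)) n)) powr t \<le> real (tow n)"
            using t r by (intro lower_growth) auto
        next
          fix \<delta> :: real assume "u < ennreal t" and \<delta>: "0 < \<delta>"
          then have "r < t" using real by (simp add: ennreal_less_iff)
          then show "\<exists>\<^sub>F n in sequentially. real (tow n) * real (hgt (reps (\<lambda>_. 1 / r)) n) \<le>
              \<delta> * real (reps (\<lambda>_. 1 / r) n * hgt (reps (\<lambda>_. 1 / r)) n) powr t"
            using t r \<delta> by (intro upper_growth[where w = "1 / r" and \<kappa> = "t / r - 1"]) auto
        }
      qed
    qed
  qed
qed

end

section \<open>Coordinates on the phase spaces\<close>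

lemma phase_space_borel: "X \<in> {torus, disc, annulus} \<Longrightarrow> X \<in> sets borel"
  by (auto simp: torus_def disc_def annulus_def intro!: borel_Times)

lemma measurable_normalized_lebesgue:
  assumes "X \<in> {torus, disc, annulus}"
  shows "f \<in> borel_measurable borel \<Longrightarrow> f \<in> borel_measurable (normalized_lebesgue X)"
    and "g \<in> borel_measurable borel \<Longrightarrow> (\<And>q. g q \<in> X) \<Longrightarrow> g \<in> measurable borel (normalized_lebesgue X)"
proof -
  note s = prob_space_normalized_lebesgue(3)[OF assms]
  show "f \<in> borel_measurable borel \<Longrightarrow> f \<in> borel_measurable (normalized_lebesgue X)"
    by (subst measurable_cong_sets[OF s refl]) (rule measurable_restrict_space1)
  show "g \<in> borel_measurable borel \<Longrightarrow> (\<And>q. g q \<in> X) \<Longrightarrow> g \<in> measurable borel (normalized_lebesgue X)"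
    by (subst measurable_cong_sets[OF refl s]) (auto intro: measurable_restrict_space2)
qed

lemma emeasure_normalized_lebesgue:
  assumes "X \<in> sets borel" "A \<in> sets borel" "A \<subseteq> X"
  shows "emeasure (normalized_lebesgue X) A = emeasure lborel A / emeasure lborel X"
proof -
  have "A \<in> sets (restrict_space lborel X)" "X \<in> sets (restrict_space lborel X)"
    using assms by (auto simp: sets_restrict_space)
  then have "emeasure (normalized_lebesgue X) A =
      emeasure (restrict_space lborel X) (X \<inter> A) / emeasure (restrict_space lborel X) X"
    unfolding normalized_lebesgue_def by (intro emeasure_uniform_measure)
  also have "X \<inter> A = A" using assms(3) by auto
  also have "emeasure (restrict_space lborel X) A = emeasure lborel A"
    using assms by (intro emeasure_restrict_space) auto
  also have "emeasure (restrict_space lborel X) X = emeasure lborel X"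
    using assms by (intro emeasure_restrict_space) auto
  finally show ?thesis .
qed

text \<open>The torus is \<open>sq\<close> itself and the annulus has only a null segment in
  addition, so the identity serves as coordinate map. The value 0 merely keeps the inverse map
  inside \<open>X\<close>.\<close>

lemma square_coordinates_torus_annulus:
  assumes X: "X \<in> {torus, annulus}"
  shows "square_coordinates (normalized_lebesgue X) (\<lambda>p. p) (\<lambda>q. if q \<in> sq then q else 0)"
proof -
  have X': "X \<in> {torus, disc, annulus}" using X by auto
  note XB [measurable] = phase_space_borel[OF X']
  note s = prob_space_normalized_lebesgue[OF X']
  have sub: "sq \<subseteq> X" and zero: "0 \<in> X"
    using X by (auto simp: sq_def torus_def annulus_def zero_prod_def)
  have one: "emeasure lborel X = 1"
    using X by (auto simp: torus_def annulus_def emeasure_lborel_Times)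
  have null: "emeasure lborel (X - sq) = 0"
    using emeasure_Diff[of lborel sq X] sub by (simp add: one emeasure_sq)
  interpret prob_space "normalized_lebesgue X" by (rule s(1))
  show ?thesis
  proof
    show "(\<lambda>p. p) \<in> borel_measurable (normalized_lebesgue X)"
      by (intro measurable_normalized_lebesgue(1)[OF X']) auto
    show "(\<lambda>q. if q \<in> sq then q else 0) \<in> measurable borel (normalized_lebesgue X)"
      using sub zero by (intro measurable_normalized_lebesgue(2)[OF X']) auto
    show "distr (normalized_lebesgue X) borel (\<lambda>p. p) = sqm"
    proof (rule measure_eqI)
      fix A assume "A \<in> sets (distr (normalized_lebesgue X) borel (\<lambda>p. p))"
      then have A [measurable]: "A \<in> sets borel" by simp
      have "emeasure (distr (normalized_lebesgue X) borel (\<lambda>p. p)) A = emeasure (normalized_lebesgue X) (A \<inter> X)"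
        by (subst emeasure_distr) (auto simp: s(2) intro!: measurable_normalized_lebesgue(1)[OF X'])
      also have "\<dots> = emeasure lborel (A \<inter> X)"
        by (subst emeasure_normalized_lebesgue) (auto simp: one divide_ennreal_def)
      also have "\<dots> = emeasure lborel ((sq \<inter> A) \<union> (A \<inter> (X - sq)))"
        using sub by (intro arg_cong[of _ _ "emeasure lborel"]) auto
      also have "\<dots> = emeasure lborel (sq \<inter> A)"
        using null emeasure_mono[of "A \<inter> (X - sq)" "X - sq" lborel]
        by (intro emeasure_Un_null_set) (auto simp: null_sets_def)
      also have "\<dots> = emeasure sqm A" by (rule emeasure_sqm[OF A, symmetric])
      finally show "emeasure (distr (normalized_lebesgue X) borel (\<lambda>p. p)) A = emeasure sqm A" .
    qed simp
  qed (auto simp: sq_def)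
qed

subsection \<open>The disc\<close>

definition half_chord :: "real \<Rightarrow> real" where "half_chord x = sqrt (1 - x\<^sup>2)"

text \<open>The distribution function of the first coordinate of a uniformly distributed point of
  the disc.\<close>

definition dcdf :: "real \<Rightarrow> real" where
  "dcdf t = measure lborel (disc \<inter> {p. fst p \<le> t}) / measure lborel disc"

lemma half_chord_measurable [measurable]: "half_chord \<in> borel_measurable borel"
  unfolding half_chord_def by measurable

lemma half_chord_nonneg: "\<bar>x\<bar> \<le> 1 \<Longrightarrow> 0 \<le> half_chord x" and half_chord_pos: "\<bar>x\<bar> < 1 \<Longrightarrow> 0 < half_chord x"
  by (simp_all add: half_chord_def abs_square_le_1 abs_square_less_1)

lemma mem_disc: "(x, y) \<in> disc \<longleftrightarrow> \<bar>x\<bar> \<le> 1 \<and> - half_chord x \<le> y \<and> y \<le> half_chord x"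
proof -
  have "(x, y) \<in> disc \<longleftrightarrow> x\<^sup>2 + y\<^sup>2 \<le> 1"
    by (simp add: disc_def norm_Pair)
  also have "\<dots> \<longleftrightarrow> \<bar>x\<bar> \<le> 1 \<and> \<bar>y\<bar> \<le> half_chord x"
  proof
    assume le: "x\<^sup>2 + y\<^sup>2 \<le> 1"
    then have "x\<^sup>2 \<le> 1" using zero_le_power2[of y] by linarith
    moreover have "sqrt (y\<^sup>2) \<le> half_chord x" unfolding half_chord_def using le by (intro real_sqrt_le_mono) simp
    ultimately show "\<bar>x\<bar> \<le> 1 \<and> \<bar>y\<bar> \<le> half_chord x" by (simp add: abs_square_le_1)
  next
    assume a: "\<bar>x\<bar> \<le> 1 \<and> \<bar>y\<bar> \<le> half_chord x"
    then have "\<bar>y\<bar>\<^sup>2 \<le> (half_chord x)\<^sup>2" by (intro power_mono) auto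
    also have "(half_chord x)\<^sup>2 = 1 - x\<^sup>2" using a by (simp add: half_chord_def abs_square_le_1)
    finally show "x\<^sup>2 + y\<^sup>2 \<le> 1" by simp
  qed
  finally show ?thesis by (auto simp: abs_le_iff)
qed

lemma disc_borel [measurable]: "disc \<in> sets borel"
  by (simp add: disc_def)

lemma emeasure_disc_finite: "emeasure lborel disc < \<infinity>"
  unfolding disc_def by (rule emeasure_bounded_finite) simp

lemma disc_strip_pos:
  assumes "-1 \<le> s" "s < t" "t \<le> 1"
  shows "0 < measure lborel (disc \<inter> {p. s < fst p \<and> fst p \<le> t})"
proof -
  let ?S = "disc \<inter> {p. s < fst p \<and> fst p \<le> t}"
  let ?U = "ball 0 1 \<inter> ({p :: real \<times> real. s < fst p} \<inter> {p. fst p < t})"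
  have S: "?S \<in> sets borel" using fst_borel by measurable
  have "open ?U"
    by (intro open_Int open_ball open_Collect_less continuous_intros)
  moreover have "((s + t) / 2, 0) \<in> ?U" using assms by (auto simp: norm_Pair)
  ultimately have "\<not> negligible ?U" using open_not_negligible by blast
  moreover have "?U \<subseteq> ?S" by (auto simp: disc_def)
  ultimately have "\<not> negligible ?S" using negligible_subset by blast
  then have "emeasure lborel ?S \<noteq> 0"
    using S by (auto simp: negligible_iff_null_sets null_sets_def intro: null_sets_completionI)
  moreover have "emeasure lborel ?S < \<infinity>"
    using emeasure_disc_finite emeasure_mono[of ?S disc lborel] by (auto intro: le_less_trans)
  ultimately show ?thesis
    by (simp add: measure_def enn2real_positive_iff zero_less_iff_neq_zero)
qed

abbreviation nd :: "(real \<times> real) measure" where "nd \<equiv> normalized_lebesgue disc"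

lemma disc_phase: "disc \<in> {torus, disc, annulus}" by simp

interpretation nd: prob_space nd
  by (rule prob_space_normalized_lebesgue(1)[OF disc_phase])

lemma space_nd: "space nd = disc" and sets_nd: "sets nd = sets (restrict_space borel disc)"
  using prob_space_normalized_lebesgue(2,3)[OF disc_phase] by auto

lemma sets_nd_iff: "A \<in> sets nd \<longleftrightarrow> A \<in> sets borel \<and> A \<subseteq> disc"
  by (simp add: sets_nd sets_restrict_space_iff conj_commute)

lemma measure_disc_pos: "0 < measure lborel disc"
proof -
  have "measure lborel (disc \<inter> {p. -1 < fst p \<and> fst p \<le> 1}) \<le> measure lborel disc"
    using emeasure_disc_finite fst_borel
    by (intro measure_mono_fmeasurable) (auto simp: fmeasurable_def, measurable)
  with disc_strip_pos[of "-1" 1] show ?thesis by simp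
qed

lemma emeasure_disc: "emeasure lborel disc = ennreal (measure lborel disc)"
  using emeasure_disc_finite by (intro emeasure_eq_ennreal_measure) auto

lemma measure_nd:
  assumes "A \<in> sets borel" "A \<subseteq> disc"
  shows "measure nd A = measure lborel A / measure lborel disc"
proof -
  have "emeasure lborel A \<le> emeasure lborel disc" using assms by (intro emeasure_mono) auto
  then have "emeasure lborel A = ennreal (measure lborel A)"
    using emeasure_disc_finite by (intro emeasure_eq_ennreal_measure) (auto simp: top_unique)
  then have "emeasure nd A = ennreal (measure lborel A / measure lborel disc)"
    using emeasure_normalized_lebesgue[OF disc_borel assms] measure_disc_pos
    by (simp add: emeasure_disc divide_ennreal)
  then show ?thesis by (simp add: measure_def)
qed

lemma strip_borel [measurable]: "disc \<inter> {p. s < fst p \<and> fst p \<le> t} \<in> sets borel"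
  "disc \<inter> {p. fst p \<le> t} \<in> sets borel"
  using fst_borel by measurable

lemma dcdf_nd: "dcdf t = measure nd (disc \<inter> {p. fst p \<le> t})"
  unfolding dcdf_def by (rule measure_nd[symmetric]) auto

lemma dcdf_diff:
  assumes "s \<le> t"
  shows "dcdf t - dcdf s = measure nd (disc \<inter> {p. s < fst p \<and> fst p \<le> t})"
proof -
  have "disc \<inter> {p. fst p \<le> t} - disc \<inter> {p. fst p \<le> s} = disc \<inter> {p. s < fst p \<and> fst p \<le> t}" by auto
  moreover have "measure nd (disc \<inter> {p. fst p \<le> t} - disc \<inter> {p. fst p \<le> s}) =
      measure nd (disc \<inter> {p. fst p \<le> t}) - measure nd (disc \<inter> {p. fst p \<le> s})"
    using assms by (intro nd.finite_measure_Diff) (auto simp: sets_nd_iff)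
  ultimately show ?thesis by (simp add: dcdf_nd)
qed

lemma dcdf_mono: "s \<le> t \<Longrightarrow> dcdf s \<le> dcdf t"
  using dcdf_diff[of s t] measure_nonneg[of nd] by (smt (verit))

lemma dcdf_strict:
  assumes "-1 \<le> s" "s < t" "t \<le> 1"
  shows "dcdf s < dcdf t"
proof -
  have "0 < measure nd (disc \<inter> {p. s < fst p \<and> fst p \<le> t})"
    using disc_strip_pos[OF assms] measure_disc_pos by (subst measure_nd) auto
  then show ?thesis using dcdf_diff[of s t] assms by simp
qed

lemma half_chord_le_1: "half_chord x \<le> 1"
  unfolding half_chord_def by simp

text \<open>A vertical strip of the disc lies in a rectangle of height 2. The resulting continuity
  of \<open>dcdf\<close> gives, by the intermediate value theorem, all values between 0 and
  1.\<close>

lemma dcdf_lipschitz: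
  assumes "s \<le> t"
  shows "dcdf t - dcdf s \<le> 2 / measure lborel disc * (t - s)"
proof -
  let ?S = "disc \<inter> {p. s < fst p \<and> fst p \<le> t}"
  have "?S \<subseteq> {s<..t} \<times> {-1..1}"
    using half_chord_le_1 by (auto simp: mem_disc) (smt (verit))+
  then have "emeasure lborel ?S \<le> emeasure lborel ({s<..t} \<times> {-1..1 :: real})"
    by (intro emeasure_mono) (auto intro!: borel_Times)
  also have "\<dots> = ennreal (2 * (t - s))"
    using assms by (subst emeasure_lborel_Times) (auto simp: ennreal_mult[symmetric] algebra_simps simp flip: ennreal_numeral)
  finally have "measure lborel ?S \<le> 2 * (t - s)"
    using assms unfolding measure_def by (intro enn2real_leI) auto
  then have "measure lborel ?S / measure lborel disc \<le> 2 * (t - s) / measure lborel disc"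
    using measure_disc_pos by (intro divide_right_mono) auto
  then show ?thesis
    unfolding dcdf_diff[OF assms] by (subst measure_nd) auto
qed

lemma dcdf_continuous: "continuous_on A dcdf"
proof (rule lipschitz_on_continuous_on)
  show "(2 / measure lborel disc)-lipschitz_on A dcdf"
  proof (rule lipschitz_onI)
    fix x y assume "x \<in> A" "y \<in> A"
    show "dist (dcdf x) (dcdf y) \<le> 2 / measure lborel disc * dist x y"
    proof (cases "x \<le> y")
      case True
      then show ?thesis using dcdf_lipschitz[OF True] dcdf_mono[OF True] by (simp add: dist_real_def)
    next
      case False
      then have "y \<le> x" by simp
      then show ?thesis using dcdf_lipschitz dcdf_mono by (simp add: dist_real_def)
    qed
  qed (use measure_disc_pos in simp)
qed

lemma dcdf_left: "dcdf (-1) = 0"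
proof -
  have "disc \<inter> {p. fst p \<le> -1} \<subseteq> {-1} \<times> {-1..1}"
    using half_chord_le_1 by (auto simp: mem_disc) (smt (verit))+
  then have "emeasure lborel (disc \<inter> {p. fst p \<le> -1}) \<le> emeasure lborel ({-1 :: real} \<times> {-1..1 :: real})"
    by (intro emeasure_mono) (auto intro!: borel_Times)
  also have "\<dots> = 0" by (subst emeasure_lborel_Times) auto
  finally show ?thesis by (simp add: dcdf_def measure_def)
qed

lemma dcdf_right: "dcdf 1 = 1"
proof -
  have "disc \<inter> {p. fst p \<le> 1} = disc" by (auto simp: mem_disc)
  then show ?thesis using measure_disc_pos by (simp add: dcdf_def)
qed

lemma dcdf_le_iff: "x \<in> {-1..1} \<Longrightarrow> y \<in> {-1..1} \<Longrightarrow> dcdf x \<le> dcdf y \<longleftrightarrow> x \<le> y"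
  using dcdf_strict[of y x] dcdf_mono[of x y] by (auto simp: not_le[symmetric])

lemma dcdf_range: "x \<in> {-1..1} \<Longrightarrow> 0 \<le> dcdf x \<and> dcdf x \<le> 1"
  using dcdf_mono[of "-1" x] dcdf_mono[of x 1] by (simp add: dcdf_left dcdf_right)

lemma dcdf_surj:
  assumes "0 \<le> a" "a \<le> 1"
  obtains x where "x \<in> {-1..1}" "dcdf x = a"
  using IVT'[of dcdf "-1" a 1] assms dcdf_continuous by (auto simp: dcdf_left dcdf_right)

text \<open>A supremum rather than a choice of preimage, so that the inverse is monotone on the
  whole line and hence Borel. The inserted -1 keeps the set nonempty for negative arguments.\<close>

definition dinv :: "real \<Rightarrow> real" where
  "dinv a = Sup (insert (-1) {x \<in> {-1..1}. dcdf x \<le> a})"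

lemma dinv_dcdf:
  assumes "x \<in> {-1..1}"
  shows "dinv (dcdf x) = x"
  unfolding dinv_def using assms dcdf_le_iff by (intro cSup_eq_maximum) auto

lemma mono_dinv: "mono dinv"
proof
  fix a b :: real assume "a \<le> b"
  show "dinv a \<le> dinv b"
    unfolding dinv_def
  proof (rule cSup_subset_mono)
    show "bdd_above (insert (-1) {x \<in> {-1..1}. dcdf x \<le> b})"
      by (rule bdd_aboveI[of _ 1]) auto
  qed (use \<open>a \<le> b\<close> in auto)
qed

lemma dinv_measurable [measurable]: "dinv \<in> borel_measurable borel"
  by (rule borel_measurable_mono[OF mono_dinv])

lemma dcdf_measurable [measurable]: "dcdf \<in> borel_measurable borel"
  by (rule borel_measurable_mono) (auto intro!: monoI dcdf_mono)

text \<open>The Rosenblatt transform of the uniform distribution on the disc: the distribution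
  function of the first coordinate, followed by the conditional one of the second, which is uniform
  on a vertical chord.\<close>

definition dPhi :: "real \<times> real \<Rightarrow> real \<times> real" where
  "dPhi p = (dcdf (fst p), (snd p + half_chord (fst p)) / (2 * half_chord (fst p)))"

definition dPsi :: "real \<times> real \<Rightarrow> real \<times> real" where
  "dPsi q = (if q \<in> {0<..<1} \<times> {0<..<1}
     then (dinv (fst q), (2 * snd q - 1) * half_chord (dinv (fst q))) else 0)"

lemma dPhi_measurable [measurable]: "dPhi \<in> borel_measurable borel"
  unfolding dPhi_def using fst_borel snd_borel
  by (intro borel_measurable_Pair measurable_compose[OF _ dcdf_measurable] borel_measurable_divide
      borel_measurable_add borel_measurable_times measurable_compose[OF _ half_chord_measurable]) auto

lemma dPsi_measurable [measurable]: "dPsi \<in> borel_measurable borel"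
proof -
  have "(\<lambda>q. (dinv (fst q), (2 * snd q - 1) * half_chord (dinv (fst q)))) \<in> borel_measurable borel"
    using fst_borel snd_borel
    by (intro borel_measurable_Pair borel_measurable_times borel_measurable_diff
      measurable_compose[OF _ half_chord_measurable] measurable_compose[OF _ dinv_measurable]) auto
  moreover have "{0<..<1} \<times> {0<..<1 :: real} \<in> sets (borel :: (real \<times> real) measure)"
    by (intro borel_Times) auto
  ultimately show ?thesis
    unfolding dPsi_def by (intro measurable_If_set) auto
qed

lemma dinv_open:
  assumes "0 < a" "a < 1"
  shows "\<bar>dinv a\<bar> < 1" "dcdf (dinv a) = a"
proof -
  obtain x where x: "x \<in> {-1..1}" "dcdf x = a" using dcdf_surj[of a] assms by auto
  then have "dinv a = x" using dinv_dcdf by auto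
  moreover have "x \<noteq> -1" "x \<noteq> 1" using x assms by (auto simp: dcdf_left dcdf_right)
  ultimately show "\<bar>dinv a\<bar> < 1" "dcdf (dinv a) = a" using x by auto
qed

lemma dPsi_disc: "dPsi q \<in> disc"
proof (cases "q \<in> {0<..<1} \<times> {0<..<1}")
  case True
  then have q: "0 < fst q" "fst q < 1" "0 < snd q" "snd q < 1" by (auto simp: mem_Times_iff)
  note d = dinv_open[OF q(1,2)]
  have "(- 1) * half_chord (dinv (fst q)) \<le> (2 * snd q - 1) * half_chord (dinv (fst q))"
    "(2 * snd q - 1) * half_chord (dinv (fst q)) \<le> 1 * half_chord (dinv (fst q))"
    using q half_chord_pos[OF d(1)] by (intro mult_right_mono; simp)+
  then show ?thesis using True d by (simp add: dPsi_def mem_disc)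
next
  case False
  have "(0, 0) \<in> disc" by (simp add: disc_def zero_prod_def[symmetric])
  then show ?thesis using False by (simp add: dPsi_def zero_prod_def)
qed

lemma dPhi_dPsi:
  assumes "q \<in> {0<..<1} \<times> {0<..<1}"
  shows "dPhi (dPsi q) = q"
proof -
  have q: "0 < fst q" "fst q < 1" using assms by (auto simp: mem_Times_iff)
  note d = dinv_open[OF q]
  have "((2 * snd q - 1) * half_chord (dinv (fst q)) + half_chord (dinv (fst q))) / (2 * half_chord (dinv (fst q))) = snd q"
    using half_chord_pos[OF d(1)] by (simp add: field_simps)
  then show ?thesis using assms d by (simp add: dPhi_def dPsi_def prod_eq_iff)
qed

lemma dPsi_dPhi:
  assumes "p \<in> disc" "dPhi p \<in> {0<..<1} \<times> {0<..<1}"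
  shows "dPsi (dPhi p) = p"
proof -
  obtain x y where p: "p = (x, y)" by fastforce
  have x: "x \<in> {-1..1}" using assms(1) by (auto simp: p mem_disc)
  have "x \<noteq> -1" "x \<noteq> 1" using assms(2) by (auto simp: p dPhi_def dcdf_left dcdf_right)
  then have "\<bar>x\<bar> < 1" using x by auto
  then have "(2 * ((y + half_chord x) / (2 * half_chord x)) - 1) * half_chord x = y"
    using half_chord_pos[of x] by (simp add: field_simps)
  then show ?thesis using assms(2) dinv_dcdf[OF x] by (simp add: dPsi_def p dPhi_def)
qed

text \<open>By Fubini: the lower fraction \<open>b\<close> of the chord over \<open>x\<close> has
  length \<open>b * (2 * half_chord x)\<close>, and \<open>b\<close> factors out of the
  integral.\<close>

lemma emeasure_disc_below:
  assumes S: "S \<in> sets borel" and b: "0 \<le> b"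
  shows "emeasure lborel {p. fst p \<in> S \<and> \<bar>fst p\<bar> \<le> 1 \<and> - half_chord (fst p) \<le> snd p \<and> snd p \<le> (2 * b - 1) * half_chord (fst p)} =
    ennreal b * (\<integral>\<^sup>+x. ennreal (2 * half_chord x) * indicator (S \<inter> {-1..1}) x \<partial>lborel)"
    (is "emeasure lborel ?A = _")
proof -
  note [measurable] = S fst_borel snd_borel
  have A: "?A \<in> sets borel"
  proof -
    have "?A = {p \<in> space borel. fst p \<in> S \<and> \<bar>fst p\<bar> \<le> 1 \<and> - half_chord (fst p) \<le> snd p \<and> snd p \<le> (2 * b - 1) * half_chord (fst p)}"
      by simp
    also have "\<dots> \<in> sets borel" by measurable
    finally show ?thesis .
  qed
  have "emeasure lborel ?A = emeasure (lborel \<Otimes>\<^sub>M lborel) ?A" by (simp add: lborel_prod)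
  also have "\<dots> = (\<integral>\<^sup>+x. emeasure lborel (Pair x -` ?A) \<partial>lborel)"
  proof (rule lborel.emeasure_pair_measure_alt)
    show "?A \<in> sets (lborel \<Otimes>\<^sub>M lborel)" unfolding lborel_prod using A by (simp only: sets_lborel)
  qed
  also have "\<dots> = (\<integral>\<^sup>+x. ennreal b * (ennreal (2 * half_chord x) * indicator (S \<inter> {-1..1}) x) \<partial>lborel)"
  proof (intro nn_integral_cong)
    fix x :: real
    show "emeasure lborel (Pair x -` ?A) = ennreal b * (ennreal (2 * half_chord x) * indicator (S \<inter> {-1..1}) x)"
    proof (cases "x \<in> S \<inter> {-1..1}")
      case True
      then have x: "\<bar>x\<bar> \<le> 1" by auto
      have "Pair x -` ?A = {- half_chord x..(2 * b - 1) * half_chord x}" using True x by auto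
      moreover have "- half_chord x \<le> (2 * b - 1) * half_chord x"
        using mult_right_mono[of "-1" "2 * b - 1" "half_chord x"] half_chord_nonneg[OF x] b by simp
      ultimately have "emeasure lborel (Pair x -` ?A) = ennreal (b * (2 * half_chord x))"
        by (simp add: algebra_simps)
      then show ?thesis using True b half_chord_nonneg[OF x] by (simp add: ennreal_mult)
    next
      case False
      then have e: "Pair x -` ?A = {}" by (auto simp: abs_le_iff)
      show ?thesis unfolding e using False by simp
    qed
  qed
  also have "\<dots> = ennreal b * (\<integral>\<^sup>+x. ennreal (2 * half_chord x) * indicator (S \<inter> {-1..1}) x \<partial>lborel)"
    by (intro nn_integral_cmult) measurable
  finally show ?thesis .
qed

text \<open>With \<open>dcdf t = a\<close>, the set is, up to a null set, the lower fraction
  \<open>b\<close> of all chords up to abscissa \<open>t\<close>. By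
  \<open>emeasure_disc_below\<close> its share of the disc is \<open>b\<close> times that of the
  full strip, which is \<open>a\<close>.\<close>

lemma measure_dPhi_atMost:
  assumes ab: "0 \<le> a" "a \<le> 1" "0 \<le> b" "b \<le> 1"
  shows "measure nd {p \<in> disc. dPhi p \<le> (a, b)} = a * b"
proof -
  obtain t where t: "t \<in> {-1..1}" "dcdf t = a" using dcdf_surj[OF ab(1,2)] .
  let ?A = "\<lambda>b. {p. fst p \<in> {..t} \<and> \<bar>fst p\<bar> \<le> 1 \<and> - half_chord (fst p) \<le> snd p \<and> snd p \<le> (2 * b - 1) * half_chord (fst p)}"
  have A1: "?A 1 = disc \<inter> {p. fst p \<le> t}" by (auto simp: mem_disc)
  have "?A b \<subseteq> ?A 1"
  proof -
    have "(2 * b - 1) * half_chord x \<le> (2 * 1 - 1) * half_chord x" if "\<bar>x\<bar> \<le> 1" for x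
      using ab half_chord_nonneg[OF that] by (intro mult_right_mono) auto
    then show ?thesis by fastforce
  qed
  then have A_sub: "?A b \<subseteq> disc" unfolding A1 by auto
  have "emeasure lborel (?A b) = ennreal b * emeasure lborel (?A 1)"
    using ab by (subst (1 2) emeasure_disc_below) auto
  then have "measure lborel (?A b) = b * measure lborel (?A 1)"
    using ab by (simp add: measure_def enn2real_mult)
  then have Ab: "measure lborel (?A b) / measure lborel disc = a * b"
    using t(2) unfolding A1 dcdf_def by (simp flip: times_divide_eq_right)
  let ?B = "{p \<in> disc. dPhi p \<le> (a, b)}"
  have B: "?B \<in> sets borel"
  proof -
    have "?B = disc \<inter> dPhi -` {..(a, b)}" by auto
    also have "\<dots> \<in> sets borel"
      using measurable_sets_borel[OF dPhi_measurable] by (intro sets.Int disc_borel) auto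
    finally show ?thesis .
  qed
  have A: "?A b \<in> sets borel"
  proof -
    note [measurable] = fst_borel snd_borel
    have "?A b = {p \<in> space borel. fst p \<le> t \<and> \<bar>fst p\<bar> \<le> 1 \<and> - half_chord (fst p) \<le> snd p \<and> snd p \<le> (2 * b - 1) * half_chord (fst p)}"
      by auto
    also have "\<dots> \<in> sets borel" by measurable
    finally show ?thesis .
  qed
  have iff: "p \<in> ?B \<longleftrightarrow> p \<in> ?A b" if "fst p \<notin> {-1, 1}" "p \<in> disc" for p
  proof -
    obtain x y where p: "p = (x, y)" by fastforce
    have x: "x \<in> {-1..1}" "\<bar>x\<bar> < 1" and y: "- half_chord x \<le> y" using that by (auto simp: p mem_disc)
    have "(y + half_chord x) / (2 * half_chord x) \<le> b \<longleftrightarrow> y \<le> (2 * b - 1) * half_chord x"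
      using half_chord_pos[OF x(2)] by (simp add: pos_divide_le_eq algebra_simps)
    moreover have "dcdf x \<le> a \<longleftrightarrow> x \<le> t" unfolding t(2)[symmetric] by (rule dcdf_le_iff[OF x(1) t(1)])
    ultimately show ?thesis using x y that by (auto simp: p dPhi_def less_eq_prod_def)
  qed
  \<comment> \<open>At the abscissas -1 and 1 the chord degenerates and \<open>dPhi\<close> divides
    by zero; these two lines are null.\<close>
  have "AE p :: real \<times> real in lborel. fst p \<notin> {-1, 1}"
  proof -
    have "emeasure lborel {-1, 1 :: real} = 0" by (intro emeasure_lborel_countable) auto
    then have "{-1, 1 :: real} \<times> (UNIV :: real set) \<in> null_sets lborel"
      by (auto simp: null_sets_def emeasure_lborel_Times intro!: borel_Times)
    then show ?thesis by (rule AE_I') auto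
  qed
  then have "AE p in lborel. p \<in> ?B \<longleftrightarrow> p \<in> ?A b"
  proof eventually_elim
    case (elim p)
    show ?case
    proof (cases "p \<in> disc")
      case False
      then show ?thesis using A_sub by blast
    qed (rule iff[OF elim])
  qed
  then have "measure lborel ?B = measure lborel (?A b)"
    using A B by (intro measure_eq_AE) (simp_all only: sets_lborel)
  moreover have "measure nd ?B = measure lborel ?B / measure lborel disc"
    using B by (intro measure_nd) auto
  ultimately show ?thesis using Ab by simp
qed

lemma measure_sqm_atMost:
  assumes "0 \<le> a" "a \<le> 1" "0 \<le> b" "b \<le> 1"
  shows "measure sqm {..(a, b)} = a * b"
proof -
  have half: "emeasure lborel ({0..<1} \<inter> {..c}) = ennreal c" if "0 \<le> c" "c \<le> 1" for c :: real
  proof (cases "c = 1")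
    case True
    then have "{0..<1} \<inter> {..c} = {0..<1}" by auto
    then show ?thesis using True by simp
  next
    case False
    then have "{0..<1} \<inter> {..c} = {0..c}" using that by auto
    then show ?thesis using that by simp
  qed
  have "sq \<inter> {..(a, b)} = ({0..<1} \<inter> {..a}) \<times> ({0..<1} \<inter> {..b})"
    by (auto simp: sq_def less_eq_prod_def)
  then have "emeasure sqm {..(a, b)} = ennreal (a * b)"
    using assms by (simp add: emeasure_sqm emeasure_lborel_Times half ennreal_mult)
  then show ?thesis using assms by (simp add: measure_def)
qed

text \<open>Lower left quadrants form a generator stable under intersection, so agreement on them
  determines the measure.\<close>

lemma distr_dPhi: "distr nd borel dPhi = sqm"
proof (rule measure_eqI_generator_eq[where E = "range (\<lambda>a. {..a})" and \<Omega> = UNIV and A = "\<lambda>n. {..(real n, real n)}"])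
  have dPhi_nd: "dPhi \<in> borel_measurable nd"
    by (intro measurable_normalized_lebesgue(1)[OF disc_phase] dPhi_measurable)
  interpret D: prob_space "distr nd borel dPhi" by (rule nd.prob_space_distr[OF dPhi_nd])
  show "Int_stable (range (\<lambda>a :: real \<times> real. {..a}))"
  proof -
    have "{..a} \<inter> {..b} = {..inf a b}" for a b :: "real \<times> real" by auto
    then show ?thesis by (auto simp: Int_stable_def)
  qed
  show "emeasure (distr nd borel dPhi) X = emeasure sqm X"
    if X: "X \<in> range (\<lambda>a. {..a})" for X
  proof -
    obtain a b where ab: "X = {..(a, b)}" using X by auto
    have XB: "X \<in> sets borel" unfolding ab by simp
    have D: "measure (distr nd borel dPhi) X = measure nd {p \<in> disc. dPhi p \<le> (a, b)}"
      unfolding measure_distr[OF dPhi_nd XB] space_nd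
      unfolding ab by (intro arg_cong[of _ _ "measure nd"]) auto
    have range: "0 \<le> fst (dPhi p) \<and> fst (dPhi p) \<le> 1 \<and> 0 \<le> snd (dPhi p) \<and> snd (dPhi p) \<le> 1"
      if "p \<in> disc" for p
    proof -
      obtain x y where p: "p = (x, y)" by fastforce
      have x: "x \<in> {-1..1}" "\<bar>x\<bar> \<le> 1" and y: "- half_chord x \<le> y" "y \<le> half_chord x"
        using that by (auto simp: p mem_disc)
      then show ?thesis
        using dcdf_range[OF x(1)] half_chord_nonneg[OF x(2)]
        by (auto simp: p dPhi_def divide_le_eq_1 intro!: divide_nonneg_nonneg)
    qed
    have "measure (distr nd borel dPhi) X = measure sqm X"
    proof (cases "a < 0 \<or> b < 0")
      case True
      then have e: "{p \<in> disc. dPhi p \<le> (a, b)} = {}" using range by (fastforce simp: less_eq_prod_def)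
      have "sq \<inter> {..(a, b)} = {}" using True by (auto simp: sq_def less_eq_prod_def)
      then have "emeasure sqm X = 0" unfolding ab by (subst emeasure_sqm) auto
      then show ?thesis unfolding D e by (simp add: measure_def)
    next
      \<comment> \<open>Both measures are concentrated on the closed unit square, so a corner beyond
        1 may be cut back to 1.\<close>
      case False
      let ?a = "min a 1" and ?b = "min b 1"
      have r: "0 \<le> ?a" "?a \<le> 1" "0 \<le> ?b" "?b \<le> 1" using False by auto
      have "{p \<in> disc. dPhi p \<le> (a, b)} = {p \<in> disc. dPhi p \<le> (?a, ?b)}"
        using range by (auto simp: less_eq_prod_def)
      then have "measure (distr nd borel dPhi) X = ?a * ?b"
        unfolding D by (simp only: measure_dPhi_atMost[OF r])
      moreover have "sq \<inter> {..(a, b)} = sq \<inter> {..(?a, ?b)}" by (auto simp: sq_def less_eq_prod_def)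
      then have "emeasure sqm {..(a, b)} = emeasure sqm {..(?a, ?b)}" by (simp add: emeasure_sqm)
      then have "measure sqm X = ?a * ?b"
        unfolding ab using measure_sqm_atMost[OF r] by (simp add: measure_def)
      ultimately show ?thesis by simp
    qed
    then show ?thesis by (simp add: D.emeasure_eq_measure sqm.emeasure_eq_measure)
  qed
  show "sets (distr nd borel dPhi) = sigma_sets UNIV (range (\<lambda>a :: real \<times> real. {..a}))"
    "sets sqm = sigma_sets UNIV (range (\<lambda>a :: real \<times> real. {..a}))"
    by (simp_all add: borel_eq_atMost)
  show "emeasure (distr nd borel dPhi) {..(real n, real n)} \<noteq> \<infinity>" for n
    using D.emeasure_finite by simp
  show "(\<Union>n. {..(real n, real n)}) = UNIV"
  proof (intro equalityI subset_UNIV subsetI)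
    fix p :: "real \<times> real"
    obtain n where "max (fst p) (snd p) \<le> real n" using real_arch_simple by blast
    then show "p \<in> (\<Union>n. {..(real n, real n)})" by (auto simp: less_eq_prod_def)
  qed
qed auto

lemma square_coordinates_disc: "square_coordinates nd dPhi dPsi"
proof
  show "dPhi \<in> borel_measurable nd"
    by (intro measurable_normalized_lebesgue(1)[OF disc_phase] dPhi_measurable)
  show "dPsi \<in> measurable borel nd"
    by (intro measurable_normalized_lebesgue(2)[OF disc_phase] dPsi_measurable dPsi_disc)
  show "distr nd borel dPhi = sqm" by (rule distr_dPhi)
qed (auto simp: space_nd dPsi_dPhi dPhi_dPsi)

theorem theorem1p3:
  fixes X :: "(real \<times> real) set" and u :: ennreal
  assumes "X \<in> {torus, disc, annulus}"
  shows "\<exists>T. invertible_measure_preserving (normalized_lebesgue X) T \<and>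
             ergodic (normalized_lebesgue X) T \<and>
             rigid (normalized_lebesgue X) T \<and>
             lower_slow_entropy (\<lambda>n t. real n powr t) (normalized_lebesgue X) T = u"
proof -
  have "\<exists>\<Phi> \<Psi>. square_coordinates (normalized_lebesgue X) \<Phi> \<Psi>"
    using assms square_coordinates_disc square_coordinates_torus_annulus by (cases "X = disc") blast+
  then obtain \<Phi> \<Psi> where "square_coordinates (normalized_lebesgue X) \<Phi> \<Psi>" by blast
  then show ?thesis by (rule square_coordinates.exists_transformation)
qed

end
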